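(* Let $a,d\in\mathbb{R}$ and $A_4=\begin{pmatrix} a & -1\\ 1 & d\end{pmatrix}$. The following statements are true. (a) If $ad=-1$, then $\mathrm{Spec}(A_4D)=\mathbb{C}$. (b) If $ad<-1$, then $\mathrm{Spec}(A_4D)\subset\mathbb{R}$ and $A_4D$ is similar to a self-adjoint operator whose numerical range is the whole real line.
   Context: Let $W^{2,2}$ be the Sobolev space of all $f\in L^2(0,1)\otimes\mathbb{C}^2$ whose generalized derivative $f''$ lies in $L^2(0,1)\otimes\mathbb{C}^2$, and write $f=\begin{pmatrix}\phi\\ \gamma\end{pmatrix}$. The operator $D$ acts on $L^2(0,1)\otimes\mathbb{C}^2$ by $Df=-f''$ with domain $\mathrm{Dom}(D)=\{f\in W^{2,2}:\phi(0)=\phi(1)=0,\ \gamma'(0)=\gamma'(1)=0\}$. For a constant $2\times2$ matrix $A$, $AD$ is the operator $f\mapsto -Af''$ with domain $\mathrm{Dom}(D)$. $\mathrm{Spec}(K)$ denotes the spectrum of $K$, i.e. the complement of the set of $z$ for which $K-z$ is a bijection from $\mathrm{Dom}(K)$ onto the Hilbert space with bounded inverse (so an operator that is not closed has spectrum $\mathbb{C}$). The numerical range of $K$ is $\{\langle Kf,f\rangle: f\in\mathrm{Dom}(K),\ \|f\|=1\}$. Two operators $K,L$ are similar if $K=ULU^{-1}$ (with matching domains) for some bounded invertible operator $U$ with bounded inverse. *)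

theory Defs
  imports "HOL-Analysis.Analysis"
begin

abbreviation unit_meas :: "real measure" where
  "unit_meas \<equiv> lebesgue_on {0<..<1}"

definition square_integrable :: "(real \<Rightarrow> complex ^ 2) \<Rightarrow> bool" where
  "square_integrable f \<longleftrightarrow>
     f \<in> borel_measurable unit_meas \<and> integrable unit_meas (\<lambda>x. (norm (f x))\<^sup>2)"

definition L2_rel :: "(real \<Rightarrow> complex ^ 2) \<Rightarrow> (real \<Rightarrow> complex ^ 2) \<Rightarrow> bool" where
  "L2_rel f g \<longleftrightarrow> square_integrable f \<and> square_integrable g \<and> (AE x in unit_meas. f x = g x)"

lemma square_integrable_zero: "square_integrable (\<lambda>x. 0)"
  by (simp add: square_integrable_def)

lemma norm_vector_scalar_mult:
  fixes v :: "complex ^ 2"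
  shows "norm (c *s v) = norm c * norm v"
  by (simp add: norm_vec_def L2_set_def norm_mult power_mult_distrib real_sqrt_mult
      flip: sum_distrib_left)

lemma borel_measurable_vec2I:
  fixes f :: "real \<Rightarrow> complex ^ 2"
  assumes "\<And>i. (\<lambda>x. f x $ i) \<in> borel_measurable M"
  shows "f \<in> borel_measurable M"
proof -
  have "(\<lambda>x. f x \<bullet> b) \<in> borel_measurable M" if "b \<in> Basis" for b
  proof -
    have "(\<lambda>x. f x \<bullet> b) = (\<lambda>x. \<Sum>i\<in>UNIV. f x $ i \<bullet> b $ i)"
      by (simp add: inner_vec_def)
    then show ?thesis using assms by simp
  qed
  then show ?thesis using borel_measurable_euclidean_space by blast
qed

lemma borel_measurable_vec2_nth:
  fixes f :: "real \<Rightarrow> complex ^ 2"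
  assumes "f \<in> borel_measurable M"
  shows "(\<lambda>x. f x $ i) \<in> borel_measurable M"
proof -
  have "(\<lambda>v :: complex ^ 2. v $ i) \<in> borel_measurable borel"
    by (intro borel_measurable_continuous_onI continuous_intros)
  from measurable_compose[OF assms this] show ?thesis .
qed

lemma square_integrable_add:
  assumes "square_integrable f" "square_integrable g"
  shows "square_integrable (\<lambda>x. f x + g x)"
proof -
  have m: "f \<in> borel_measurable unit_meas" "g \<in> borel_measurable unit_meas"
    using assms by (auto simp: square_integrable_def)
  have "integrable unit_meas (\<lambda>x. 2 * (norm (f x))\<^sup>2 + 2 * (norm (g x))\<^sup>2)"
    using assms by (auto simp: square_integrable_def)
  then have "integrable unit_meas (\<lambda>x. (norm (f x + g x))\<^sup>2)"
  proof (rule Bochner_Integration.integrable_bound)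
    show "(\<lambda>x. (norm (f x + g x))\<^sup>2) \<in> borel_measurable unit_meas"
      using m by measurable
    show "AE x in unit_meas. norm ((norm (f x + g x))\<^sup>2)
            \<le> norm (2 * (norm (f x))\<^sup>2 + 2 * (norm (g x))\<^sup>2)"
    proof (rule AE_I2)
      fix x
      have "(norm (f x + g x))\<^sup>2 \<le> (norm (f x) + norm (g x))\<^sup>2"
        by (intro power_mono norm_triangle_ineq) auto
      also have "\<dots> \<le> 2 * (norm (f x))\<^sup>2 + 2 * (norm (g x))\<^sup>2"
        using sum_squares_bound[of "norm (f x)" "norm (g x)"] by (simp add: power2_sum)
      finally show "norm ((norm (f x + g x))\<^sup>2)
            \<le> norm (2 * (norm (f x))\<^sup>2 + 2 * (norm (g x))\<^sup>2)" by simp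
    qed
  qed
  then show ?thesis using m by (auto simp: square_integrable_def)
qed

lemma square_integrable_matrix:
  fixes A :: "complex ^ 2 ^ 2"
  assumes "square_integrable f"
  shows "square_integrable (\<lambda>x. A *v f x)"
proof -
  have m: "f \<in> borel_measurable unit_meas"
    using assms by (auto simp: square_integrable_def)
  have "linear ((*v) A)"
    by (intro linearI)
      (simp_all add: vec_eq_iff matrix_vector_mult_def scaleR_sum_right distrib_left sum.distrib)
  then have bl: "bounded_linear ((*v) A)"
    by (simp add: linear_conv_bounded_linear)
  then obtain C where C: "\<And>v. norm (A *v v) \<le> norm v * C"
    using bounded_linear.bounded by blast
  have "(*v) A \<in> borel_measurable borel"
    by (intro borel_measurable_continuous_onI linear_continuous_on bl)
  from measurable_compose[OF m this]
  have m': "(\<lambda>x. A *v f x) \<in> borel_measurable unit_meas" .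
  have "integrable unit_meas (\<lambda>x. (norm (f x))\<^sup>2 * C\<^sup>2)"
    using assms by (auto simp: square_integrable_def)
  then have "integrable unit_meas (\<lambda>x. (norm (A *v f x))\<^sup>2)"
  proof (rule Bochner_Integration.integrable_bound)
    show "(\<lambda>x. (norm (A *v f x))\<^sup>2) \<in> borel_measurable unit_meas"
      using m' by measurable
    show "AE x in unit_meas. norm ((norm (A *v f x))\<^sup>2) \<le> norm ((norm (f x))\<^sup>2 * C\<^sup>2)"
    proof (rule AE_I2)
      fix x
      have "(norm (A *v f x))\<^sup>2 \<le> (norm (f x) * C)\<^sup>2"
        by (intro power_mono C) auto
      then show "norm ((norm (A *v f x))\<^sup>2) \<le> norm ((norm (f x))\<^sup>2 * C\<^sup>2)"
        by (simp add: power_mult_distrib)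
    qed
  qed
  with m' show ?thesis by (auto simp: square_integrable_def)
qed

lemma square_integrable_scaleC:
  assumes "square_integrable f"
  shows "square_integrable (\<lambda>x. c *s f x)"
proof -
  have "(\<lambda>x. c *s f x) = (\<lambda>x. mat c *v f x)"
    by (auto simp: fun_eq_iff vec_eq_iff matrix_vector_mult_def mat_def if_distrib if_distribR cong: if_cong)
  then show ?thesis using square_integrable_matrix[OF assms] by metis
qed

lemma square_integrable_scaleR:
  assumes "square_integrable f"
  shows "square_integrable (\<lambda>x. r *\<^sub>R f x)"
proof -
  have "(\<lambda>x. r *\<^sub>R f x) = (\<lambda>x. of_real r *s f x)"
    by (simp add: fun_eq_iff vec_eq_iff scaleR_conv_of_real[where 'a = complex])
  then show ?thesis using square_integrable_scaleC[OF assms] by metis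
qed

quotient_type L2 = "real \<Rightarrow> complex ^ 2" / partial: L2_rel
proof (rule part_equivpI)
  show "\<exists>f. L2_rel f f"
    using square_integrable_zero by (auto simp: L2_rel_def)
  show "symp L2_rel"
    by (auto simp: symp_def L2_rel_def elim: AE_mp)
  show "transp L2_rel"
    by (auto simp: transp_def L2_rel_def elim: AE_mp)
qed

lift_definition scaleC_L2 :: "complex \<Rightarrow> L2 \<Rightarrow> L2" is "\<lambda>c f x. c *s f x"
  by (auto simp: L2_rel_def square_integrable_scaleC elim: AE_mp)

lift_definition matrix_L2 :: "complex ^ 2 ^ 2 \<Rightarrow> L2 \<Rightarrow> L2" is "\<lambda>A f x. A *v f x"
  by (auto simp: L2_rel_def square_integrable_matrix elim: AE_mp)

lift_definition cinner :: "L2 \<Rightarrow> L2 \<Rightarrow> complex"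
  is "\<lambda>f g. LINT x|unit_meas. (\<Sum>i\<in>UNIV. f x $ i * cnj (g x $ i))"
proof -
  fix f f' g g' :: "real \<Rightarrow> complex ^ 2"
  assume r: "L2_rel f f'" "L2_rel g g'"
  note nth = borel_measurable_vec2_nth
  show "(LINT x|unit_meas. (\<Sum>i\<in>UNIV. f x $ i * cnj (g x $ i)))
      = (LINT x|unit_meas. (\<Sum>i\<in>UNIV. f' x $ i * cnj (g' x $ i)))"
  proof (rule integral_cong_AE)
    show "AE x in unit_meas. (\<Sum>i\<in>UNIV. f x $ i * cnj (g x $ i))
        = (\<Sum>i\<in>UNIV. f' x $ i * cnj (g' x $ i))"
      using r by (auto simp: L2_rel_def elim: AE_mp)
  qed (use r in \<open>auto simp: L2_rel_def square_integrable_def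
        intro!: borel_measurable_sum borel_measurable_times nth
          measurable_compose[OF nth borel_measurable_continuous_onI[OF continuous_on_cnj[OF continuous_on_id]]]\<close>)
qed

lemma integrable_cinner:
  assumes "square_integrable f" "square_integrable g"
  shows "integrable unit_meas (\<lambda>x. \<Sum>i\<in>UNIV. f x $ i * cnj (g x $ i))"
proof (rule Bochner_Integration.integrable_sum)
  fix i :: 2
  note nth = borel_measurable_vec2_nth
  have m: "f \<in> borel_measurable unit_meas" "g \<in> borel_measurable unit_meas"
    using assms by (auto simp: square_integrable_def)
  have "integrable unit_meas (\<lambda>x. (norm (f x))\<^sup>2 + (norm (g x))\<^sup>2)"
    using assms by (auto simp: square_integrable_def)
  then show "integrable unit_meas (\<lambda>x. f x $ i * cnj (g x $ i))"
  proof (rule Bochner_Integration.integrable_bound)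
    show "(\<lambda>x. f x $ i * cnj (g x $ i)) \<in> borel_measurable unit_meas"
      using m
      by (auto intro!: borel_measurable_times nth
          measurable_compose[OF nth borel_measurable_continuous_onI[OF continuous_on_cnj[OF continuous_on_id]]])
    show "AE x in unit_meas. norm (f x $ i * cnj (g x $ i))
            \<le> norm ((norm (f x))\<^sup>2 + (norm (g x))\<^sup>2)"
    proof (rule AE_I2)
      fix x
      have "norm (f x $ i * cnj (g x $ i)) \<le> norm (f x) * norm (g x)"
        by (simp add: norm_mult mult_mono Finite_Cartesian_Product.norm_nth_le)
      also have "\<dots> \<le> (norm (f x))\<^sup>2 + (norm (g x))\<^sup>2"
        using sum_squares_bound[of "norm (f x)" "norm (g x)"]
          mult_nonneg_nonneg[OF norm_ge_zero[of "f x"] norm_ge_zero[of "g x"]] by linarith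
      finally show "norm (f x $ i * cnj (g x $ i)) \<le> norm ((norm (f x))\<^sup>2 + (norm (g x))\<^sup>2)"
        by simp
    qed
  qed
qed

text \<open>The real inner product is the real part of the complex one, so that \<open>norm\<close>,
  \<open>bounded_linear\<close>, \<open>closure\<close> below refer to the usual $L^2$ norm.\<close>

instantiation L2 :: real_inner
begin

lift_definition zero_L2 :: L2 is "\<lambda>x. 0"
  by (auto simp: L2_rel_def square_integrable_zero)

lift_definition plus_L2 :: "L2 \<Rightarrow> L2 \<Rightarrow> L2" is "\<lambda>f g x. f x + g x"
  by (auto simp: L2_rel_def square_integrable_add elim: AE_mp)

lift_definition scaleR_L2 :: "real \<Rightarrow> L2 \<Rightarrow> L2" is "\<lambda>r f x. r *\<^sub>R f x"
  by (auto simp: L2_rel_def square_integrable_scaleR elim: AE_mp)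

definition uminus_L2 :: "L2 \<Rightarrow> L2" where "uminus_L2 f = (-1) *\<^sub>R f"

definition minus_L2 :: "L2 \<Rightarrow> L2 \<Rightarrow> L2" where "minus_L2 f g = f + - g"

definition inner_L2 :: "L2 \<Rightarrow> L2 \<Rightarrow> real" where "inner_L2 f g = Re (cinner f g)"

definition norm_L2 :: "L2 \<Rightarrow> real" where "norm_L2 f = sqrt (inner f f)"

definition sgn_L2 :: "L2 \<Rightarrow> L2" where "sgn_L2 f = inverse (norm f) *\<^sub>R f"

definition dist_L2 :: "L2 \<Rightarrow> L2 \<Rightarrow> real" where "dist_L2 f g = norm (f - g)"

definition uniformity_L2 :: "(L2 \<times> L2) filter" where
  "uniformity_L2 = (INF e\<in>{0<..}. principal {(f, g). dist f g < e})"

definition open_L2 :: "L2 set \<Rightarrow> bool" where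
  "open_L2 S \<longleftrightarrow> (\<forall>x\<in>S. \<forall>\<^sub>F (x', y) in uniformity. x' = x \<longrightarrow> y \<in> S)"

instance
proof
  fix f g h :: L2 and r s :: real and S :: "L2 set"
  show "f + g + h = f + (g + h)"
    by transfer (auto simp: L2_rel_def add.assoc intro!: square_integrable_add)
  show comm: "f + g = g + f"
    by transfer (auto simp: L2_rel_def add.commute intro!: square_integrable_add)
  show "0 + f = f"
    by transfer (auto simp: L2_rel_def)
  show "- f + f = 0"
    unfolding uminus_L2_def
    by transfer (auto simp: L2_rel_def square_integrable_zero
        intro!: square_integrable_add square_integrable_scaleR)
  show "f - g = f + - g"
    by (rule minus_L2_def)
  show "r *\<^sub>R (f + g) = r *\<^sub>R f + r *\<^sub>R g"
    by transfer (auto simp: L2_rel_def scaleR_add_right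
        intro!: square_integrable_add square_integrable_scaleR)
  show "(r + s) *\<^sub>R f = r *\<^sub>R f + s *\<^sub>R f"
    by transfer (auto simp: L2_rel_def scaleR_add_left
        intro!: square_integrable_add square_integrable_scaleR)
  show "r *\<^sub>R s *\<^sub>R f = (r * s) *\<^sub>R f"
    by transfer (auto simp: L2_rel_def intro!: square_integrable_scaleR)
  show "1 *\<^sub>R f = f"
    by transfer (auto simp: L2_rel_def)
  show "dist f g = norm (f - g)"
    by (rule dist_L2_def)
  show "sgn f = inverse (norm f) *\<^sub>R f"
    by (rule sgn_L2_def)
  show "(uniformity :: (L2 \<times> L2) filter) = (INF e\<in>{0<..}. principal {(x, y). dist x y < e})"
    by (rule uniformity_L2_def)
  show "open S \<longleftrightarrow> (\<forall>x\<in>S. \<forall>\<^sub>F (x', y) in uniformity. x' = x \<longrightarrow> y \<in> S)"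
    by (rule open_L2_def)
  have Re_cinner: "Re (LINT x|unit_meas. (\<Sum>i\<in>UNIV. u x $ i * cnj (v x $ i)))
      = (LINT x|unit_meas. inner (u x) (v x))"
    and int_inner: "integrable unit_meas (\<lambda>x. inner (u x) (v x))"
    if "square_integrable u" "square_integrable v" for u v
  proof -
    have i: "inner (u x) (v x) = Re (\<Sum>i\<in>UNIV. u x $ i * cnj (v x $ i))" for x
      by (simp add: inner_vec_def inner_complex_def)
    show "Re (LINT x|unit_meas. (\<Sum>i\<in>UNIV. u x $ i * cnj (v x $ i)))
      = (LINT x|unit_meas. inner (u x) (v x))"
      unfolding i using integrable_cinner[OF that] by (rule integral_Re[symmetric])
    show "integrable unit_meas (\<lambda>x. inner (u x) (v x))"
      unfolding i using integrable_cinner[OF that] by (rule integrable_Re)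
  qed
  show "inner f g = inner g f"
    unfolding inner_L2_def
    by transfer (simp add: L2_rel_def Re_cinner inner_commute)
  show "inner (f + g) h = inner f h + inner g h"
    unfolding inner_L2_def
    by transfer (simp add: L2_rel_def Re_cinner square_integrable_add inner_add_left int_inner
        del: vector_add_component)
  show "inner (r *\<^sub>R f) g = r * inner f g"
    unfolding inner_L2_def
    by transfer (simp add: L2_rel_def Re_cinner square_integrable_scaleR int_inner
        del: vector_scaleR_component)
  show "0 \<le> inner f f"
    unfolding inner_L2_def by transfer (simp add: L2_rel_def Re_cinner)
  show "inner f f = 0 \<longleftrightarrow> f = 0"
    unfolding inner_L2_def
  proof transfer
    fix u :: "real \<Rightarrow> complex ^ 2"
    assume "L2_rel u u"
    then have u: "square_integrable u" by (simp add: L2_rel_def)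
    have "(LINT x|unit_meas. inner (u x) (u x)) = 0 \<longleftrightarrow> (AE x in unit_meas. inner (u x) (u x) = 0)"
      by (rule integral_nonneg_eq_0_iff_AE[OF int_inner[OF u u]]) auto
    then show "Re (LINT x|unit_meas. (\<Sum>i\<in>UNIV. u x $ i * cnj (u x $ i))) = 0
        \<longleftrightarrow> L2_rel u (\<lambda>x. 0)"
      using u by (simp add: Re_cinner L2_rel_def square_integrable_zero)
  qed
  show "norm f = sqrt (inner f f)"
    by (rule norm_L2_def)
qed

end

record operator =
  Dom :: "L2 set"
  app :: "L2 \<Rightarrow> L2"

definition linear_operator :: "operator \<Rightarrow> bool" where
  "linear_operator K \<longleftrightarrow>
     0 \<in> Dom K \<and>
     (\<forall>f\<in>Dom K. \<forall>g\<in>Dom K. f + g \<in> Dom K \<and> app K (f + g) = app K f + app K g) \<and>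
     (\<forall>c. \<forall>f\<in>Dom K. scaleC_L2 c f \<in> Dom K \<and> app K (scaleC_L2 c f) = scaleC_L2 c (app K f))"

definition bounded_clinear :: "(L2 \<Rightarrow> L2) \<Rightarrow> bool" where
  "bounded_clinear U \<longleftrightarrow>
     bounded_linear U \<and> (\<forall>c f. U (scaleC_L2 c f) = scaleC_L2 c (U f))"

definition resolvent_set :: "operator \<Rightarrow> complex set" where
  "resolvent_set K =
     {z. bij_betw (\<lambda>f. app K f - scaleC_L2 z f) (Dom K) UNIV \<and>
         bounded_clinear (inv_into (Dom K) (\<lambda>f. app K f - scaleC_L2 z f))}"

definition Spec :: "operator \<Rightarrow> complex set" where
  "Spec K = - resolvent_set K"

definition numerical_range :: "operator \<Rightarrow> complex set" where
  "numerical_range K = {cinner (app K f) f | f. f \<in> Dom K \<and> norm f = 1}"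

definition graph_of :: "operator \<Rightarrow> (L2 \<times> L2) set" where
  "graph_of K = {(f, app K f) | f. f \<in> Dom K}"

definition adjoint_graph :: "operator \<Rightarrow> (L2 \<times> L2) set" where
  "adjoint_graph K = {(g, h). \<forall>f\<in>Dom K. cinner (app K f) g = cinner f h}"

definition self_adjoint :: "operator \<Rightarrow> bool" where
  "self_adjoint K \<longleftrightarrow>
     linear_operator K \<and> closure (Dom K) = UNIV \<and> graph_of K = adjoint_graph K"

text \<open>\<open>V\<close> is the bounded inverse of \<open>U\<close>, and \<open>K = U L V\<close> with domain \<open>U ` Dom L\<close>.\<close>

definition similar_operators :: "operator \<Rightarrow> operator \<Rightarrow> bool" where
  "similar_operators K L \<longleftrightarrow>
     (\<exists>U V. bounded_clinear U \<and> bounded_clinear V \<and> U \<circ> V = id \<and> V \<circ> U = id \<and>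
        Dom K = U ` Dom L \<and> (\<forall>f\<in>Dom K. app K f = U (app L (V f))))"

text \<open>Test functions are taken real-valued; by linearity complex-valued ones give the same
  generalized derivatives. The sign in \<open>weak_deriv2_fun\<close> is $(-1)^2$.\<close>

definition test_function :: "(real \<Rightarrow> real) \<Rightarrow> bool" where
  "test_function \<psi> \<longleftrightarrow>
     (\<forall>k x. (deriv ^^ k) \<psi> field_differentiable at x) \<and>
     compact (closure {x. \<psi> x \<noteq> 0}) \<and> closure {x. \<psi> x \<noteq> 0} \<subseteq> {0<..<1}"

definition weak_deriv2_fun :: "(real \<Rightarrow> complex ^ 2) \<Rightarrow> (real \<Rightarrow> complex ^ 2) \<Rightarrow> bool" where
  "weak_deriv2_fun f g \<longleftrightarrow>
     (\<forall>\<psi>. test_function \<psi> \<longrightarrow>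
        (LINT x|unit_meas. (deriv ^^ 2) \<psi> x *\<^sub>R f x) = (LINT x|unit_meas. \<psi> x *\<^sub>R g x))"

lemma test_function_measurable:
  assumes "test_function \<psi>"
  shows "(deriv ^^ k) \<psi> \<in> borel_measurable unit_meas"
proof -
  have "continuous_on UNIV ((deriv ^^ k) \<psi>)"
    using assms
    by (auto simp: test_function_def continuous_on_eq_continuous_at
        intro: field_differentiable_imp_continuous_at)
  then have "(deriv ^^ k) \<psi> \<in> borel_measurable borel"
    by (rule borel_measurable_continuous_onI)
  then have "(deriv ^^ k) \<psi> \<in> borel_measurable lebesgue"
    by (simp add: measurable_completion)
  then show ?thesis by (rule measurable_restrict_space1)
qed

lift_definition weak_deriv2 :: "L2 \<Rightarrow> L2 \<Rightarrow> bool" is weak_deriv2_fun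
proof -
  have *: "(LINT x|unit_meas. (deriv ^^ k) \<psi> x *\<^sub>R u x)
      = (LINT x|unit_meas. (deriv ^^ k) \<psi> x *\<^sub>R v x)"
    if "L2_rel u v" "test_function \<psi>" for k \<psi> u v
    using that
    by (intro integral_cong_AE borel_measurable_scaleR test_function_measurable)
      (auto simp: L2_rel_def square_integrable_def elim: AE_mp)
  fix f f' g g' :: "real \<Rightarrow> complex ^ 2"
  assume r: "L2_rel f f'" "L2_rel g g'"
  show "weak_deriv2_fun f g = weak_deriv2_fun f' g'"
    unfolding weak_deriv2_fun_def
    using *[OF r(1), where k = 2] *[OF r(2), where k = 0] by simp
qed

definition W22 :: "L2 set" where
  "W22 = {f. \<exists>g. weak_deriv2 f g}"

definition deriv2 :: "L2 \<Rightarrow> L2" where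
  "deriv2 f = (THE g. weak_deriv2 f g)"

lift_definition represented_by :: "L2 \<Rightarrow> (real \<Rightarrow> complex ^ 2) \<Rightarrow> bool"
  is "\<lambda>f F. AE x in unit_meas. f x = F x"
  by (intro ext) (auto simp: L2_rel_def elim: AE_mp)

text \<open>Boundary values of an element of \<open>W22\<close> are those of its representative in
  $C^1([0,1])$, which exists by the Sobolev embedding and is unique.\<close>

definition C1_representative ::
  "L2 \<Rightarrow> (real \<Rightarrow> complex ^ 2) \<Rightarrow> (real \<Rightarrow> complex ^ 2) \<Rightarrow> bool" where
  "C1_representative f F F' \<longleftrightarrow>
     represented_by f F \<and>
     (\<forall>x\<in>{0..1}. (F has_vector_derivative F' x) (at x within {0..1})) \<and>
     continuous_on {0..1} F'"

definition D_op :: operator where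
  "D_op = \<lparr>
     Dom = {f \<in> W22. \<exists>F F'. C1_representative f F F' \<and>
              F 0 $ 1 = 0 \<and> F 1 $ 1 = 0 \<and> F' 0 $ 2 = 0 \<and> F' 1 $ 2 = 0},
     app = (\<lambda>f. - deriv2 f)\<rparr>"

definition matrix_op :: "complex ^ 2 ^ 2 \<Rightarrow> operator \<Rightarrow> operator" where
  "matrix_op A K = \<lparr>Dom = Dom K, app = (\<lambda>f. matrix_L2 A (app K f))\<rparr>"

definition A4 :: "real \<Rightarrow> real \<Rightarrow> complex ^ 2 ^ 2" where
  "A4 a d = vector [vector [of_real a, - 1], vector [1, of_real d]]"

end

theory Submission
  imports Defs
begin

text \<open>
  Let $J = \mathrm{diag}(1,-1)$. If $ad < -1$, then $A_4 J$ is a real symmetric definite matrix, so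
  with $s = \mathrm{sgn}\,a$ there is a Cholesky factor $V$ with $V^* V A_4 = s J$. Hence
  $L = V A_4 D V^{-1}$ has the quadratic form $s\langle J D u, u\rangle$ at $V u$, and is symmetric.
  For non-real $z$ the equation $(A_4 D - z) f = h$ is a two-point boundary value problem for an ordinary
  differential equation that is diagonalised by the eigenvectors of $A_4$; symmetry of $L$ gives
  uniqueness, and the Fredholm alternative for the finitely many integration constants turns
  uniqueness into solvability. Surjectivity of $L - z$ for all non-real $z$ yields both
  self-adjointness and reality of the spectrum. The functions
  $(\sigma\sin n\pi x, \tau\cos n\pi x)$ realise every real number in the numerical range.

  If $ad = -1$, then $(-1, a) A_4 = 0$, so a function in the range of $A_4 D - z$ has a continuous
  combination $-h_1 + a h_2$, which a step function violates.
\<close>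

text \<open>The data are weak: generalized derivatives, boundary values of representatives, forcing
  that is only square-integrable. The analysis therefore rests on triples \<open>H2 F F' g\<close>,
  in which \<open>F'\<close> and \<open>F\<close> are indefinite integrals. A single density result,
  that polynomials times (x(1-x))^2 are dense in L^2, yields the fundamental lemma of the calculus
  of variations, integration by parts for primitives of L^2 functions, and density of
  \<open>Dom D_op\<close>.

  The role of J comes from the boundary conditions, Dirichlet in one component and Neumann in the
  other. A diagonal matrix respects them, whereas V mixes the components and gives L coupled
  conditions. Symmetry of L is therefore verified in the original coordinates, where J keeps all
  boundary terms zero. The form there is s times the difference of the squared norms of phi' and
  gamma', unbounded in both directions, which is why the numerical range can fill the line. The
  matrix to be factored is P = s (A_4 J)^(-1), of determinant -1/(1+ad); this is positive exactly
  when ad < -1.\<close>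

definition sq_int :: "(real \<Rightarrow> 'b::euclidean_space) \<Rightarrow> bool" where
  "sq_int f \<longleftrightarrow> f \<in> borel_measurable unit_meas \<and> integrable unit_meas (\<lambda>x. (norm (f x))\<^sup>2)"

text \<open>The polymorphic codomain of \<open>sq_int\<close> lets scalar components, products with
  kernels and vector functions share one theory; on \<open>complex ^ 2\<close> it is the notion
  underlying \<open>L2\<close>.\<close>

lemma square_integrable_iff_sq_int: "square_integrable f \<longleftrightarrow> sq_int f"
  by (simp add: square_integrable_def sq_int_def)

lemma space_unit_meas [simp]: "space unit_meas = {0<..<1}"
  by simp

lemma finite_measure_unit_meas: "finite_measure unit_meas"
  by (rule finite_measure_lebesgue_on) simp

lemma integrable_const_unit: "integrable unit_meas (\<lambda>x. c :: 'b::{banach, second_countable_topology})"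
  using finite_measure.integrable_const[OF finite_measure_unit_meas] .

lemma measure_unit_meas: "measure unit_meas {0<..<1} = 1"
  by (simp add: measure_restrict_space)

lemma sq_int_bound:
  assumes "sq_int g" "f \<in> borel_measurable unit_meas"
    and "\<And>x. 0 < x \<Longrightarrow> x < 1 \<Longrightarrow> norm (f x) \<le> C * norm (g x)"
  shows "sq_int f"
proof -
  have "integrable unit_meas (\<lambda>x. C\<^sup>2 * (norm (g x))\<^sup>2)"
    using assms(1) by (simp add: sq_int_def)
  then have "integrable unit_meas (\<lambda>x. (norm (f x))\<^sup>2)"
  proof (rule Bochner_Integration.integrable_bound)
    show "(\<lambda>x. (norm (f x))\<^sup>2) \<in> borel_measurable unit_meas"
      using assms(2) by measurable
    show "AE x in unit_meas. norm ((norm (f x))\<^sup>2) \<le> norm (C\<^sup>2 * (norm (g x))\<^sup>2)"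
      using power_mono[OF assms(3) norm_ge_zero, where n = 2]
      by (intro AE_I2) (simp add: power_mult_distrib)
  qed
  with assms(2) show ?thesis by (simp add: sq_int_def)
qed

lemma sq_int_add:
  assumes "sq_int f" "sq_int g"
  shows "sq_int (\<lambda>x. f x + g x)"
proof -
  have m: "f \<in> borel_measurable unit_meas" "g \<in> borel_measurable unit_meas"
    using assms by (auto simp: sq_int_def)
  have "integrable unit_meas (\<lambda>x. 2 * (norm (f x))\<^sup>2 + 2 * (norm (g x))\<^sup>2)"
    using assms by (auto simp: sq_int_def)
  then have "integrable unit_meas (\<lambda>x. (norm (f x + g x))\<^sup>2)"
  proof (rule Bochner_Integration.integrable_bound)
    show "(\<lambda>x. (norm (f x + g x))\<^sup>2) \<in> borel_measurable unit_meas"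
      using m by measurable
    show "AE x in unit_meas. norm ((norm (f x + g x))\<^sup>2)
        \<le> norm (2 * (norm (f x))\<^sup>2 + 2 * (norm (g x))\<^sup>2)"
    proof (rule AE_I2)
      fix x
      have "(norm (f x + g x))\<^sup>2 \<le> (norm (f x) + norm (g x))\<^sup>2"
        by (intro power_mono norm_triangle_ineq) auto
      also have "\<dots> \<le> 2 * (norm (f x))\<^sup>2 + 2 * (norm (g x))\<^sup>2"
        using sum_squares_bound[of "norm (f x)" "norm (g x)"] by (simp add: power2_sum)
      finally show "norm ((norm (f x + g x))\<^sup>2)
        \<le> norm (2 * (norm (f x))\<^sup>2 + 2 * (norm (g x))\<^sup>2)" by simp
    qed
  qed
  then show ?thesis using m by (auto simp: sq_int_def)
qed

lemma sq_int_linear: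
  assumes "sq_int f" "bounded_linear T"
  shows "sq_int (\<lambda>x. T (f x))"
proof -
  obtain C where "\<And>v. norm (T v) \<le> norm v * C"
    using assms(2) bounded_linear.bounded by blast
  moreover have "T \<in> borel_measurable borel"
    by (intro borel_measurable_continuous_onI linear_continuous_on assms(2))
  then have "(\<lambda>x. T (f x)) \<in> borel_measurable unit_meas"
    using assms(1) by (auto simp: sq_int_def intro: measurable_compose)
  ultimately show ?thesis
    by (intro sq_int_bound[OF assms(1), where C = C]) (auto simp: mult.commute)
qed

lemma sq_int_minus: "sq_int f \<Longrightarrow> sq_int (\<lambda>x. - f x)"
  using sq_int_linear[of f uminus] bounded_linear_minus[OF bounded_linear_ident] by simp

lemma sq_int_diff: "sq_int f \<Longrightarrow> sq_int g \<Longrightarrow> sq_int (\<lambda>x. f x - g x)"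
  using sq_int_add[OF _ sq_int_minus, of f g] by simp

lemma borel_measurable_unit_meas_cont:
  assumes "continuous_on {0..1} (f :: real \<Rightarrow> 'b::euclidean_space)"
  shows "f \<in> borel_measurable unit_meas"
  by (rule continuous_imp_measurable_on_sets_lebesgue)
    (auto intro: continuous_on_subset[OF assms])

lemma continuous_on_unit_bounded:
  assumes "continuous_on {0..1::real} (f :: real \<Rightarrow> 'b::euclidean_space)"
  obtains C where "C > 0" "\<And>x. 0 \<le> x \<Longrightarrow> x \<le> 1 \<Longrightarrow> norm (f x) \<le> C"
proof -
  have "bounded (f ` {0..1})"
    by (intro compact_imp_bounded compact_continuous_image assms) auto
  then show thesis
    using that unfolding bounded_pos by force
qed

lemma sq_int_const: "sq_int (\<lambda>x. c)"
  using integrable_const_unit by (simp add: sq_int_def)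

lemma sq_int_continuous:
  assumes "continuous_on {0..1} f"
  shows "sq_int f"
proof -
  obtain C where "\<And>x. 0 \<le> x \<Longrightarrow> x \<le> 1 \<Longrightarrow> norm (f x) \<le> C"
    using continuous_on_unit_bounded[OF assms] by blast
  then show ?thesis
    using sq_int_bound[OF sq_int_const[of "1::real"] borel_measurable_unit_meas_cont[OF assms], of C]
    by simp
qed

lemma borel_measurable_bilinear:
  fixes B :: "'a::euclidean_space \<Rightarrow> 'b::euclidean_space \<Rightarrow> 'c::euclidean_space"
  assumes "bounded_bilinear B" "f \<in> borel_measurable M" "g \<in> borel_measurable M"
  shows "(\<lambda>x. B (f x) (g x)) \<in> borel_measurable M"
proof -
  interpret bounded_bilinear B by fact
  have "continuous_on UNIV (\<lambda>p. B (fst p) (snd p))"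
    by (intro continuous_on continuous_intros)
  from borel_measurable_continuous_Pair[OF assms(2,3) this] show ?thesis by simp
qed

lemma sq_int_bilinear_continuous:
  fixes B :: "'a::euclidean_space \<Rightarrow> 'b::euclidean_space \<Rightarrow> 'c::euclidean_space"
  assumes "bounded_bilinear B" "continuous_on {0..1} k" "sq_int g"
  shows "sq_int (\<lambda>x. B (k x) (g x))"
proof -
  interpret bounded_bilinear B by fact
  obtain C where C: "C > 0" "\<And>x. 0 \<le> x \<Longrightarrow> x \<le> 1 \<Longrightarrow> norm (k x) \<le> C"
    using continuous_on_unit_bounded[OF assms(2)] by blast
  obtain K where K: "K > 0" "\<And>a b. norm (B a b) \<le> norm a * norm b * K"
    using pos_bounded by blast
  have m: "(\<lambda>x. B (k x) (g x)) \<in> borel_measurable unit_meas"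
    using borel_measurable_bilinear[OF assms(1) borel_measurable_unit_meas_cont[OF assms(2)]] assms(3)
    by (simp add: sq_int_def)
  show ?thesis
  proof (rule sq_int_bound[OF assms(3) m])
    fix x :: real assume x: "0 < x" "x < 1"
    have "norm (B (k x) (g x)) \<le> norm (k x) * norm (g x) * K" by (rule K)
    also have "\<dots> \<le> C * norm (g x) * K"
      using C(2)[of x] x K(1) by (intro mult_right_mono) auto
    finally show "norm (B (k x) (g x)) \<le> C * K * norm (g x)" by (simp add: mult_ac)
  qed
qed

lemma integrable_norm_mult_sq_int:
  assumes "sq_int f" "sq_int g"
  shows "integrable unit_meas (\<lambda>x. norm (f x) * norm (g x))"
proof -
  have m: "f \<in> borel_measurable unit_meas" "g \<in> borel_measurable unit_meas"
    using assms by (auto simp: sq_int_def)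
  have "integrable unit_meas (\<lambda>x. (norm (f x))\<^sup>2 + (norm (g x))\<^sup>2)"
    using assms by (auto simp: sq_int_def)
  then show ?thesis
  proof (rule Bochner_Integration.integrable_bound)
    show "(\<lambda>x. norm (f x) * norm (g x)) \<in> borel_measurable unit_meas" using m by measurable
    show "AE x in unit_meas. norm (norm (f x) * norm (g x)) \<le> norm ((norm (f x))\<^sup>2 + (norm (g x))\<^sup>2)"
    proof (rule AE_I2)
      fix x
      show "norm (norm (f x) * norm (g x)) \<le> norm ((norm (f x))\<^sup>2 + (norm (g x))\<^sup>2)"
        using sum_squares_bound[of "norm (f x)" "norm (g x)"]
          mult_nonneg_nonneg[OF norm_ge_zero[of "f x"] norm_ge_zero[of "g x"]]
        unfolding real_norm_def abs_mult abs_norm_cancel by linarith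
    qed
  qed
qed

lemma integrable_sq_int:
  assumes "sq_int f"
  shows "integrable unit_meas f"
proof -
  have "integrable unit_meas (\<lambda>x. norm (1::real) * norm (f x))"
    by (rule integrable_norm_mult_sq_int[OF sq_int_const assms])
  then show ?thesis
    using assms by (simp add: sq_int_def integrable_norm_iff)
qed

lemma integrable_bilinear_sq_int:
  fixes B :: "'a::euclidean_space \<Rightarrow> 'b::euclidean_space \<Rightarrow> 'c::euclidean_space"
  assumes "bounded_bilinear B" "sq_int f" "sq_int g"
  shows "integrable unit_meas (\<lambda>x. B (f x) (g x))"
proof -
  interpret bounded_bilinear B by fact
  obtain K where K: "K > 0" "\<And>a b. norm (B a b) \<le> norm a * norm b * K"
    using pos_bounded by blast
  have m: "(\<lambda>x. B (f x) (g x)) \<in> borel_measurable unit_meas"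
    using borel_measurable_bilinear[OF assms(1), of f unit_meas g] assms(2,3)
    by (simp add: sq_int_def)
  have "integrable unit_meas (\<lambda>x. norm (f x) * norm (g x) * K)"
    using integrable_norm_mult_sq_int[OF assms(2,3)] by simp
  then show ?thesis
    by (rule Bochner_Integration.integrable_bound) (use m K in \<open>auto intro!: AE_I2 order_trans[OF K(2)]\<close>)
qed

text \<open>Since \<open>unit_meas\<close> is a probability measure, this is nonnegativity of the
  variance of \<open>norm (f x)\<close>.\<close>

lemma L1_le_L2:
  assumes "sq_int f"
  shows "(LINT x|unit_meas. norm (f x)) \<le> sqrt (LINT x|unit_meas. (norm (f x))\<^sup>2)"
proof -
  let ?m = "LINT x|unit_meas. norm (f x)"
  have i: "integrable unit_meas f" "integrable unit_meas (\<lambda>x. (norm (f x))\<^sup>2)"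
    using assms integrable_sq_int by (auto simp: sq_int_def)
  have "0 \<le> (LINT x|unit_meas. (norm (f x) - ?m)\<^sup>2)"
    by (rule integral_nonneg_AE) auto
  also have "\<dots> = (LINT x|unit_meas. (norm (f x))\<^sup>2 - 2 * ?m * norm (f x) + ?m\<^sup>2)"
    by (intro Bochner_Integration.integral_cong refl) (simp add: power2_diff)
  also have "\<dots> = (LINT x|unit_meas. (norm (f x))\<^sup>2) - 2 * ?m * ?m + ?m\<^sup>2"
    using i integrable_const_unit[of "?m\<^sup>2"] measure_unit_meas by simp
  finally have "?m\<^sup>2 \<le> (LINT x|unit_meas. (norm (f x))\<^sup>2)"
    by (simp add: power2_eq_square)
  then show ?thesis by (rule real_le_rsqrt)
qed

subsection \<open>Polynomials vanishing to second order at the end points are dense\<close>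

text \<open>The square makes both the weight and its derivative vanish at 0 and 1, so a weighted
  polynomial satisfies Dirichlet and Neumann conditions at once.\<close>

definition end_weight :: "real \<Rightarrow> real" where
  "end_weight x = (x * (1 - x))\<^sup>2"

text \<open>Density in L^2 is stated as a property of a single function so that it can be propagated
  by \<open>poly_approx_limit\<close>: from weighted continuous functions to continuous, bounded
  measurable and finally all square-integrable ones.\<close>

definition poly_approx :: "(real \<Rightarrow> 'b::euclidean_space) \<Rightarrow> bool" where
  "poly_approx f \<longleftrightarrow> (\<forall>e>0. \<exists>p. polynomial_function p \<and>
     (LINT x|unit_meas. (norm (f x - end_weight x *\<^sub>R p x))\<^sup>2) < e)"

lemma continuous_end_weight_poly:
  assumes "polynomial_function (p :: real \<Rightarrow> 'b::euclidean_space)"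
  shows "continuous_on S (\<lambda>x. end_weight x *\<^sub>R p x)"
  unfolding end_weight_def
  by (intro continuous_intros continuous_on_polymonial_function assms)

text \<open>Dominated convergence upgrades the pointwise limit to an L^2 limit, and approximability
  is closed under L^2 limits. The majorant \<open>H\<close> bounds the error \<open>f - s n\<close>,
  hence only \<open>H\<close> squared must be integrable.\<close>

lemma poly_approx_limit:
  fixes f :: "real \<Rightarrow> 'b::euclidean_space"
  assumes f: "sq_int f" and s: "\<And>n. sq_int (s n)" and ap: "\<And>n. poly_approx (s n)"
    and lim: "AE x in unit_meas. (\<lambda>n. s n x) \<longlonglongrightarrow> f x"
    and H: "integrable unit_meas (\<lambda>x. (H x)\<^sup>2)"
    and bd: "AE x in unit_meas. \<forall>n. norm (f x - s n x) \<le> (H x :: real)"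
  shows "poly_approx f"
  unfolding poly_approx_def
proof (intro allI impI)
  fix e :: real assume e: "e > 0"
  have "(\<lambda>n. LINT x|unit_meas. (norm (f x - s n x))\<^sup>2) \<longlonglongrightarrow> (LINT x|unit_meas. 0)"
  proof (rule integral_dominated_convergence[OF _ _ H])
    show "(\<lambda>x. (norm (f x - s n x))\<^sup>2) \<in> borel_measurable unit_meas" for n
      using sq_int_diff[OF f s] by (auto simp: sq_int_def dest: borel_measurable_integrable)
    show "AE x in unit_meas. (\<lambda>n. (norm (f x - s n x))\<^sup>2) \<longlonglongrightarrow> 0"
      using lim
    proof eventually_elim
      case (elim x)
      have "(\<lambda>n. (norm (f x - s n x))\<^sup>2) \<longlonglongrightarrow> (norm (f x - f x))\<^sup>2"
        by (intro tendsto_intros elim)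
      then show ?case by simp
    qed
    show "AE x in unit_meas. norm ((norm (f x - s n x))\<^sup>2) \<le> (H x)\<^sup>2" for n
      using bd by eventually_elim (simp add: power_mono)
  qed simp
  \<comment> \<open>The bound (x + y)^2 \<le> 2 x^2 + 2 y^2 doubles both errors, so each of the two
    gets a quarter of \<open>e\<close>.\<close>
  then have "\<forall>\<^sub>F n in sequentially. (LINT x|unit_meas. (norm (f x - s n x))\<^sup>2) < e / 4"
    by (rule order_tendstoD(2)) (use e in simp)
  then obtain n where n: "(LINT x|unit_meas. (norm (f x - s n x))\<^sup>2) < e / 4"
    by (auto simp: eventually_sequentially)
  obtain p where p: "polynomial_function p"
      "(LINT x|unit_meas. (norm (s n x - end_weight x *\<^sub>R p x))\<^sup>2) < e / 4"
    using ap[of n] e unfolding poly_approx_def by (meson divide_pos_pos zero_less_numeral)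
  have wp: "sq_int (\<lambda>x. end_weight x *\<^sub>R p x)"
    by (intro sq_int_continuous continuous_end_weight_poly p)
  have i: "integrable unit_meas (\<lambda>x. (norm (f x - s n x))\<^sup>2)"
    "integrable unit_meas (\<lambda>x. (norm (s n x - end_weight x *\<^sub>R p x))\<^sup>2)"
    "integrable unit_meas (\<lambda>x. (norm (f x - end_weight x *\<^sub>R p x))\<^sup>2)"
    using sq_int_diff[OF f s] sq_int_diff[OF s wp] sq_int_diff[OF f wp]
    by (auto simp: sq_int_def)
  have "(LINT x|unit_meas. (norm (f x - end_weight x *\<^sub>R p x))\<^sup>2)
     \<le> (LINT x|unit_meas. 2 * (norm (f x - s n x))\<^sup>2 + 2 * (norm (s n x - end_weight x *\<^sub>R p x))\<^sup>2)"
  proof (rule integral_mono)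
    fix x
    let ?a = "f x - s n x" and ?b = "s n x - end_weight x *\<^sub>R p x"
    have "(norm (?a + ?b))\<^sup>2 \<le> (norm ?a + norm ?b)\<^sup>2"
      by (intro power_mono norm_triangle_ineq) auto
    also have "\<dots> \<le> 2 * (norm ?a)\<^sup>2 + 2 * (norm ?b)\<^sup>2"
      using sum_squares_bound[of "norm ?a" "norm ?b"] by (simp add: power2_sum)
    finally show "(norm (f x - end_weight x *\<^sub>R p x))\<^sup>2 \<le> 2 * (norm ?a)\<^sup>2 + 2 * (norm ?b)\<^sup>2"
      by simp
  qed (use i in auto)
  also have "\<dots> = 2 * (LINT x|unit_meas. (norm (f x - s n x))\<^sup>2)
      + 2 * (LINT x|unit_meas. (norm (s n x - end_weight x *\<^sub>R p x))\<^sup>2)"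
    using i by simp
  also have "\<dots> < e" using n p by simp
  finally show "\<exists>p. polynomial_function p \<and>
     (LINT x|unit_meas. (norm (f x - end_weight x *\<^sub>R p x))\<^sup>2) < e"
    using p by blast
qed

lemma end_weight_bounds: "0 \<le> x \<Longrightarrow> x \<le> 1 \<Longrightarrow> 0 \<le> end_weight x \<and> end_weight x \<le> 1"
  unfolding end_weight_def by (simp add: mult_le_one power_le_one)

lemma end_weight_pos: "0 < x \<Longrightarrow> x < 1 \<Longrightarrow> 0 < end_weight x"
  by (simp add: end_weight_def)

lemma poly_approx_weighted:
  assumes "continuous_on {0..1} (q :: real \<Rightarrow> 'b::euclidean_space)"
  shows "poly_approx (\<lambda>x. end_weight x *\<^sub>R q x)"
  unfolding poly_approx_def
proof (intro allI impI)
  fix e :: real assume e: "e > 0"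
  \<comment> \<open>The uniform error is squared and integrated over an interval of length 1;
    halving \<open>e\<close> keeps the final inequality strict.\<close>
  obtain p where p: "polynomial_function p" "\<And>x. x \<in> {0..1} \<Longrightarrow> norm (q x - p x) < sqrt (e / 2)"
    using Stone_Weierstrass_polynomial_function[OF compact_Icc assms, of "sqrt (e / 2)"] e by auto
  have "(LINT x|unit_meas. (norm (end_weight x *\<^sub>R q x - end_weight x *\<^sub>R p x))\<^sup>2)
      \<le> (LINT x|unit_meas. e / 2)"
  proof (rule integral_mono)
    have "sq_int (\<lambda>x. end_weight x *\<^sub>R q x - end_weight x *\<^sub>R p x)"
      unfolding end_weight_def
      by (intro sq_int_continuous continuous_on_diff continuous_on_scaleR assms p
          continuous_on_polymonial_function[OF p(1)] continuous_intros)
    then show "integrable unit_meas (\<lambda>x. (norm (end_weight x *\<^sub>R q x - end_weight x *\<^sub>R p x))\<^sup>2)"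
      by (simp add: sq_int_def)
    show "integrable unit_meas (\<lambda>x. e / 2)"
      using integrable_const_unit .
    fix x :: real assume "x \<in> space unit_meas"
    then have x: "0 \<le> x" "x \<le> 1" by auto
    have "norm (end_weight x *\<^sub>R q x - end_weight x *\<^sub>R p x) = end_weight x * norm (q x - p x)"
      using end_weight_bounds[OF x] by (simp flip: scaleR_diff_right)
    also have "\<dots> \<le> 1 * norm (q x - p x)"
      using end_weight_bounds[OF x] by (intro mult_right_mono) auto
    also have "\<dots> \<le> sqrt (e / 2)" using p(2)[of x] x by simp
    finally have "(norm (end_weight x *\<^sub>R q x - end_weight x *\<^sub>R p x))\<^sup>2 \<le> (sqrt (e / 2))\<^sup>2"
      by (intro power_mono) auto
    then show "(norm (end_weight x *\<^sub>R q x - end_weight x *\<^sub>R p x))\<^sup>2 \<le> e / 2"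
      using e by simp
  qed
  also have "\<dots> < e" using e measure_unit_meas by simp
  finally show "\<exists>pa. polynomial_function pa \<and>
     (LINT x|unit_meas. (norm (end_weight x *\<^sub>R q x - end_weight x *\<^sub>R pa x))\<^sup>2) < e"
    using p by blast
qed

lemma poly_approx_continuous:
  assumes "continuous_on {0..1} (k :: real \<Rightarrow> 'b::euclidean_space)"
  shows "poly_approx k"
proof -
  obtain C where C: "C > 0" "\<And>x. 0 \<le> x \<Longrightarrow> x \<le> 1 \<Longrightarrow> norm (k x) \<le> C"
    using continuous_on_unit_bounded[OF assms] by blast
  \<comment> \<open>Dividing by the weight would be singular at the end points, so the divisor is
    kept above \<open>inverse (Suc n)\<close>. At each interior point the weight eventually exceeds
    this floor, and then \<open>end_weight x *\<^sub>R q n x\<close> equals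
    \<open>k x\<close>.\<close>
  define q where "q n x = inverse (max (end_weight x) (inverse (Suc n))) *\<^sub>R k x" for n x
  have cq: "continuous_on {0..1} (q n)" for n
    unfolding q_def
    by (intro continuous_intros assms)
      (auto simp: end_weight_def max_def intro!: continuous_intros)
  have cw: "continuous_on {0..1} end_weight"
    by (auto simp: end_weight_def intro!: continuous_intros)
  show ?thesis
  proof (rule poly_approx_limit[where s = "\<lambda>n x. end_weight x *\<^sub>R q n x" and H = "\<lambda>x. C"])
    show "sq_int k" by (rule sq_int_continuous[OF assms])
    show "sq_int (\<lambda>x. end_weight x *\<^sub>R q n x)" for n
      by (intro sq_int_continuous continuous_intros cq cw)
    show "poly_approx (\<lambda>x. end_weight x *\<^sub>R q n x)" for n
      by (rule poly_approx_weighted[OF cq])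
    show "AE x in unit_meas. (\<lambda>n. end_weight x *\<^sub>R q n x) \<longlonglongrightarrow> k x"
    proof (rule AE_I2)
      fix x :: real assume "x \<in> space unit_meas"
      then have w: "0 < end_weight x" by (auto intro: end_weight_pos)
      have "\<forall>\<^sub>F n in sequentially. inverse (real (Suc n)) < end_weight x"
        using LIMSEQ_inverse_real_of_nat w by (rule order_tendstoD(2))
      then have "\<forall>\<^sub>F n in sequentially. end_weight x *\<^sub>R q n x = k x"
        by eventually_elim (use w in \<open>simp add: q_def max_def\<close>)
      then show "(\<lambda>n. end_weight x *\<^sub>R q n x) \<longlonglongrightarrow> k x"
        by (rule tendsto_eventually)
    qed
    show "integrable unit_meas (\<lambda>x. C\<^sup>2)"
      using integrable_const_unit .
    show "AE x in unit_meas. \<forall>n. norm (k x - end_weight x *\<^sub>R q n x) \<le> C"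
    proof (intro AE_I2 allI)
      fix x n assume "x \<in> space unit_meas"
      then have x: "0 \<le> x" "x \<le> 1" "0 < end_weight x" by (auto intro: end_weight_pos)
      let ?t = "end_weight x * inverse (max (end_weight x) (inverse (Suc n)))"
      have m: "end_weight x \<le> max (end_weight x) (inverse (Suc n))" by simp
      then have t: "0 \<le> ?t" "?t \<le> 1"
        using x by (auto simp: field_simps simp del: max.cobounded1 max.bounded_iff)
      have "k x - end_weight x *\<^sub>R q n x = (1 - ?t) *\<^sub>R k x"
        by (simp add: q_def scaleR_diff_left)
      then have "norm (k x - end_weight x *\<^sub>R q n x) = (1 - ?t) * norm (k x)"
        using t by simp
      also have "\<dots> \<le> 1 * norm (k x)"
        using t by (intro mult_right_mono) auto
      also have "\<dots> \<le> C" using C(2)[of x] x by simp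
      finally show "norm (k x - end_weight x *\<^sub>R q n x) \<le> C" .
    qed
  qed
qed

section \<open>Truncation: from continuous to square-integrable functions\<close>

definition clip :: "real \<Rightarrow> 'b::euclidean_space \<Rightarrow> 'b" where
  "clip M v = (M / max M (norm v)) *\<^sub>R v"

text \<open>\<open>clip M\<close> is the radial retraction onto the closed ball of radius
  \<open>M\<close>. Being continuous, it truncates without losing continuity or
  measurability.\<close>

lemma clip_props:
  assumes "M > 0"
  shows "norm (clip M v) \<le> M" "norm v \<le> M \<Longrightarrow> clip M v = v" "norm (v - clip M v) \<le> norm v"
    "continuous_on UNIV (clip M)"
proof -
  show "norm (clip M v) \<le> M"
    using assms by (auto simp: clip_def max_def)
  show "norm v \<le> M \<Longrightarrow> clip M v = v"
    using assms by (simp add: clip_def)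
  have t: "0 \<le> M / max M (norm v)" "M / max M (norm v) \<le> 1"
    using assms by (auto intro: divide_nonneg_pos simp: divide_le_eq_1_pos)
  have "v - clip M v = (1 - M / max M (norm v)) *\<^sub>R v"
    by (simp add: clip_def scaleR_diff_left)
  then have "norm (v - clip M v) = (1 - M / max M (norm v)) * norm v"
    using t by simp
  also have "\<dots> \<le> 1 * norm v" using t by (intro mult_right_mono) auto
  finally show "norm (v - clip M v) \<le> norm v" by simp
  show "continuous_on UNIV (clip M)"
    unfolding clip_def using assms by (intro continuous_intros) (auto simp: max_def)
qed

text \<open>Lebesgue measurability provides continuous functions converging to \<open>f\<close> off
  a negligible set. Clipping them at \<open>M\<close> leaves the limit unchanged, because
  \<open>f\<close> stays in the ball, and supplies the majorant \<open>2 * M\<close>.\<close>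

lemma poly_approx_bounded:
  assumes f: "(f :: real \<Rightarrow> 'b::euclidean_space) \<in> borel_measurable unit_meas"
    and M: "M > 0" "\<And>x. norm (f x) \<le> M"
  shows "poly_approx f"
proof -
  have "f measurable_on {0<..<1}"
    using f by (subst measurable_on_iff_borel_measurable) auto
  then obtain N g where N: "negligible N" and g: "\<And>n. continuous_on UNIV (g n)"
    and lim: "\<And>x. x \<notin> N \<Longrightarrow> (\<lambda>n. g n x) \<longlonglongrightarrow> (if x \<in> {0<..<1} then f x else 0)"
    unfolding measurable_on_def by blast
  have cc: "continuous_on S (\<lambda>x. clip M (g n x))" for n S
    using continuous_on_compose2[OF clip_props(4)[OF M(1)] continuous_on_subset[OF g]] by blast
  have sf: "sq_int f"
    using sq_int_bound[OF sq_int_const[of "1::real"] f, of M] M by simp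
  show ?thesis
  proof (rule poly_approx_limit[where s = "\<lambda>n x. clip M (g n x)" and H = "\<lambda>x. 2 * M"])
    show "sq_int f" by fact
    show "sq_int (\<lambda>x. clip M (g n x))" for n by (rule sq_int_continuous[OF cc])
    show "poly_approx (\<lambda>x. clip M (g n x))" for n by (rule poly_approx_continuous[OF cc])
    show "integrable unit_meas (\<lambda>x. (2 * M)\<^sup>2)"
      using integrable_const_unit .
    show "AE x in unit_meas. \<forall>n. norm (f x - clip M (g n x)) \<le> 2 * M"
    proof (intro AE_I2 allI)
      fix x n
      show "norm (f x - clip M (g n x)) \<le> 2 * M"
        using norm_triangle_ineq4[of "f x" "clip M (g n x)"] M(2)[of x]
          clip_props(1)[OF M(1), of "g n x"] by simp
    qed
    have "AE x in lebesgue. x \<notin> N"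
      using N by (auto simp: eventually_ae_filter negligible_iff_null_sets)
    then have "AE x in lebesgue. x \<in> {0<..<1} \<longrightarrow> (\<lambda>n. clip M (g n x)) \<longlonglongrightarrow> f x"
    proof eventually_elim
      case (elim x)
      show ?case
      proof
        assume "x \<in> {0<..<1}"
        with lim[OF elim] have "(\<lambda>n. g n x) \<longlonglongrightarrow> f x" by simp
        then have "(\<lambda>n. clip M (g n x)) \<longlonglongrightarrow> clip M (f x)"
          using clip_props(4)[OF M(1)] by (auto intro: continuous_on_tendsto_compose)
        then show "(\<lambda>n. clip M (g n x)) \<longlonglongrightarrow> f x"
          using clip_props(2)[OF M(1) M(2)] by simp
      qed
    qed
    then show "AE x in unit_meas. (\<lambda>n. clip M (g n x)) \<longlonglongrightarrow> f x"
      by (simp add: AE_restrict_space_iff)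
  qed
qed

text \<open>At each point the truncations at height \<open>Suc n\<close> are eventually equal to
  \<open>f\<close>, and the error never exceeds \<open>norm (f x)\<close>.\<close>

theorem poly_approx_sq_int:
  assumes "sq_int f"
  shows "poly_approx f"
proof (rule poly_approx_limit[where s = "\<lambda>n x. clip (Suc n) (f x)" and H = "\<lambda>x. norm (f x)"])
  have m: "(\<lambda>x. clip (Suc n) (f x)) \<in> borel_measurable unit_meas" for n
    using assms clip_props(4)[of "Suc n"]
    by (auto simp: sq_int_def intro: measurable_compose borel_measurable_continuous_onI)
  show "sq_int (\<lambda>x. clip (real (Suc n)) (f x))" for n
    by (rule sq_int_bound[OF sq_int_const[of "1::real"] m, of _ "real (Suc n)"])
      (use clip_props(1)[of "real (Suc n)"] in auto)
  show "poly_approx (\<lambda>x. clip (real (Suc n)) (f x))" for n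
    by (rule poly_approx_bounded[OF m, where M = "real (Suc n)"]) (use clip_props(1)[of "real (Suc n)"] in auto)
  show "AE x in unit_meas. (\<lambda>n. clip (real (Suc n)) (f x)) \<longlonglongrightarrow> f x"
  proof (rule AE_I2)
    fix x
    obtain N where N: "norm (f x) \<le> real N" using real_arch_simple by blast
    have "\<forall>\<^sub>F n in sequentially. clip (real (Suc n)) (f x) = f x"
      unfolding eventually_sequentially
    proof (intro exI allI impI)
      fix n assume "N \<le> n"
      then show "clip (real (Suc n)) (f x) = f x" using N by (intro clip_props(2)) auto
    qed
    then show "(\<lambda>n. clip (real (Suc n)) (f x)) \<longlonglongrightarrow> f x" by (rule tendsto_eventually)
  qed
  show "AE x in unit_meas. \<forall>n. norm (f x - clip (real (Suc n)) (f x)) \<le> norm (f x)"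
    by (intro AE_I2 allI clip_props(3)) simp
qed (use assms in \<open>auto simp: sq_int_def\<close>)

subsection \<open>Smooth functions and test functions\<close>

definition smooth :: "(real \<Rightarrow> real) \<Rightarrow> bool" where
  "smooth f \<longleftrightarrow> (\<forall>k x. (deriv ^^ k) f field_differentiable at x)"

text \<open>Iterated derivatives cannot leave a class in which every member has a derivative
  belonging to the class. Smoothness can thus be shown without any formula for the higher
  derivatives.\<close>

lemma smooth_coinduct:
  assumes "P f" and step: "\<And>g. P g \<Longrightarrow> \<exists>g'. P g' \<and> (\<forall>x. (g has_field_derivative g' x) (at x))"
  shows "smooth f"
proof -
  have "P ((deriv ^^ k) f)" for k
  proof (induction k)
    case (Suc k)
    obtain g' where g': "P g'" "\<And>x. ((deriv ^^ k) f has_field_derivative g' x) (at x)"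
      using step[OF Suc] by blast
    then have "(deriv ^^ Suc k) f = g'"
      by (auto intro: DERIV_imp_deriv)
    with g' show ?case by simp
  qed (simp add: assms)
  then show ?thesis
    unfolding smooth_def field_differentiable_def using step by blast
qed

lemma smooth_deriv:
  assumes "smooth f"
  shows "smooth (deriv f)" "(f has_field_derivative deriv f x) (at x)"
proof -
  have "(deriv ^^ k) (deriv f) = (deriv ^^ Suc k) f" for k
    by (simp add: funpow_swap1)
  then show "smooth (deriv f)"
    using assms unfolding smooth_def by metis
  have "f field_differentiable at x"
    using assms unfolding smooth_def by (metis funpow_0)
  then show "(f has_field_derivative deriv f x) (at x)"
    by (simp add: field_differentiable_derivI)
qed

lemma smooth_continuous: "smooth f \<Longrightarrow> continuous_on S f"
  by (meson DERIV_isCont continuous_at_imp_continuous_on smooth_deriv(2))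

text \<open>The derivative of a product is a sum of products, so products alone do not form a class
  closed under differentiation; the algebra generated by the smooth functions does.\<close>

inductive smooth_algebra :: "(real \<Rightarrow> real) \<Rightarrow> bool" where
  base: "smooth f \<Longrightarrow> smooth_algebra f"
| add: "smooth_algebra f \<Longrightarrow> smooth_algebra g \<Longrightarrow> smooth_algebra (\<lambda>x. f x + g x)"
| mult: "smooth_algebra f \<Longrightarrow> smooth_algebra g \<Longrightarrow> smooth_algebra (\<lambda>x. f x * g x)"

lemma smooth_algebra_deriv:
  "smooth_algebra f \<Longrightarrow> \<exists>f'. smooth_algebra f' \<and> (\<forall>x. (f has_field_derivative f' x) (at x))"
proof (induction rule: smooth_algebra.induct)
  case (base f)
  then show ?case using smooth_deriv smooth_algebra.base by blast
next
  case (add f g)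
  then obtain f' g' where "smooth_algebra f'" "smooth_algebra g'"
    "\<And>x. (f has_field_derivative f' x) (at x)" "\<And>x. (g has_field_derivative g' x) (at x)"
    by blast
  then show ?case
    by (intro exI[of _ "\<lambda>x. f' x + g' x"]) (auto intro: smooth_algebra.add derivative_intros)
next
  case (mult f g)
  then obtain f' g' where "smooth_algebra f'" "smooth_algebra g'"
    "\<And>x. (f has_field_derivative f' x) (at x)" "\<And>x. (g has_field_derivative g' x) (at x)"
    by blast
  with mult show ?case
    by (intro exI[of _ "\<lambda>x. f' x * g x + g' x * f x"])
      (auto intro: smooth_algebra.intros(2,3) DERIV_mult)
qed

lemma smooth_algebra_smooth: "smooth_algebra f \<Longrightarrow> smooth f"
  using smooth_coinduct[of smooth_algebra] smooth_algebra_deriv by blast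

lemma smooth_add: "smooth f \<Longrightarrow> smooth g \<Longrightarrow> smooth (\<lambda>x. f x + g x)"
  and smooth_mult: "smooth f \<Longrightarrow> smooth g \<Longrightarrow> smooth (\<lambda>x. f x * g x)"
  by (auto intro!: smooth_algebra_smooth intro: smooth_algebra.intros)

lemma smooth_polynomial: "real_polynomial_function f \<Longrightarrow> smooth f"
  using smooth_coinduct[of real_polynomial_function] has_real_derivative_polynomial_function by blast

lemma smooth_const: "smooth (\<lambda>x. c)"
  by (intro smooth_polynomial real_polynomial_function.intros)

lemma smooth_antiderivative:
  assumes "\<And>x. (f has_field_derivative g x) (at x)" "smooth g"
  shows "smooth f"
proof -
  have "deriv f = g" using assms(1) by (auto intro: DERIV_imp_deriv)
  moreover have "(deriv ^^ Suc k) f = (deriv ^^ k) (deriv f)" for k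
    by (simp add: funpow_swap1)
  ultimately have "(deriv ^^ k) f field_differentiable at x" for k x
    using assms unfolding smooth_def field_differentiable_def
    by (cases k) (auto simp del: funpow.simps(2) simp: field_differentiable_def)
  then show ?thesis by (simp add: smooth_def)
qed

lemma smooth_affine:
  assumes "smooth f"
  shows "smooth (\<lambda>x. f (a * x + b))"
\<comment> \<open>The scalar \<open>c\<close> in the class absorbs the factor \<open>a\<close> that
  each application of the chain rule produces.\<close>
proof (rule smooth_coinduct[where P = "\<lambda>h. \<exists>g c. smooth g \<and> h = (\<lambda>x. c * g (a * x + b))"])
  show "\<exists>g c. smooth g \<and> (\<lambda>x. f (a * x + b)) = (\<lambda>x. c * g (a * x + b))"
    using assms by (intro exI[of _ f] exI[of _ 1]) simp
  fix h assume "\<exists>g c. smooth g \<and> h = (\<lambda>x. c * g (a * x + b))"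
  then obtain g c where g: "smooth g" "h = (\<lambda>x. c * g (a * x + b))" by blast
  have "(h has_field_derivative (c * a) * deriv g (a * x + b)) (at x)" for x
    unfolding g(2)
    by (rule derivative_eq_intros DERIV_chain2[OF smooth_deriv(2)[OF g(1)]] refl | simp)+
  then show "\<exists>h'. (\<exists>g c. smooth g \<and> h' = (\<lambda>x. c * g (a * x + b))) \<and>
      (\<forall>x. (h has_field_derivative h' x) (at x))"
    using smooth_deriv(1)[OF g(1)]
    by (intro exI[of _ "\<lambda>x. (c * a) * deriv g (a * x + b)"]) blast
qed

section \<open>A smooth function that is flat at the origin\<close>

definition flat_step :: "real \<Rightarrow> real" where
  "flat_step x = (if 0 < x then exp (- inverse x) else 0)"

text \<open>These functions contain \<open>flat_step\<close> (for \<open>p = 1\<close>) and are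
  closed under differentiation, which is what \<open>smooth_coinduct\<close> requires.\<close>

definition flat_fun :: "real poly \<Rightarrow> real \<Rightarrow> real" where
  "flat_fun p x = (if 0 < x then poly p (inverse x) * exp (- inverse x) else 0)"

lemma poly_times_exp_minus_at_top:
  "((\<lambda>y. poly p y * exp (- y)) \<longlongrightarrow> 0) (at_top :: real filter)"
proof -
  have eq: "poly p y * exp (- y) = (\<Sum>i\<le>degree p. coeff p i * (y ^ i / exp y))" for y
    by (simp add: poly_altdef sum_distrib_right exp_minus divide_inverse mult.assoc)
  have "((\<lambda>y. \<Sum>i\<le>degree p. coeff p i * (y ^ i / exp y)) \<longlongrightarrow> (\<Sum>i\<le>degree p. coeff p i * 0)) at_top"
    by (intro tendsto_intros tendsto_power_div_exp_0)
  then show ?thesis by (simp add: eq)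
qed

text \<open>With y = 1/x, differentiating p(y) exp(-y) in x gives (p - p')(y) y^2 exp(-y). At the
  origin the right difference quotient is y p(y) exp(-y) with y tending to infinity, so the
  exponential wins.\<close>

lemma flat_fun_deriv:
  "(flat_fun p has_field_derivative
     flat_fun ((p - pderiv p) * [:0, 0, 1:]) x) (at x)"
proof -
  consider "x < 0" | "x > 0" | "x = 0" by linarith
  then show ?thesis
  proof cases
    case 1
    have "((\<lambda>x. 0) has_field_derivative 0) (at x)" by simp
    moreover have "\<forall>\<^sub>F y in nhds x. flat_fun p y = 0"
      using eventually_nhds_in_open[of "{..<0}" x] 1
      by (auto simp: flat_fun_def elim!: eventually_mono)
    ultimately show ?thesis
      using 1 DERIV_cong_ev[of x x "flat_fun p" "\<lambda>x. 0" "flat_fun ((p - pderiv p) * [:0, 0, 1:]) x" 0]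
      by (simp add: flat_fun_def)
  next
    case 2
    have "((\<lambda>x. poly p (inverse x) * exp (- inverse x)) has_field_derivative
        poly ((p - pderiv p) * [:0, 0, 1:]) (inverse x) * exp (- inverse x)) (at x)"
      using 2
      by (auto intro!: derivative_eq_intros DERIV_chain2[OF poly_DERIV] DERIV_chain2[OF DERIV_exp]
          simp: field_simps power2_eq_square)
    moreover have "\<forall>\<^sub>F y in nhds x. flat_fun p y = poly p (inverse y) * exp (- inverse y)"
      using eventually_nhds_in_open[of "{0<..}" x] 2
      by (auto simp: flat_fun_def elim!: eventually_mono)
    ultimately show ?thesis
      using 2 DERIV_cong_ev[OF refl, of "flat_fun p" "\<lambda>y. poly p (inverse y) * exp (- inverse y)"]
      by (simp add: flat_fun_def)
  next
    case 3
    have "((\<lambda>h. flat_fun p h / h) \<longlongrightarrow> 0) (at_left 0)"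
      by (rule tendsto_eventually) (auto simp: eventually_at_left_field flat_fun_def intro: exI[of _ "-1"])
    moreover have "((\<lambda>h. flat_fun p h / h) \<longlongrightarrow> 0) (at_right 0)"
    proof -
      have "((\<lambda>h. poly (p * [:0, 1:]) (inverse h) * exp (- inverse h)) \<longlongrightarrow> 0) (at_right (0 :: real))"
        using filterlim_compose[OF poly_times_exp_minus_at_top filterlim_inverse_at_top_right] .
      moreover have "\<forall>\<^sub>F h in at_right 0.
          poly (p * [:0, 1:]) (inverse h) * exp (- inverse h) = flat_fun p h / h"
        by (auto simp: eventually_at_right_field flat_fun_def field_simps intro: exI[of _ 1])
      ultimately show ?thesis by (rule Lim_transform_eventually)
    qed
    ultimately have "((\<lambda>h. flat_fun p h / h) \<longlongrightarrow> 0) (at 0)"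
      by (simp add: filterlim_split_at)
    then show ?thesis
      using 3 by (simp add: DERIV_def flat_fun_def)
  qed
qed

lemma smooth_flat_step: "smooth flat_step"
proof -
  have "smooth (flat_fun p)" for p
    by (rule smooth_coinduct[where P = "\<lambda>f. \<exists>p. f = flat_fun p"]) (use flat_fun_deriv in blast)+
  moreover have "flat_step = flat_fun 1"
    by (auto simp: flat_step_def flat_fun_def)
  ultimately show ?thesis by metis
qed

section \<open>Supports of test functions and cut-offs\<close>

lemma test_functionI:
  assumes "smooth \<psi>" "{x. \<psi> x \<noteq> 0} \<subseteq> {u..v}" "0 < u" "v < 1"
  shows "test_function \<psi>"
proof -
  have "closure {x. \<psi> x \<noteq> 0} \<subseteq> {u..v}"
    using assms(2) by (simp add: closure_minimal)
  moreover from this have "compact (closure {x. \<psi> x \<noteq> 0})"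
    using compact_Int_closed[of "{u..v}" "closure {x. \<psi> x \<noteq> 0}"] by (simp add: inf.absorb2)
  ultimately show ?thesis
    using assms unfolding test_function_def smooth_def by force
qed

lemma test_functionE:
  assumes "test_function \<psi>"
  obtains u v where "smooth \<psi>" "0 < u" "u < v" "v < 1" "{x. \<psi> x \<noteq> 0} \<subseteq> {u<..<v}"
proof -
  let ?K = "closure {x. \<psi> x \<noteq> 0}"
  have K: "compact ?K" "?K \<subseteq> {0<..<1}" and s: "smooth \<psi>"
    using assms by (auto simp: test_function_def smooth_def)
  show thesis
  proof (cases "?K = {}")
    case True
    then have "{x. \<psi> x \<noteq> 0} = {}" by (simp only: closure_eq_empty)
    then have "{x. \<psi> x \<noteq> 0} \<subseteq> {1/3<..<1/2}" by blast
    then show ?thesis by (intro that[of "1/3" "1/2", OF s]) auto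
  next
    case False
    obtain p where p: "p \<in> ?K" "\<And>y. y \<in> ?K \<Longrightarrow> p \<le> y"
      using compact_attains_inf[OF K(1) False] by blast
    obtain q where q: "q \<in> ?K" "\<And>y. y \<in> ?K \<Longrightarrow> y \<le> q"
      using compact_attains_sup[OF K(1) False] by blast
    have pq: "0 < p" "p \<le> q" "q < 1" using K(2) p q by auto
    \<comment> \<open>The bounds lie halfway between the extreme points of the support and the ends
      of the unit interval, so the enclosing interval is open and nonempty even if
      \<open>p = q\<close>.\<close>
    have "{x. \<psi> x \<noteq> 0} \<subseteq> {p / 2<..<(q + 1) / 2}"
    proof
      fix x assume "x \<in> {x. \<psi> x \<noteq> 0}"
      then have "x \<in> ?K" by (rule subsetD[OF closure_subset])
      then have "p \<le> x" "x \<le> q" using p(2) q(2) by auto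
      then show "x \<in> {p / 2<..<(q + 1) / 2}" using pq by auto
    qed
    then show ?thesis using pq by (intro that[of "p / 2" "(q + 1) / 2", OF s]) auto
  qed
qed

lemma test_function_deriv:
  assumes "test_function \<psi>"
  shows "test_function (deriv \<psi>)"
proof -
  obtain u v where uv: "smooth \<psi>" "0 < u" "u < v" "v < 1" "{x. \<psi> x \<noteq> 0} \<subseteq> {u<..<v}"
    using test_functionE[OF assms] .
  show ?thesis
  proof (rule test_functionI[OF smooth_deriv(1)[OF uv(1)] _ uv(2) uv(4)], rule ccontr)
    assume "\<not> {x. deriv \<psi> x \<noteq> 0} \<subseteq> {u..v}"
    then obtain x where x: "deriv \<psi> x \<noteq> 0" "x \<in> - {u..v}" by blast
    have "\<forall>\<^sub>F y in nhds x. y \<in> - {u..v}"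
      by (rule eventually_nhds_in_open) (use x in auto)
    then have "\<forall>\<^sub>F y in nhds x. \<psi> y = 0"
      by eventually_elim (use uv(5) in force)
    then have "(\<psi> has_field_derivative 0) (at x)"
      using DERIV_cong_ev[OF refl, of \<psi> "\<lambda>x. 0"] by simp
    then show False using x DERIV_imp_deriv by blast
  qed
qed

lemma test_function_mult:
  assumes "test_function \<psi>" "smooth r"
  shows "test_function (\<lambda>x. \<psi> x * r x)"
proof -
  obtain u v where uv: "smooth \<psi>" "0 < u" "u < v" "v < 1" "{x. \<psi> x \<noteq> 0} \<subseteq> {u<..<v}"
    using test_functionE[OF assms(1)] .
  show ?thesis
    by (rule test_functionI[OF smooth_mult[OF uv(1) assms(2)] _ uv(2) uv(4)]) (use uv(5) in force)
qed

text \<open>A cut-off that converges to 1 pointwise on the open interval while staying between 0 and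
  1. Its values remain below 1, but this convergence is all that dominated convergence asks
  for.\<close>

definition plateau :: "nat \<Rightarrow> real \<Rightarrow> real" where
  "plateau n x = flat_step (real (Suc n) * x - 1) * flat_step (real (Suc n) * (1 - x) - 1)"

lemma test_function_plateau: "test_function (plateau n)"
\<comment> \<open>For \<open>n = 0\<close> the interval is \<open>{1..0}\<close>, which is empty, in
  accordance with \<open>plateau 0\<close> being identically zero.\<close>
proof (rule test_functionI[where u = "1 / Suc n" and v = "1 - 1 / Suc n"])
  show "smooth (plateau n)"
    using smooth_mult[OF smooth_affine[OF smooth_flat_step, of "real (Suc n)" "- 1"]
        smooth_affine[OF smooth_flat_step, of "- real (Suc n)" "real (Suc n) - 1"]]
    by (simp add: plateau_def[abs_def] algebra_simps)
  show "{x. plateau n x \<noteq> 0} \<subseteq> {1 / real (Suc n)..1 - 1 / real (Suc n)}"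
    by (auto simp: plateau_def flat_step_def field_simps split: if_splits)
qed auto

lemma plateau_bounds: "0 \<le> plateau n x" "plateau n x \<le> 1"
  by (auto simp: plateau_def flat_step_def mult_le_one)

lemma plateau_tendsto:
  assumes "0 < x" "x < 1"
  shows "(\<lambda>n. plateau n x) \<longlonglongrightarrow> 1"
proof -
  have lim: "(\<lambda>n. flat_step (real (Suc n) * y - 1)) \<longlonglongrightarrow> 1" if "y > 0" for y
  proof -
    have top: "filterlim (\<lambda>n. real (Suc n) * y - 1) at_top sequentially"
    proof -
      have "filterlim (\<lambda>n. real (Suc n)) at_top sequentially"
        by (rule filterlim_compose[OF filterlim_real_sequentially filterlim_Suc])
      then have "filterlim (\<lambda>n. y * real (Suc n)) at_top sequentially"
        by (rule filterlim_tendsto_pos_mult_at_top[OF tendsto_const that])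
      then have "filterlim (\<lambda>n. - 1 + y * real (Suc n)) at_top sequentially"
        by (rule filterlim_tendsto_add_at_top[OF tendsto_const])
      then show ?thesis by (simp add: algebra_simps)
    qed
    have "((\<lambda>n. exp (- inverse (real (Suc n) * y - 1))) \<longlongrightarrow> exp (- 0)) sequentially"
      by (intro tendsto_intros tendsto_inverse_0_at_top top)
    moreover have "\<forall>\<^sub>F n in sequentially.
        exp (- inverse (real (Suc n) * y - 1)) = flat_step (real (Suc n) * y - 1)"
      using filterlim_at_top_dense[THEN iffD1, OF top, rule_format, of 0]
      by eventually_elim (simp add: flat_step_def)
    ultimately show ?thesis by (auto intro: Lim_transform_eventually)
  qed
  show ?thesis
    unfolding plateau_def using tendsto_mult[OF lim lim, of x "1 - x"] assms by simp
qed

subsection \<open>The fundamental lemma of the calculus of variations\<close>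

lemma integrable_scaleR_cont:
  assumes "continuous_on {0..1} (k :: real \<Rightarrow> real)" "sq_int g"
  shows "integrable unit_meas (\<lambda>x. k x *\<^sub>R g x)"
  by (intro integrable_sq_int sq_int_bilinear_continuous[OF bounded_bilinear_scaleR] assms)

text \<open>Multiplication by \<open>plateau n\<close> turns a smooth function into a test function,
  so what holds for integrals against test functions passes to integrals against all smooth
  functions.\<close>

lemma integral_plateau_tendsto:
  assumes "sq_int g" "smooth r"
  shows "(\<lambda>n. LINT x|unit_meas. (plateau n x * r x) *\<^sub>R g x) \<longlonglongrightarrow> (LINT x|unit_meas. r x *\<^sub>R g x)"
proof -
  have i: "integrable unit_meas (\<lambda>x. r x *\<^sub>R g x)"
    by (intro integrable_scaleR_cont smooth_continuous assms)
  show ?thesis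
  proof (rule integral_dominated_convergence[where w = "\<lambda>x. norm (r x *\<^sub>R g x)"])
    show "(\<lambda>x. r x *\<^sub>R g x) \<in> borel_measurable unit_meas" using i by auto
    show "(\<lambda>x. (plateau n x * r x) *\<^sub>R g x) \<in> borel_measurable unit_meas" for n
    proof -
      obtain u v where "smooth (plateau n)" using test_functionE[OF test_function_plateau] by blast
      then show ?thesis
        using integrable_scaleR_cont[OF smooth_continuous[OF smooth_mult[OF _ assms(2)]] assms(1)]
        by (meson borel_measurable_integrable)
    qed
    show "AE x in unit_meas. (\<lambda>n. (plateau n x * r x) *\<^sub>R g x) \<longlonglongrightarrow> r x *\<^sub>R g x"
    proof (rule AE_I2)
      fix x :: real assume "x \<in> space unit_meas"
      then have "(\<lambda>n. plateau n x) \<longlonglongrightarrow> 1" by (intro plateau_tendsto) auto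
      then have "(\<lambda>n. (plateau n x * r x) *\<^sub>R g x) \<longlonglongrightarrow> (1 * r x) *\<^sub>R g x"
        by (intro tendsto_intros)
      then show "(\<lambda>n. (plateau n x * r x) *\<^sub>R g x) \<longlonglongrightarrow> r x *\<^sub>R g x" by simp
    qed
    show "AE x in unit_meas. norm ((plateau n x * r x) *\<^sub>R g x) \<le> norm (r x *\<^sub>R g x)" for n
      using plateau_bounds[of n] by (intro AE_I2) (simp add: abs_mult mult_left_le_one_le mult.assoc)
  qed (use i in \<open>rule integrable_norm\<close>)
qed

text \<open>Cut-offs extend the orthogonality from test functions to all smooth functions, in
  particular to polynomials in each coordinate. If a weighted polynomial \<open>q\<close> is close
  to \<open>g\<close>, Pythagoras bounds the squared norm of \<open>g\<close> by that of
  \<open>g - q\<close>.\<close>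

theorem sq_int_zero_if_test_zero:
  fixes g :: "real \<Rightarrow> 'b::euclidean_space"
  assumes g: "sq_int g"
    and 0: "\<And>\<psi>. test_function \<psi> \<Longrightarrow> (LINT x|unit_meas. \<psi> x *\<^sub>R g x) = 0"
  shows "AE x in unit_meas. g x = 0"
proof -
  have r0: "(LINT x|unit_meas. r x *\<^sub>R g x) = 0" if "smooth r" for r
  proof -
    have "(\<lambda>n. LINT x|unit_meas. (plateau n x * r x) *\<^sub>R g x) = (\<lambda>n. 0)"
      using 0[OF test_function_mult[OF test_function_plateau that]] by simp
    then show ?thesis
      using integral_plateau_tendsto[OF g that] LIMSEQ_unique tendsto_const by metis
  qed
  have p0: "(LINT x|unit_meas. inner (g x) (p x)) = 0" if "polynomial_function p" for p
  proof -
    have sm: "smooth (\<lambda>x. inner (p x) b)" if "b \<in> Basis" for b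
      using \<open>polynomial_function p\<close> that
      by (auto simp: polynomial_function_iff_Basis_inner intro: smooth_polynomial)
    have i: "integrable unit_meas (\<lambda>x. inner (p x) b *\<^sub>R g x)" if "b \<in> Basis" for b
      using integrable_scaleR_cont[OF smooth_continuous[OF sm[OF that]] g] .
    have "(LINT x|unit_meas. inner (g x) (p x))
        = (LINT x|unit_meas. (\<Sum>b\<in>Basis. inner (inner (p x) b *\<^sub>R g x) b))"
      by (intro Bochner_Integration.integral_cong refl)
        (subst euclidean_inner, simp add: mult.commute)
    also have "\<dots> = (\<Sum>b\<in>Basis. LINT x|unit_meas. inner (inner (p x) b *\<^sub>R g x) b)"
      using i by (intro Bochner_Integration.integral_sum integrable_inner_left) auto
    also have "\<dots> = (\<Sum>b\<in>Basis. inner (LINT x|unit_meas. inner (p x) b *\<^sub>R g x) b)"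
      using i by (intro sum.cong refl integral_inner_left) auto
    also have "\<dots> = 0" using r0[OF sm] by simp
    finally show ?thesis .
  qed
  have ig: "integrable unit_meas (\<lambda>x. (norm (g x))\<^sup>2)"
    using g by (simp add: sq_int_def)
  have le: "(LINT x|unit_meas. (norm (g x))\<^sup>2) \<le> e" if e: "e > 0" for e
  proof -
    obtain p where p: "polynomial_function p"
      "(LINT x|unit_meas. (norm (g x - end_weight x *\<^sub>R p x))\<^sup>2) < e"
      using poly_approx_sq_int[OF g, unfolded poly_approx_def, rule_format, OF e] by auto
    define q where "q x = end_weight x *\<^sub>R p x" for x
    have "real_polynomial_function (\<lambda>x :: real. x)"
      by (rule real_polynomial_function.intros(1)) (rule bounded_linear_ident)
    then have "real_polynomial_function end_weight"
      unfolding end_weight_def[abs_def]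
      by (intro real_polynomial_function_power real_polynomial_function.intros(2,4)
          real_polynomial_function_diff)
    \<comment> \<open>The weight is itself a polynomial, so the approximant \<open>q\<close> is
      among the functions to which \<open>g\<close> is orthogonal.\<close>
    then have qp: "polynomial_function q"
      unfolding q_def[abs_def] using p(1)
      by (intro polynomial_function_mult) (simp_all add: real_polynomial_function_eq)
    have sq: "sq_int q"
      by (intro sq_int_continuous continuous_on_polymonial_function qp)
    have i: "integrable unit_meas (\<lambda>x. (norm (g x - q x))\<^sup>2)" "integrable unit_meas (\<lambda>x. (norm (q x))\<^sup>2)"
        "integrable unit_meas (\<lambda>x. inner (g x) (q x))"
      using sq_int_diff[OF g sq] sq integrable_bilinear_sq_int[OF bounded_bilinear_inner g sq]
      by (auto simp: sq_int_def)
    have "(LINT x|unit_meas. (norm (g x - q x))\<^sup>2)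
        = (LINT x|unit_meas. (norm (g x))\<^sup>2 - 2 * inner (g x) (q x) + (norm (q x))\<^sup>2)"
      by (intro Bochner_Integration.integral_cong refl)
        (simp add: power2_norm_eq_inner inner_diff_left inner_diff_right inner_commute)
    also have "\<dots> = (LINT x|unit_meas. (norm (g x))\<^sup>2) + (LINT x|unit_meas. (norm (q x))\<^sup>2)"
      using i ig p0[OF qp] by simp
    finally have "(LINT x|unit_meas. (norm (g x))\<^sup>2) + (LINT x|unit_meas. (norm (q x))\<^sup>2) < e"
      using p(2) by (simp add: q_def)
    moreover have "0 \<le> (LINT x|unit_meas. (norm (q x))\<^sup>2)"
      by (rule integral_nonneg_AE) auto
    ultimately show ?thesis by linarith
  qed
  have nonpos: "(LINT x|unit_meas. (norm (g x))\<^sup>2) \<le> 0"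
    by (rule field_le_epsilon) (simp add: le)
  moreover have "0 \<le> (LINT x|unit_meas. (norm (g x))\<^sup>2)"
    by (rule integral_nonneg_AE) auto
  ultimately have "(LINT x|unit_meas. (norm (g x))\<^sup>2) = 0" using nonpos by linarith
  then have "AE x in unit_meas. (norm (g x))\<^sup>2 = 0"
    using integral_nonneg_eq_0_iff_AE[OF ig] by simp
  then show ?thesis by simp
qed

text \<open>The points of disagreement inside the open interval form an open negligible set, which
  is empty; continuity then reaches the end points. Subintervals are allowed so that the two sides
  of a jump can be treated separately.\<close>

lemma AE_eq_imp_eq_subinterval:
  fixes f g :: "real \<Rightarrow> 'b::euclidean_space"
  assumes f: "continuous_on {p..q} f" and g: "continuous_on {p..q} g"
    and pq: "0 \<le> p" "p < q" "q \<le> 1"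
    and ae: "AE x in unit_meas. p < x \<and> x < q \<longrightarrow> f x = g x"
    and x: "x \<in> {p..q}"
  shows "f x = g x"
proof -
  let ?h = "\<lambda>x. f x - g x"
  have ch: "continuous_on {p..q} ?h" by (intro continuous_intros f g)
  have "open ({p<..<q} \<inter> ?h -` (- {0}))"
    by (rule continuous_open_preimage[OF continuous_on_subset[OF ch]]) auto
  moreover have "{p<..<q} \<inter> ?h -` (- {0}) = {y. p < y \<and> y < q \<and> f y \<noteq> g y}"
    by auto
  ultimately have o: "open {y. p < y \<and> y < q \<and> f y \<noteq> g y}" by simp
  have "AE x in lebesgue. x \<in> {0<..<1} \<longrightarrow> p < x \<and> x < q \<longrightarrow> f x = g x"
    using ae by (simp add: AE_restrict_space_iff)
  then have "AE x in lebesgue. x \<notin> {y. p < y \<and> y < q \<and> f y \<noteq> g y}"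
    by eventually_elim (use pq in auto)
  then have "negligible {y. p < y \<and> y < q \<and> f y \<noteq> g y}"
    by (auto simp: eventually_ae_filter negligible_iff_null_sets intro: null_sets_completion_subset)
  then have "{y. p < y \<and> y < q \<and> f y \<noteq> g y} = {}"
    using open_not_negligible[OF o] by blast
  then have e: "?h y = 0" if "y \<in> {p<..<q}" for y
    using that by auto
  have cl: "closure {p<..<q} = {p..q}" using pq by simp
  have "?h x = 0"
    by (rule continuous_constant_on_closure[of "{p<..<q}" ?h]) (use ch x e cl in auto)
  then show ?thesis by simp
qed

text \<open>This is the du Bois-Reymond lemma. A test function of integral zero is the derivative of
  a test function, and every \<omega> acquires integral zero after subtracting a multiple of a fixed
  normalised \<eta>. The constant is therefore the integral of \<eta> u.\<close>

lemma constant_if_test_deriv_zero: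
  fixes u :: "real \<Rightarrow> 'b::euclidean_space"
  assumes u: "continuous_on {0..1} u"
    and 0: "\<And>\<psi>. test_function \<psi> \<Longrightarrow> (LINT x|unit_meas. deriv \<psi> x *\<^sub>R u x) = 0"
  shows "\<exists>c. \<forall>x\<in>{0..1}. u x = c"
proof -
  have su: "sq_int u" by (rule sq_int_continuous[OF u])
  have i1: "integrable unit_meas (\<lambda>x. \<psi> x *\<^sub>R u x)" "integrable unit_meas \<psi>" if "test_function \<psi>" for \<psi>
  proof -
    have "continuous_on {0..1} \<psi>" using that by (auto elim: test_functionE intro: smooth_continuous)
    then show "integrable unit_meas (\<lambda>x. \<psi> x *\<^sub>R u x)" "integrable unit_meas \<psi>"
      using integrable_scaleR_cont[OF _ su] integrable_sq_int[OF sq_int_continuous] by auto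
  qed
  have "(\<lambda>n. LINT x|unit_meas. (plateau n x * 1) *\<^sub>R (1::real)) \<longlonglongrightarrow> (LINT x|unit_meas. 1 *\<^sub>R 1)"
    by (rule integral_plateau_tendsto[OF sq_int_const smooth_const])
  then have "(\<lambda>n. LINT x|unit_meas. plateau n x) \<longlonglongrightarrow> 1"
    using measure_unit_meas by simp
  then have "\<forall>\<^sub>F n in sequentially. 0 < (LINT x|unit_meas. plateau n x)"
    by (rule order_tendstoD(1)) simp
  then obtain n where n: "0 < (LINT x|unit_meas. plateau n x)"
    by (auto simp: eventually_sequentially)
  define m where "m = (LINT x|unit_meas. plateau n x)"
  \<comment> \<open>Normalisation is possible because the integrals of the cut-offs tend to 1, so
    one of them is positive.\<close>
  define \<eta> where "\<eta> x = inverse m * plateau n x" for x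
  define c where "c = (LINT x|unit_meas. \<eta> x *\<^sub>R u x)"
  have \<eta>: "test_function \<eta>"
    using test_function_mult[OF test_function_plateau[of n] smooth_const[of "inverse m"]]
    by (simp add: \<eta>_def[abs_def] mult.commute)
  have \<eta>1: "(LINT x|unit_meas. \<eta> x) = 1"
    using n by (simp add: \<eta>_def m_def)
  have "AE x in unit_meas. u x - c = 0"
  proof (rule sq_int_zero_if_test_zero[OF sq_int_diff[OF su sq_int_const]])
    fix \<omega> assume \<omega>: "test_function \<omega>"
    define k where "k = (LINT x|unit_meas. \<omega> x)"
    define h where "h x = \<omega> x + (- k) * \<eta> x" for x
    obtain p q where pq: "smooth \<omega>" "0 < p" "p < q" "q < 1" "{x. \<omega> x \<noteq> 0} \<subseteq> {p<..<q}"
      using test_functionE[OF \<omega>] .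
    obtain p' q' where pq': "smooth \<eta>" "0 < p'" "p' < q'" "q' < 1" "{x. \<eta> x \<noteq> 0} \<subseteq> {p'<..<q'}"
      using test_functionE[OF \<eta>] .
    define r s where "r = min p p'" and "s = max q q'"
    have rs: "0 < r" "r < s" "s < 1" using pq pq' by (auto simp: r_def s_def)
    have h0: "h x = 0" if "x \<notin> {r<..<s}" for x
    proof -
      have "x \<notin> {p<..<q}" "x \<notin> {p'<..<q'}" using that by (auto simp: r_def s_def)
      then have "\<omega> x = 0" "\<eta> x = 0" using pq(5) pq'(5) by auto
      then show ?thesis by (simp add: h_def)
    qed
    have sh: "smooth h"
      unfolding h_def[abs_def] by (intro smooth_add smooth_mult smooth_const pq pq')
    have ih: "(LINT x|unit_meas. h x) = 0"
      using i1(2)[OF \<omega>] i1(2)[OF \<eta>] \<eta>1 by (simp add: h_def k_def)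
    have hint: "h integrable_on {a..b}" for a b
      by (intro integrable_continuous_real smooth_continuous sh)
    \<comment> \<open>Starting at -1, outside the support of \<open>h\<close>, makes every
      \<open>x \<ge> 0\<close> interior to \<open>{-1..x+1}\<close>, where the one-sided derivative
      of the integral is an ordinary derivative. For negative \<open>x\<close> the function vanishes
      nearby.\<close>
    define P where "P x = integral {-1..x} h" for x
    have P0: "P x = 0" if "x \<le> r" for x
      unfolding P_def by (intro integral_unique has_integral_is_0) (use that h0 in auto)
    have dP: "(P has_field_derivative h x) (at x)" for x
    proof (cases "x < 0")
      case True
      have "\<forall>\<^sub>F y in nhds x. P y = 0"
        using eventually_nhds_in_open[of "{..<0}" x] True P0 rs
        by (auto elim!: eventually_mono)
      moreover have "h x = 0" using h0 True rs by auto
      ultimately show ?thesis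
        using DERIV_cong_ev[OF refl, of P "\<lambda>x. 0"] by simp
    next
      case False
      have "(P has_vector_derivative h x) (at x within {-1..x+1})"
        unfolding P_def by (rule integral_has_vector_derivative) (use False in \<open>auto intro: smooth_continuous sh\<close>)
      moreover have "at x within {-1..x+1} = at x"
        using False by (intro at_within_interior) auto
      ultimately show ?thesis by (simp add: has_real_derivative_iff_has_vector_derivative)
    qed
    have P1: "P x = 0" if "x \<ge> s" for x
    proof -
      have "(h has_integral (LINT x|unit_meas. h x)) {0<..<1}"
        by (intro has_integral_integral_lebesgue_on integrable_sq_int sq_int_continuous smooth_continuous sh) auto
      then have "(h has_integral 0) {0<..<1}" by (simp add: ih)
      moreover have "(h has_integral 0) {0<..<1} \<longleftrightarrow> (h has_integral 0) {-1..x}"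
      proof -
        have eq: "(\<lambda>y. if y \<in> {0<..<1} then h y else 0) = (\<lambda>y. if y \<in> {-1..x} then h y else 0)"
          using h0 rs that by fastforce
        show ?thesis
          by (subst (1 2) has_integral_restrict_UNIV[symmetric]) (simp only: eq)
      qed
      ultimately show ?thesis by (simp add: P_def integral_unique)
    qed
    have tP: "test_function P"
    proof (rule test_functionI[OF smooth_antiderivative[OF dP sh] _ rs(1,3)])
      have "r \<le> x \<and> x \<le> s" if "P x \<noteq> 0" for x
        using that P0[of x] P1[of x] by linarith
      then show "{x. P x \<noteq> 0} \<subseteq> {r..s}" by auto
    qed
    have dP': "deriv P = h" using dP by (auto intro: DERIV_imp_deriv)
    have "0 = (LINT x|unit_meas. h x *\<^sub>R u x)"
      using 0[OF tP] dP' by simp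
    also have "\<dots> = (LINT x|unit_meas. \<omega> x *\<^sub>R u x - k *\<^sub>R (\<eta> x *\<^sub>R u x))"
      by (simp add: h_def algebra_simps)
    also have "\<dots> = (LINT x|unit_meas. \<omega> x *\<^sub>R u x) - k *\<^sub>R c"
      using i1(1)[OF \<omega>] i1(1)[OF \<eta>] by (simp add: c_def del: scaleR_scaleR)
    also have "k *\<^sub>R c = (LINT x|unit_meas. \<omega> x *\<^sub>R c)"
      using i1(2)[OF \<omega>] by (simp add: k_def)
    also have "(LINT x|unit_meas. \<omega> x *\<^sub>R u x) - (LINT x|unit_meas. \<omega> x *\<^sub>R c)
        = (LINT x|unit_meas. \<omega> x *\<^sub>R (u x - c))"
      using i1(1)[OF \<omega>] i1(2)[OF \<omega>] by (simp add: scaleR_diff_right)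
    finally show "(LINT x|unit_meas. \<omega> x *\<^sub>R (u x - c)) = 0" by simp
  qed
  then have "AE x in unit_meas. 0 < x \<and> x < 1 \<longrightarrow> u x = c"
    by eventually_elim simp
  then have "u x = c" if "x \<in> {0..1}" for x
    using AE_eq_imp_eq_subinterval[OF u continuous_on_const, of c x] that by simp
  then show ?thesis by blast
qed

subsection \<open>Integration by parts for absolutely continuous functions\<close>

text \<open>This passes from the Lebesgue integral over the open interval to gauge integrals over
  closed ones, where the fundamental theorem of calculus is available.\<close>

lemma sq_int_absolutely_integrable:
  assumes "sq_int g"
  shows "g absolutely_integrable_on {0..1}"
proof -
  have "g absolutely_integrable_on {0<..<1}"
    using integrable_sq_int[OF assms]
    by (simp add: set_integrable_def integrable_restrict_space)
  then show ?thesis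
    using absolutely_integrable_on_open_interval[where f = g and a = 0 and b = 1] by simp
qed

lemma sq_int_integrable_on:
  assumes "sq_int g" "0 \<le> x" "x \<le> 1"
  shows "g integrable_on {0..x}" "(\<lambda>x. norm (g x)) integrable_on {0..x}"
  using sq_int_absolutely_integrable[OF assms(1)] assms(2,3)
  unfolding absolutely_integrable_on_def by (auto intro: integrable_subinterval_real)

lemma unit_integral_eq:
  assumes "integrable unit_meas f"
  shows "(LINT x|unit_meas. f x) = integral {0..1} (f :: real \<Rightarrow> 'b::euclidean_space)"
  using lebesgue_integral_eq_integral[OF assms] by (simp add: integral_open_interval_real)

lemma primitive_bound:
  assumes "sq_int g" "0 \<le> x" "x \<le> 1"
  shows "norm (integral {0..x} g) \<le> (LINT t|unit_meas. norm (g t))"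
    and "integral {0..x} (\<lambda>t. norm (g t)) \<le> (LINT t|unit_meas. norm (g t))"
proof -
  have "integral {0..x} (\<lambda>t. norm (g t)) \<le> integral {0..1} (\<lambda>t. norm (g t))"
    using sq_int_integrable_on[OF assms(1)] assms by (intro integral_subset_le) auto
  also have "\<dots> = (LINT t|unit_meas. norm (g t))"
    using integrable_sq_int[OF assms(1)] by (intro unit_integral_eq[symmetric]) auto
  finally show le: "integral {0..x} (\<lambda>t. norm (g t)) \<le> (LINT t|unit_meas. norm (g t))" .
  have "norm (integral {0..x} g) \<le> integral {0..x} (\<lambda>t. norm (g t))"
    using sq_int_integrable_on[OF assms] by (intro integral_norm_bound_integral) auto
  with le show "norm (integral {0..x} g) \<le> (LINT t|unit_meas. norm (g t))" by simp
qed

lemma continuous_primitive: "sq_int g \<Longrightarrow> continuous_on {0..1} (\<lambda>x. integral {0..x} g)"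
  using sq_int_integrable_on(1)[of g 1] by (intro indefinite_integral_continuous_1) auto

text \<open>A general bilinear pairing lets one formula serve for test functions times vectors, for
  a function times a conjugated C^1 function, and for exponential factors in differential
  equations.\<close>

locale smooth_kernel =
  fixes B :: "'a::euclidean_space \<Rightarrow> 'b::euclidean_space \<Rightarrow> 'c::euclidean_space"
    and K K' :: "real \<Rightarrow> 'a"
  assumes bilin: "bounded_bilinear B"
    and K: "\<And>t. t \<in> {0..1} \<Longrightarrow> (K has_vector_derivative K' t) (at t within {0..1})"
    and K': "continuous_on {0..1} K'"
begin

lemma cont_K: "continuous_on {0..1} K"
  unfolding continuous_on_eq_continuous_within
  using has_vector_derivative_continuous K by blast

text \<open>The product rule for \<open>B (K t)\<close> applied to the primitive of
  \<open>g\<close>, read as a formula that makes sense for square-integrable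
  \<open>g\<close>.\<close>

definition integrand :: "(real \<Rightarrow> 'b) \<Rightarrow> real \<Rightarrow> 'c" where
  "integrand g t = B (K' t) (integral {0..t} g) + B (K t) (g t)"

lemma sq_int_B:
  assumes "sq_int g"
  shows "sq_int (\<lambda>t. B (K' t) (integral {0..t} g))" "sq_int (\<lambda>t. B (K t) (g t))"
  using sq_int_bilinear_continuous[OF bilin K' sq_int_continuous[OF continuous_primitive[OF assms]]]
    sq_int_bilinear_continuous[OF bilin cont_K assms] by auto

lemma sq_int_integrand: "sq_int g \<Longrightarrow> sq_int (integrand g)"
  unfolding integrand_def[abs_def] by (intro sq_int_add sq_int_B)

lemma parts_continuous:
  assumes g: "continuous_on {0..1} g" and x: "0 \<le> x" "x \<le> 1"
  shows "(integrand g has_integral B (K x) (integral {0..x} g)) {0..x}"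
proof -
  have "((\<lambda>t. B (K t) (integral {0..t} g)) has_vector_derivative integrand g t) (at t within {0..x})"
    if "t \<in> {0..x}" for t
  proof -
    have t: "t \<in> {0..1}" using that x by auto
    have "((\<lambda>t. B (K t) (integral {0..t} g)) has_vector_derivative integrand g t) (at t within {0..1})"
      using bounded_bilinear.has_vector_derivative[OF bilin K[OF t] integral_has_vector_derivative[OF g t]]
      by (simp add: integrand_def add.commute)
    then show ?thesis
      by (rule has_vector_derivative_within_subset) (use x in auto)
  qed
  from fundamental_theorem_of_calculus[OF x(1) this]
  show ?thesis by (simp add: bounded_bilinear.zero_right[OF bilin])
qed

text \<open>The defect \<open>err\<close> of the formula is unchanged by subtracting a continuous
  function from \<open>g\<close>, since the formula is classical there. It is bounded by the L^1
  norm, hence by the L^2 norm, so density makes it zero. No almost everywhere differentiation is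
  involved.\<close>

lemma parts_sq_int:
  assumes g: "sq_int g" and x: "0 \<le> x" "x \<le> 1"
  shows "(integrand g has_integral B (K x) (integral {0..x} g)) {0..x}"
proof -
  interpret bounded_bilinear B by (rule bilin)
  obtain M where M: "M > 0" "\<And>a b. norm (B a b) \<le> norm a * norm b * M"
    using pos_bounded by blast
  obtain k0 where k0: "k0 > 0" "\<And>t. 0 \<le> t \<Longrightarrow> t \<le> 1 \<Longrightarrow> norm (K t) \<le> k0"
    using continuous_on_unit_bounded[OF cont_K] by blast
  obtain k1 where k1: "k1 > 0" "\<And>t. 0 \<le> t \<Longrightarrow> t \<le> 1 \<Longrightarrow> norm (K' t) \<le> k1"
    using continuous_on_unit_bounded[OF K'] by blast
  \<comment> \<open>The term with \<open>K'\<close> contributes \<open>M * k1\<close>;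
    \<open>M * k0\<close> enters twice, once from the integrand and once from the boundary term at
    \<open>x\<close>.\<close>
  define C where "C = M * (k1 + 2 * k0)"
  have C: "C > 0" using M k0 k1 by (simp add: C_def)
  define err where "err r = integral {0..x} (integrand r) - B (K x) (integral {0..x} r)" for r
  have err_bound: "norm (err r) \<le> C * (LINT t|unit_meas. norm (r t))" if r: "sq_int r" for r
  proof -
    let ?n = "LINT t|unit_meas. norm (r t)"
    have n0: "0 \<le> ?n" by (rule integral_nonneg_AE) auto
    have "norm (integral {0..x} (integrand r)) \<le> integral {0..x} (\<lambda>t. M * k1 * ?n + M * k0 * norm (r t))"
    proof (rule integral_norm_bound_integral)
      show "integrand r integrable_on {0..x}"
        by (rule sq_int_integrable_on[OF sq_int_integrand[OF r] x])
      show "(\<lambda>t. M * k1 * ?n + M * k0 * norm (r t)) integrable_on {0..x}"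
        by (intro integrable_add integrable_on_mult_right sq_int_integrable_on[OF r x]) auto
      fix t assume t: "t \<in> {0..x}"
      have "norm (integrand r t) \<le> norm (B (K' t) (integral {0..t} r)) + norm (B (K t) (r t))"
        unfolding integrand_def by (rule norm_triangle_ineq)
      also have "\<dots> \<le> norm (K' t) * norm (integral {0..t} r) * M + norm (K t) * norm (r t) * M"
        by (intro add_mono M)
      also have "\<dots> \<le> k1 * ?n * M + k0 * norm (r t) * M"
        using t x M k0(1) k1(1)
        by (intro add_mono mult_right_mono mult_mono k0(2) k1(2) primitive_bound[OF r]) auto
      finally show "norm (integrand r t) \<le> M * k1 * ?n + M * k0 * norm (r t)"
        by (simp add: mult_ac)
    qed
    also have "\<dots> = x * (M * k1 * ?n) + M * k0 * integral {0..x} (\<lambda>t. norm (r t))"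
      using sq_int_integrable_on[OF r x] x
      by (subst integral_add) (auto intro: integrable_on_mult_right)
    also have "\<dots> \<le> 1 * (M * k1 * ?n) + M * k0 * ?n"
      using primitive_bound[OF r x] x M k0 k1 n0
      by (intro add_mono mult_right_mono mult_left_mono) auto
    finally have 1: "norm (integral {0..x} (integrand r)) \<le> M * k1 * ?n + M * k0 * ?n" by simp
    have "norm (B (K x) (integral {0..x} r)) \<le> norm (K x) * norm (integral {0..x} r) * M"
      by (rule M)
    also have "\<dots> \<le> k0 * ?n * M"
      using M k0(1) by (intro mult_right_mono mult_mono k0(2) primitive_bound[OF r] x) auto
    finally have 2: "norm (B (K x) (integral {0..x} r)) \<le> M * k0 * ?n" by (simp add: mult_ac)
    have "norm (err r) \<le> norm (integral {0..x} (integrand r)) + norm (B (K x) (integral {0..x} r))"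
      unfolding err_def by (rule norm_triangle_ineq4)
    also have "\<dots> \<le> C * ?n" using 1 2 by (simp add: C_def algebra_simps)
    finally show ?thesis .
  qed
  have err_diff: "err (\<lambda>t. g t - q t) = err g" if q: "continuous_on {0..1} q" for q
  proof -
    have sq: "sq_int q" by (rule sq_int_continuous[OF q])
    have p: "integral {0..t} (\<lambda>t. g t - q t) = integral {0..t} g - integral {0..t} q"
      if "0 \<le> t" "t \<le> 1" for t
      using sq_int_integrable_on[OF g that] sq_int_integrable_on[OF sq that]
      by (intro integral_diff) auto
    have "integral {0..x} (integrand (\<lambda>t. g t - q t)) = integral {0..x} (\<lambda>t. integrand g t - integrand q t)"
      using x by (intro integral_cong) (simp add: integrand_def p diff_right)
    also have "\<dots> = integral {0..x} (integrand g) - integral {0..x} (integrand q)"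
      by (intro integral_diff sq_int_integrable_on[OF sq_int_integrand x] g sq)
    also have "integral {0..x} (integrand q) = B (K x) (integral {0..x} q)"
      by (rule integral_unique[OF parts_continuous[OF q x]])
    finally show ?thesis
      by (simp add: err_def p x diff_right)
  qed
  have le: "norm (err g) \<le> e" if e: "e > 0" for e
  proof -
    obtain p where p: "polynomial_function p"
      "(LINT t|unit_meas. (norm (g t - end_weight t *\<^sub>R p t))\<^sup>2) < (e / C)\<^sup>2"
      using poly_approx_sq_int[OF g, unfolded poly_approx_def, rule_format, of "(e / C)\<^sup>2"] e C by auto
    let ?q = "\<lambda>t. end_weight t *\<^sub>R p t"
    have q: "continuous_on {0..1} ?q" by (rule continuous_end_weight_poly[OF p(1)])
    have sd: "sq_int (\<lambda>t. g t - ?q t)"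
      by (intro sq_int_diff g sq_int_continuous q)
    have "norm (err g) = norm (err (\<lambda>t. g t - ?q t))"
      using err_diff[OF q] by simp
    also have "\<dots> \<le> C * (LINT t|unit_meas. norm (g t - ?q t))"
      by (rule err_bound[OF sd])
    also have "\<dots> \<le> C * sqrt (LINT t|unit_meas. (norm (g t - ?q t))\<^sup>2)"
      using C by (intro mult_left_mono L1_le_L2 sd) auto
    also have "\<dots> \<le> C * sqrt ((e / C)\<^sup>2)"
      using C by (intro mult_left_mono real_sqrt_le_mono less_imp_le[OF p(2)]) auto
    also have "\<dots> = e" using e C by (simp add: real_sqrt_abs)
    finally show ?thesis .
  qed
  have "norm (err g) \<le> 0"
    by (rule field_le_epsilon) (simp add: le)
  then have "integral {0..x} (integrand g) = B (K x) (integral {0..x} g)"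
    by (simp add: err_def)
  then show ?thesis
    using sq_int_integrable_on[OF sq_int_integrand[OF g] x] by (simp add: has_integral_integral)
qed

text \<open>The initial value \<open>c\<close> is split off: its contribution is the classical
  fundamental theorem for \<open>B (K t) c\<close>.\<close>

theorem parts:
  assumes g: "sq_int g" and x: "0 \<le> x" "x \<le> 1"
    and G: "\<And>t. t \<in> {0..1} \<Longrightarrow> G t = c + integral {0..t} g"
  shows "((\<lambda>t. B (K' t) (G t) + B (K t) (g t)) has_integral B (K x) (G x) - B (K 0) c) {0..x}"
proof -
  interpret bounded_bilinear B by (rule bilin)
  have "((\<lambda>t. B (K t) c) has_vector_derivative B (K' t) c) (at t within {0..x})"
    if "t \<in> {0..x}" for t
  proof (rule has_vector_derivative_within_subset)
    show "((\<lambda>t. B (K t) c) has_vector_derivative B (K' t) c) (at t within {0..1})"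
      using that x by (intro bounded_linear.has_vector_derivative[OF bounded_linear_left K]) auto
  qed (use x in auto)
  from fundamental_theorem_of_calculus[OF x(1) this]
  have c: "((\<lambda>t. B (K' t) c) has_integral B (K x) c - B (K 0) c) {0..x}" .
  have "((\<lambda>t. B (K' t) c + integrand g t) has_integral
      (B (K x) c - B (K 0) c) + B (K x) (integral {0..x} g)) {0..x}"
    by (rule has_integral_add[OF c parts_sq_int[OF g x]])
  moreover have "(B (K x) c - B (K 0) c) + B (K x) (integral {0..x} g) = B (K x) (G x) - B (K 0) c"
    using G[of x] x by (simp add: add_right)
  moreover have "B (K' t) c + integrand g t = B (K' t) (G t) + B (K t) (g t)" if "t \<in> {0..x}" for t
    using that x G[of t] by (simp add: integrand_def add_right)
  ultimately show ?thesis
    using has_integral_eq[of "{0..x}" "\<lambda>t. B (K' t) c + integrand g t"] by simp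
qed

theorem parts_unit:
  assumes g: "sq_int g" and G: "\<And>t. t \<in> {0..1} \<Longrightarrow> G t = c + integral {0..t} g"
  shows "(LINT t|unit_meas. B (K t) (g t))
    = B (K 1) (G 1) - B (K 0) (G 0) - (LINT t|unit_meas. B (K' t) (G t))"
proof -
  have cG: "continuous_on {0..1} G"
    using continuous_on_eq[OF continuous_on_add[OF continuous_on_const[of _ c] continuous_primitive[OF g]]]
      G by simp
  have i: "integrable unit_meas (\<lambda>t. B (K' t) (G t))" "integrable unit_meas (\<lambda>t. B (K t) (g t))"
    by (intro integrable_bilinear_sq_int bilin sq_int_continuous K' cont_K cG g)+
  have "(LINT t|unit_meas. B (K' t) (G t)) + (LINT t|unit_meas. B (K t) (g t))
      = (LINT t|unit_meas. B (K' t) (G t) + B (K t) (g t))"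
    using i by simp
  also have "\<dots> = integral {0..1} (\<lambda>t. B (K' t) (G t) + B (K t) (g t))"
    using i by (intro unit_integral_eq) auto
  also have "\<dots> = B (K 1) (G 1) - B (K 0) c"
    using integral_unique[OF parts[OF g _ _ G]] by simp
  also have "c = G 0" using G[of 0] by simp
  finally show ?thesis by (simp add: algebra_simps)
qed

end

lemma parts_smooth:
  fixes g G :: "real \<Rightarrow> 'b::euclidean_space"
  assumes "smooth \<psi>" "sq_int g" "\<And>t. t \<in> {0..1} \<Longrightarrow> G t = c + integral {0..t} g"
  shows "(LINT t|unit_meas. \<psi> t *\<^sub>R g t)
    = \<psi> 1 *\<^sub>R G 1 - \<psi> 0 *\<^sub>R G 0 - (LINT t|unit_meas. deriv \<psi> t *\<^sub>R G t)"
proof -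
  interpret smooth_kernel "scaleR :: real \<Rightarrow> 'b \<Rightarrow> 'b" \<psi> "deriv \<psi>"
  proof (rule smooth_kernel.intro)
    show "bounded_bilinear (scaleR :: real \<Rightarrow> 'b \<Rightarrow> 'b)" by (rule bounded_bilinear_scaleR)
    show "(\<psi> has_vector_derivative deriv \<psi> t) (at t within {0..1})" if "t \<in> {0..1}" for t
      using smooth_deriv(2)[OF assms(1)]
      by (auto simp: has_real_derivative_iff_has_vector_derivative intro: has_vector_derivative_at_within)
  qed (intro smooth_continuous smooth_deriv assms)
  show ?thesis by (rule parts_unit[OF assms(2,3)])
qed

lemma parts_test_function:
  assumes "test_function \<psi>" "sq_int g" "\<And>t. t \<in> {0..1} \<Longrightarrow> G t = c + integral {0..t} g"
  shows "(LINT t|unit_meas. \<psi> t *\<^sub>R g t) = - (LINT t|unit_meas. deriv \<psi> t *\<^sub>R G t)"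
proof -
  obtain u v where uv: "smooth \<psi>" "0 < u" "u < v" "v < 1" "{x. \<psi> x \<noteq> 0} \<subseteq> {u<..<v}"
    using test_functionE[OF assms(1)] .
  have "\<psi> 0 = 0" "\<psi> 1 = 0" using uv by force+
  then show ?thesis using parts_smooth[OF uv(1) assms(2,3)] by simp
qed

subsection \<open>The second-order Sobolev space on the unit interval\<close>

text \<open>The second Sobolev space written through indefinite integrals: \<open>F'\<close> is
  absolutely continuous with density \<open>g\<close>. Carrying all three functions avoids choosing
  derivatives almost everywhere and gives direct access to the boundary values of \<open>F\<close>
  and \<open>F'\<close>.\<close>

definition H2 :: "(real \<Rightarrow> 'b::euclidean_space) \<Rightarrow> (real \<Rightarrow> 'b) \<Rightarrow> (real \<Rightarrow> 'b) \<Rightarrow> bool" where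
  "H2 F F' g \<longleftrightarrow> sq_int g \<and> (\<forall>x\<in>{0..1}. F' x = F' 0 + integral {0..x} g) \<and>
     (\<forall>x\<in>{0..1}. F x = F 0 + integral {0..x} F')"

lemma H2D:
  assumes "H2 F F' g"
  shows "sq_int g" "x \<in> {0..1} \<Longrightarrow> F' x = F' 0 + integral {0..x} g"
    "x \<in> {0..1} \<Longrightarrow> F x = F 0 + integral {0..x} F'"
  using assms unfolding H2_def by blast+

lemma continuous_if_primitive:
  assumes "sq_int h" "\<And>x. x \<in> {0..1} \<Longrightarrow> G x = c + integral {0..x} h"
  shows "continuous_on {0..1} G"
proof -
  have "continuous_on {0..1} (\<lambda>x. c + integral {0..x} h)"
    by (intro continuous_intros continuous_primitive assms(1))
  then show ?thesis by (rule continuous_on_eq) (rule assms(2)[symmetric])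
qed

lemma H2_continuous:
  assumes "H2 F F' g"
  shows "continuous_on {0..1} F'" "continuous_on {0..1} F"
proof -
  show F': "continuous_on {0..1} F'"
    by (rule continuous_if_primitive[OF H2D(1,2)[OF assms]])
  show "continuous_on {0..1} F"
    by (rule continuous_if_primitive[OF sq_int_continuous[OF F'] H2D(3)[OF assms]])
qed

lemma H2_derivative:
  assumes "H2 F F' g" "x \<in> {0..1}"
  shows "(F has_vector_derivative F' x) (at x within {0..1})"
proof -
  have "((\<lambda>x. F 0 + integral {0..x} F') has_vector_derivative 0 + F' x) (at x within {0..1})"
    by (intro has_vector_derivative_add has_vector_derivative_const integral_has_vector_derivative
        H2_continuous[OF assms(1)] assms(2))
  then have v: "((\<lambda>x. F 0 + integral {0..x} F') has_vector_derivative F' x) (at x within {0..1})"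
    by simp
  show ?thesis
    by (rule has_vector_derivative_transform[OF assms(2) H2D(3)[OF assms(1)] v])
qed

lemma H2_linear:
  assumes "H2 F F' g" "bounded_linear T"
  shows "H2 (\<lambda>x. T (F x)) (\<lambda>x. T (F' x)) (\<lambda>x. T (g x) :: 'c::euclidean_space)"
proof -
  interpret bounded_linear T by fact
  have *: "integral {0..x} (\<lambda>t. T (h t)) = T (integral {0..x} h)" if "sq_int h" "x \<in> {0..1}" for h x
    using integral_linear[OF sq_int_integrable_on(1)[OF that(1)] assms(2), of x] that(2)
    by (simp add: o_def)
  have sF': "sq_int F'" by (rule sq_int_continuous[OF H2_continuous(1)[OF assms(1)]])
  have sg: "sq_int g" by (rule H2D(1)[OF assms(1)])
  show ?thesis
    unfolding H2_def
  proof (intro conjI ballI)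
    show "sq_int (\<lambda>x. T (g x))" by (rule sq_int_linear[OF sg assms(2)])
    fix x :: real assume x: "x \<in> {0..1}"
    have "F' x = F' 0 + integral {0..x} g" "F x = F 0 + integral {0..x} F'"
      by (rule H2D(2,3)[OF assms(1) x])+
    then show "T (F' x) = T (F' 0) + integral {0..x} (\<lambda>x. T (g x))"
      "T (F x) = T (F 0) + integral {0..x} (\<lambda>x. T (F' x))"
      using *[OF sg x] *[OF sF' x] by (metis add)+
  qed
qed

lemma H2_add:
  assumes "H2 F F' g" "H2 G G' h"
  shows "H2 (\<lambda>x. F x + G x) (\<lambda>x. F' x + G' x) (\<lambda>x. g x + h x)"
proof -
  have s: "sq_int F'" "sq_int G'" "sq_int g" "sq_int h"
    using assms H2_continuous[OF assms(1)] H2_continuous[OF assms(2)]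
    by (auto intro: sq_int_continuous H2D(1))
  have *: "integral {0..x} (\<lambda>t. u t + v t) = integral {0..x} u + integral {0..x} v"
    if "sq_int u" "sq_int v" "x \<in> {0..1}" for u v :: "real \<Rightarrow> 'a" and x
    using that by (intro integral_add sq_int_integrable_on) auto
  show ?thesis
    unfolding H2_def
  proof (intro conjI ballI)
    show "sq_int (\<lambda>x. g x + h x)" by (intro sq_int_add s)
    fix x :: real assume x: "x \<in> {0..1}"
    show "F' x + G' x = F' 0 + G' 0 + integral {0..x} (\<lambda>x. g x + h x)"
      by (subst H2D(2)[OF assms(1) x], subst H2D(2)[OF assms(2) x], subst *[OF s(3,4) x]) simp
    show "F x + G x = F 0 + G 0 + integral {0..x} (\<lambda>x. F' x + G' x)"
      by (subst H2D(3)[OF assms(1) x], subst H2D(3)[OF assms(2) x], subst *[OF s(1,2) x]) simp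
  qed
qed

lemma primitive_of_derivative:
  fixes G h :: "real \<Rightarrow> 'b::euclidean_space"
  assumes G: "\<And>x. x \<in> {0..1} \<Longrightarrow> (G has_vector_derivative h x) (at x within {0..1})"
    and x: "x \<in> {0..1}"
  shows "G x = G 0 + integral {0..x} h"
proof -
  have "(h has_integral G x - G 0) {0..x}"
  proof (rule fundamental_theorem_of_calculus)
    fix t assume t: "t \<in> {0..x}"
    show "(G has_vector_derivative h t) (at t within {0..x})"
      by (rule has_vector_derivative_within_subset[OF G]) (use t x in auto)
  qed (use x in auto)
  then show ?thesis by (simp add: integral_unique)
qed

lemma H2I_C2:
  assumes "\<And>x. x \<in> {0..1} \<Longrightarrow> (F has_vector_derivative F' x) (at x within {0..1})"
    and "\<And>x. x \<in> {0..1} \<Longrightarrow> (F' has_vector_derivative g x) (at x within {0..1})"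
    and "continuous_on {0..1} g"
  shows "H2 F F' g"
  unfolding H2_def
  by (intro conjI ballI sq_int_continuous[OF assms(3)] primitive_of_derivative[OF assms(1)]
      primitive_of_derivative[OF assms(2)])

lemma H2_weak:
  assumes "H2 F F' g" "test_function \<psi>"
  shows "(LINT x|unit_meas. deriv (deriv \<psi>) x *\<^sub>R F x) = (LINT x|unit_meas. \<psi> x *\<^sub>R g x)"
proof -
  have "(LINT x|unit_meas. deriv \<psi> x *\<^sub>R F' x) = - (LINT x|unit_meas. deriv (deriv \<psi>) x *\<^sub>R F x)"
    by (rule parts_test_function[OF test_function_deriv[OF assms(2)]
          sq_int_continuous[OF H2_continuous(1)[OF assms(1)]] H2D(3)[OF assms(1)]])
  moreover have "(LINT x|unit_meas. \<psi> x *\<^sub>R g x) = - (LINT x|unit_meas. deriv \<psi> x *\<^sub>R F' x)"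
    by (rule parts_test_function[OF assms(2) H2D(1,2)[OF assms(1)]])
  ultimately show ?thesis by simp
qed

text \<open>Integrating by parts on both sides of the weak identity shows that \<open>F'\<close>
  minus the primitive of \<open>g\<close> is orthogonal to derivatives of test functions. By the du
  Bois-Reymond lemma it is constant.\<close>

lemma H2I_weak:
  fixes F F' g :: "real \<Rightarrow> 'b::euclidean_space"
  assumes F: "\<And>x. x \<in> {0..1} \<Longrightarrow> (F has_vector_derivative F' x) (at x within {0..1})"
    and F': "continuous_on {0..1} F'" and g: "sq_int g"
    and w: "\<And>\<psi>. test_function \<psi> \<Longrightarrow>
      (LINT x|unit_meas. deriv (deriv \<psi>) x *\<^sub>R F x) = (LINT x|unit_meas. \<psi> x *\<^sub>R g x)"
  shows "H2 F F' g"
proof -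
  note eF = primitive_of_derivative[OF F]
  let ?P = "\<lambda>x. integral {0..x} g"
  have cP: "continuous_on {0..1} ?P" by (rule continuous_primitive[OF g])
  have sF': "sq_int F'" by (rule sq_int_continuous[OF F'])
  have "\<exists>c. \<forall>x\<in>{0..1}. F' x - ?P x = c"
  proof (rule constant_if_test_deriv_zero)
    show "continuous_on {0..1} (\<lambda>x. F' x - ?P x)" by (intro continuous_intros F' cP)
    fix \<psi> assume \<psi>: "test_function \<psi>"
    obtain u v where "smooth \<psi>" using test_functionE[OF \<psi>] by blast
    then have c: "continuous_on {0..1} (deriv \<psi>)"
      by (intro smooth_continuous smooth_deriv)
    have "(LINT x|unit_meas. deriv \<psi> x *\<^sub>R F' x) = - (LINT x|unit_meas. deriv (deriv \<psi>) x *\<^sub>R F x)"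
      by (rule parts_test_function[OF test_function_deriv[OF \<psi>] sF' eF])
    also have "\<dots> = - (LINT x|unit_meas. \<psi> x *\<^sub>R g x)" by (simp add: w[OF \<psi>])
    also have "(LINT x|unit_meas. \<psi> x *\<^sub>R g x) = - (LINT x|unit_meas. deriv \<psi> x *\<^sub>R ?P x)"
      by (rule parts_test_function[OF \<psi> g, where c = 0]) simp
    finally show "(LINT x|unit_meas. deriv \<psi> x *\<^sub>R (F' x - ?P x)) = 0"
      using integrable_scaleR_cont[OF c sF'] integrable_scaleR_cont[OF c sq_int_continuous[OF cP]]
      by (simp add: scaleR_diff_right)
  qed
  then obtain c where c: "\<And>x. x \<in> {0..1} \<Longrightarrow> F' x - ?P x = c" by blast
  have "F' x = F' 0 + ?P x" if "x \<in> {0..1}" for x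
    using c[OF that] c[of 0] by (simp add: algebra_simps)
  then show ?thesis using eF g unfolding H2_def by (intro conjI ballI)
qed

subsection \<open>Representatives of square-integrable classes\<close>

lemma L2_rel_refl: "L2_rel f f \<longleftrightarrow> sq_int f"
  by (simp add: L2_rel_def square_integrable_iff_sq_int)

lemma abs_L2_eq_iff:
  assumes "sq_int f" "sq_int g"
  shows "abs_L2 f = abs_L2 g \<longleftrightarrow> (AE x in unit_meas. f x = g x)"
proof -
  have "L2_rel f g \<longleftrightarrow> abs_L2 f = abs_L2 g"
    using Quotient_rel[OF Quotient_L2, of f g] assms by (simp add: L2_rel_refl)
  moreover have "L2_rel f g \<longleftrightarrow> (AE x in unit_meas. f x = g x)"
    using assms by (simp add: L2_rel_def square_integrable_iff_sq_int)
  ultimately show ?thesis by simp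
qed

text \<open>Every statement about classes can be reduced to honest functions, for which the integral
  lemmas are available.\<close>

lemma abs_L2_cases:
  obtains g where "sq_int g" "f = abs_L2 g"
  using Quotient_abs_rep[OF Quotient_L2, of f] Quotient_rep_reflp[OF Quotient_L2, of f]
  by (metis L2_rel_refl)

lemma abs_L2_unary:
  assumes "sq_int f"
  shows "r *\<^sub>R abs_L2 f = abs_L2 (\<lambda>x. r *\<^sub>R f x)"
    "- abs_L2 f = abs_L2 (\<lambda>x. - f x)"
    "scaleC_L2 c (abs_L2 f) = abs_L2 (\<lambda>x. c *s f x)"
    "matrix_L2 A (abs_L2 f) = abs_L2 (\<lambda>x. A *v f x)"
    "represented_by (abs_L2 f) F \<longleftrightarrow> (AE x in unit_meas. f x = F x)"
proof -
  have r: "L2_rel f f" using assms by (auto simp: L2_rel_refl)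
  show "r *\<^sub>R abs_L2 f = abs_L2 (\<lambda>x. r *\<^sub>R f x)" by (rule scaleR_L2.abs_eq[OF r])
  show "- abs_L2 f = abs_L2 (\<lambda>x. - f x)"
    by (simp only: uminus_L2_def scaleR_L2.abs_eq[OF r] scaleR_minus1_left)
  show "scaleC_L2 c (abs_L2 f) = abs_L2 (\<lambda>x. c *s f x)" by (rule scaleC_L2.abs_eq[OF r])
  show "matrix_L2 A (abs_L2 f) = abs_L2 (\<lambda>x. A *v f x)" by (rule matrix_L2.abs_eq[OF r])
  show "represented_by (abs_L2 f) F \<longleftrightarrow> (AE x in unit_meas. f x = F x)"
    by (simp add: represented_by.abs_eq[OF r])
qed

lemma abs_L2_binary:
  assumes "sq_int f" "sq_int g"
  shows "abs_L2 f + abs_L2 g = abs_L2 (\<lambda>x. f x + g x)"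
    "abs_L2 f - abs_L2 g = abs_L2 (\<lambda>x. f x - g x)"
    "cinner (abs_L2 f) (abs_L2 g) = (LINT x|unit_meas. f x $ 1 * cnj (g x $ 1) + f x $ 2 * cnj (g x $ 2))"
    "weak_deriv2 (abs_L2 f) (abs_L2 g) \<longleftrightarrow> weak_deriv2_fun f g"
proof -
  have r: "L2_rel f f" "L2_rel g g" using assms by (auto simp: L2_rel_refl)
  show "abs_L2 f + abs_L2 g = abs_L2 (\<lambda>x. f x + g x)" by (rule plus_L2.abs_eq[OF r])
  have "L2_rel (\<lambda>x. - g x) (\<lambda>x. - g x)"
    using sq_int_minus[OF assms(2)] by (simp add: L2_rel_refl)
  from plus_L2.abs_eq[OF r(1) this]
  show "abs_L2 f - abs_L2 g = abs_L2 (\<lambda>x. f x - g x)"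
    by (simp only: minus_L2_def[of "abs_L2 f"] abs_L2_unary[OF assms(2)] add_uminus_conv_diff)
  show "cinner (abs_L2 f) (abs_L2 g) = (LINT x|unit_meas. f x $ 1 * cnj (g x $ 1) + f x $ 2 * cnj (g x $ 2))"
    unfolding cinner.abs_eq[OF r] by (simp add: sum_2)
  show "weak_deriv2 (abs_L2 f) (abs_L2 g) \<longleftrightarrow> weak_deriv2_fun f g"
    by (rule weak_deriv2.abs_eq[OF r])
qed

lemmas abs_L2_simps = abs_L2_unary abs_L2_binary

lemma weak_deriv2_fun_iff:
  "weak_deriv2_fun f g \<longleftrightarrow> (\<forall>\<psi>. test_function \<psi> \<longrightarrow>
    (LINT x|unit_meas. deriv (deriv \<psi>) x *\<^sub>R f x) = (LINT x|unit_meas. \<psi> x *\<^sub>R g x))"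
  by (simp add: weak_deriv2_fun_def numeral_2_eq_2)

text \<open>Two candidates have the same integrals against all test functions, so the fundamental
  lemma applies to their difference. This justifies the definite description in
  \<open>deriv2\<close>.\<close>

lemma weak_deriv2_unique:
  assumes "weak_deriv2 f g" "weak_deriv2 f h"
  shows "g = h"
proof -
  obtain f0 g0 h0 where r: "sq_int f0" "f = abs_L2 f0" "sq_int g0" "g = abs_L2 g0" "sq_int h0" "h = abs_L2 h0"
    by (metis abs_L2_cases)
  have "AE x in unit_meas. g0 x - h0 x = 0"
  proof (rule sq_int_zero_if_test_zero[OF sq_int_diff[OF r(3,5)]])
    fix \<psi> assume \<psi>: "test_function \<psi>"
    obtain u v where "smooth \<psi>" using test_functionE[OF \<psi>] by blast
    then have c: "continuous_on {0..1} \<psi>" by (intro smooth_continuous)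
    have "(LINT x|unit_meas. \<psi> x *\<^sub>R g0 x) = (LINT x|unit_meas. \<psi> x *\<^sub>R h0 x)"
      using assms \<psi> r by (simp add: abs_L2_simps weak_deriv2_fun_iff)
    then show "(LINT x|unit_meas. \<psi> x *\<^sub>R (g0 x - h0 x)) = 0"
      using integrable_scaleR_cont[OF c r(3)] integrable_scaleR_cont[OF c r(5)]
      by (simp add: scaleR_diff_right)
  qed
  then show ?thesis using r by (simp add: abs_L2_eq_iff)
qed

lemma deriv2_eq: "weak_deriv2 f g \<Longrightarrow> deriv2 f = g"
  unfolding deriv2_def using weak_deriv2_unique by blast

definition boundary_conditions :: "(real \<Rightarrow> complex ^ 2) \<Rightarrow> (real \<Rightarrow> complex ^ 2) \<Rightarrow> bool" where
  "boundary_conditions F F' \<longleftrightarrow> F 0 $ 1 = 0 \<and> F 1 $ 1 = 0 \<and> F' 0 $ 2 = 0 \<and> F' 1 $ 2 = 0"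

lemma D_opI:
  assumes "H2 F F' g" "boundary_conditions F F'"
  shows "abs_L2 F \<in> Dom D_op" "app D_op (abs_L2 F) = abs_L2 (\<lambda>x. - g x)"
proof -
  have s: "sq_int F" "sq_int g"
    by (rule sq_int_continuous H2_continuous H2D(1) assms(1))+
  have w: "weak_deriv2 (abs_L2 F) (abs_L2 g)"
    using H2_weak[OF assms(1)] by (simp add: abs_L2_simps s weak_deriv2_fun_iff)
  have "C1_representative (abs_L2 F) F F'"
    unfolding C1_representative_def
    using H2_derivative[OF assms(1)] H2_continuous[OF assms(1)] by (simp add: abs_L2_simps s)
  then show "abs_L2 F \<in> Dom D_op"
    using assms(2) w unfolding D_op_def W22_def boundary_conditions_def by auto
  show "app D_op (abs_L2 F) = abs_L2 (\<lambda>x. - g x)"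
    using deriv2_eq[OF w] by (simp add: D_op_def abs_L2_simps s)
qed

text \<open>The domain supplies a generalized derivative and a C^1 representative independently of
  each other; \<open>H2I_weak\<close> ties them together. With \<open>D_opI\<close> this translates
  all questions about \<open>D_op\<close> into questions about \<open>H2\<close> triples.\<close>

lemma D_opE:
  assumes "f \<in> Dom D_op"
  obtains F F' g where "H2 F F' g" "boundary_conditions F F'" "sq_int F" "sq_int g"
    "f = abs_L2 F" "app D_op f = abs_L2 (\<lambda>x. - g x)"
proof -
  obtain h F F' where h: "weak_deriv2 f h" and F: "C1_representative f F F'"
    and b: "boundary_conditions F F'"
    using assms unfolding D_op_def W22_def boundary_conditions_def by auto
  obtain f0 g where r: "sq_int f0" "f = abs_L2 f0" "sq_int g" "h = abs_L2 g"
    by (metis abs_L2_cases)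
  have F': "\<And>x. x \<in> {0..1} \<Longrightarrow> (F has_vector_derivative F' x) (at x within {0..1})"
    "continuous_on {0..1} F'"
    using F by (auto simp: C1_representative_def)
  then have "continuous_on {0..1} F"
    unfolding continuous_on_eq_continuous_within
    using has_vector_derivative_continuous by blast
  then have sF: "sq_int F" by (rule sq_int_continuous)
  have fF: "f = abs_L2 F"
    using F r sF by (simp add: C1_representative_def abs_L2_simps abs_L2_eq_iff)
  have "weak_deriv2_fun F g"
    using h by (simp add: fF r(4) abs_L2_simps sF r(3))
  then have "H2 F F' g"
    by (intro H2I_weak F' r(3)) (simp_all add: weak_deriv2_fun_iff)
  then show thesis
    using that[OF _ b sF r(3) fF] D_opI(2)[OF _ b] fF by metis
qed

subsection \<open>Complex Hilbert space structure\<close>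

lemma sq_int_matrix: "sq_int f \<Longrightarrow> sq_int (\<lambda>x. (A :: complex ^ 2 ^ 2) *v f x)"
  using square_integrable_matrix by (simp add: square_integrable_iff_sq_int)

lemma sq_int_scaleC: "sq_int f \<Longrightarrow> sq_int (\<lambda>x. c *s (f x :: complex ^ 2))"
  using square_integrable_scaleC by (simp add: square_integrable_iff_sq_int)

lemma bounded_linear_matrix: "bounded_linear ((*v) (A :: complex ^ 2 ^ 2))"
proof -
  have "linear ((*v) A)"
    by (intro linearI)
      (simp_all add: vec_eq_iff matrix_vector_mult_def scaleR_sum_right distrib_left sum.distrib)
  then show ?thesis by (simp add: linear_conv_bounded_linear)
qed

lemma scaleC_eq_matrix: "c *s v = mat c *v (v :: complex ^ 2)"
  by (auto simp: vec_eq_iff matrix_vector_mult_def mat_def if_distrib if_distribR cong: if_cong)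

text \<open>Complex scalars are treated as scalar matrices, so that linearity and commutation need
  to be proved for matrices only.\<close>

lemma scaleC_L2_eq_matrix: "scaleC_L2 c f = matrix_L2 (mat c) f"
proof -
  obtain f0 where "sq_int f0" "f = abs_L2 f0" by (rule abs_L2_cases)
  then show ?thesis by (simp add: abs_L2_simps scaleC_eq_matrix)
qed

lemma matrix_L2_add: "matrix_L2 A (f + g) = matrix_L2 A f + matrix_L2 A g"
proof -
  obtain f0 where f: "sq_int f0" "f = abs_L2 f0" by (rule abs_L2_cases)
  obtain g0 where g: "sq_int g0" "g = abs_L2 g0" by (rule abs_L2_cases)
  show ?thesis
    by (simp add: f g abs_L2_simps sq_int_add sq_int_matrix matrix_vector_right_distrib)
qed

lemma matrix_L2_scaleR: "matrix_L2 A (r *\<^sub>R f) = r *\<^sub>R matrix_L2 A f"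
proof -
  obtain f0 where f: "sq_int f0" "f = abs_L2 f0" by (rule abs_L2_cases)
  have "sq_int (\<lambda>x. r *\<^sub>R f0 x)" by (rule sq_int_linear[OF f(1) bounded_linear_scaleR_right])
  moreover have "A *v (r *\<^sub>R v) = r *\<^sub>R (A *v v)" for v
    by (rule linear_scale[OF bounded_linear.linear[OF bounded_linear_matrix]])
  ultimately show ?thesis
    by (simp add: f abs_L2_simps sq_int_matrix)
qed

lemma matrix_L2_compose: "matrix_L2 A (matrix_L2 B f) = matrix_L2 (A ** B) f"
proof -
  obtain f0 where "sq_int f0" "f = abs_L2 f0" by (rule abs_L2_cases)
  then show ?thesis by (simp add: abs_L2_simps sq_int_matrix matrix_vector_mul_assoc)
qed

lemma matrix_L2_one: "matrix_L2 (mat 1) f = f"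
proof -
  obtain f0 where "sq_int f0" "f = abs_L2 f0" by (rule abs_L2_cases)
  then show ?thesis by (simp add: abs_L2_simps)
qed

lemma matrix_L2_uminus: "matrix_L2 A (- f) = - matrix_L2 A f"
  using matrix_L2_scaleR[of A "-1" f] by simp

lemma matrix_L2_diff: "matrix_L2 A (f - g) = matrix_L2 A f - matrix_L2 A g"
  using matrix_L2_add[of A f "- g"] by (simp add: matrix_L2_uminus)

lemma mat_mult_commute: "A ** mat c = mat c ** (A :: complex ^ 2 ^ 2)"
  by (auto simp: vec_eq_iff matrix_matrix_mult_def mat_def if_distrib if_distribR mult.commute cong: if_cong)

lemma matrix_L2_scaleC: "matrix_L2 A (scaleC_L2 c f) = scaleC_L2 c (matrix_L2 A f)"
  by (simp add: scaleC_L2_eq_matrix matrix_L2_compose mat_mult_commute)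

lemma scaleC_L2_add: "scaleC_L2 c (f + g) = scaleC_L2 c f + scaleC_L2 c g"
  and scaleC_L2_diff: "scaleC_L2 c (f - g) = scaleC_L2 c f - scaleC_L2 c g"
  by (simp_all add: scaleC_L2_eq_matrix matrix_L2_add matrix_L2_diff)

lemma scaleC_L2_commute: "scaleC_L2 c (scaleC_L2 d f) = scaleC_L2 d (scaleC_L2 c f)"
  by (simp add: scaleC_L2_eq_matrix matrix_L2_compose mat_mult_commute[of "mat c"])

lemma scaleC_L2_of_real: "scaleC_L2 (of_real r) f = r *\<^sub>R f"
proof -
  obtain f0 where "sq_int f0" "f = abs_L2 f0" by (rule abs_L2_cases)
  moreover have "of_real r *s v = r *\<^sub>R v" for v :: "complex ^ 2"
    by (simp add: vec_eq_iff scaleR_conv_of_real[where 'a = complex])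
  ultimately show ?thesis
    by (simp add: abs_L2_simps)
qed

lemma integrable_mult_cnj:
  assumes "sq_int f" "sq_int g"
  shows "integrable unit_meas (\<lambda>x. f x $ (i :: 2) * cnj (g x $ i))"
proof (rule integrable_bilinear_sq_int[OF bounded_bilinear_mult])
  show "sq_int (\<lambda>x. f x $ i)" by (rule sq_int_linear[OF assms(1) bounded_linear_vec_nth])
  show "sq_int (\<lambda>x. cnj (g x $ i))"
    by (intro sq_int_linear[OF assms(2)] bounded_linear_compose[OF bounded_linear_cnj]
        bounded_linear_vec_nth)
qed

lemma cinner_commute: "cinner g f = cnj (cinner f g)"
proof -
  obtain f0 where f: "sq_int f0" "f = abs_L2 f0" by (rule abs_L2_cases)
  obtain g0 where g: "sq_int g0" "g = abs_L2 g0" by (rule abs_L2_cases)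
  have "cnj (cinner f g) = (LINT x|unit_meas. cnj (f0 x $ 1 * cnj (g0 x $ 1) + f0 x $ 2 * cnj (g0 x $ 2)))"
    by (simp only: f g abs_L2_simps Bochner_Integration.integral_cnj)
  also have "\<dots> = cinner g f"
    by (simp add: f g abs_L2_simps mult.commute)
  finally show ?thesis by simp
qed

lemma cinner_add_left: "cinner (f + g) h = cinner f h + cinner g h"
proof -
  obtain f0 where f: "sq_int f0" "f = abs_L2 f0" by (rule abs_L2_cases)
  obtain g0 where g: "sq_int g0" "g = abs_L2 g0" by (rule abs_L2_cases)
  obtain h0 where h: "sq_int h0" "h = abs_L2 h0" by (rule abs_L2_cases)
  note i = integrable_mult_cnj[OF f(1) h(1)] integrable_mult_cnj[OF g(1) h(1)]
  have "cinner (f + g) h = (LINT x|unit_meas. (f0 x $ 1 * cnj (h0 x $ 1) + f0 x $ 2 * cnj (h0 x $ 2))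
      + (g0 x $ 1 * cnj (h0 x $ 1) + g0 x $ 2 * cnj (h0 x $ 2)))"
    by (simp add: f g h abs_L2_simps sq_int_add algebra_simps)
  also have "\<dots> = cinner f h + cinner g h"
    using i by (subst Bochner_Integration.integral_add) (auto simp: f g h abs_L2_simps)
  finally show ?thesis .
qed

lemma cinner_scaleC_left: "cinner (scaleC_L2 c f) g = c * cinner f g"
proof -
  obtain f0 where f: "sq_int f0" "f = abs_L2 f0" by (rule abs_L2_cases)
  obtain g0 where g: "sq_int g0" "g = abs_L2 g0" by (rule abs_L2_cases)
  have "cinner (scaleC_L2 c f) g
      = (LINT x|unit_meas. c * (f0 x $ 1 * cnj (g0 x $ 1) + f0 x $ 2 * cnj (g0 x $ 2)))"
    by (simp add: f g abs_L2_simps sq_int_scaleC algebra_simps)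
  also have "\<dots> = c * cinner f g" by (simp add: f g abs_L2_simps)
  finally show ?thesis .
qed

lemma cinner_scaleC_right: "cinner f (scaleC_L2 c g) = cnj c * cinner f g"
  unfolding cinner_commute[of f "scaleC_L2 c g"] cinner_commute[of f g]
  by (simp add: cinner_scaleC_left)

lemma cinner_add_right: "cinner f (g + h) = cinner f g + cinner f h"
  unfolding cinner_commute[of f "g + h"] cinner_commute[of f g] cinner_commute[of f h]
  by (simp add: cinner_add_left)

lemma cinner_uminus_left: "cinner (- f) g = - cinner f g"
  using cinner_scaleC_left[of "-1" f g] scaleC_L2_of_real[of "-1" f] by simp

lemma cinner_uminus_right: "cinner f (- g) = - cinner f g"
  using cinner_scaleC_right[of f "-1" g] scaleC_L2_of_real[of "-1" g] by simp

lemma cinner_diff_left: "cinner (f - g) h = cinner f h - cinner g h"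
  using cinner_add_left[of f "- g" h] by (simp add: cinner_uminus_left)

lemma cinner_diff_right: "cinner f (g - h) = cinner f g - cinner f h"
  using cinner_add_right[of f g "- h"] by (simp add: cinner_uminus_right)

lemma norm_L2_sq: "(norm f)\<^sup>2 = Re (cinner f f)"
  by (simp add: power2_norm_eq_inner inner_L2_def)

lemma cinner_self: "cinner f f = of_real ((norm f)\<^sup>2)"
proof -
  have "Im (cinner f f) = 0"
    using arg_cong[OF cinner_commute[of f f], of Im] by simp
  then show ?thesis by (simp add: norm_L2_sq complex_eq_iff)
qed

lemma norm_cinner_le: "\<bar>Re (cinner f g)\<bar> \<le> norm f * norm g"
  using Cauchy_Schwarz_ineq2[of f g] by (simp add: inner_L2_def)

lemma cinner_norm_le: "norm (cinner f g) \<le> norm f * norm g"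
proof (cases "cinner f g = 0")
  case False
  define w where "w = cinner f g"
  \<comment> \<open>A unimodular phase that makes the inner product real and nonnegative. The
    Cauchy-Schwarz inequality of the real inner product space controls the real part only.\<close>
  define c where "c = cnj w / of_real (norm w)"
  have w: "w \<noteq> 0" using False by (simp add: w_def)
  have ww: "cnj w * w = of_real (norm w) * of_real (norm w)"
    using complex_norm_square[of w] by (simp add: power2_eq_square mult.commute)
  have c: "c * cinner f g = of_real (norm (cinner f g))"
    using w ww by (simp add: c_def field_simps flip: w_def)
  have cc: "c * cnj c = 1"
    using w ww by (simp add: c_def field_simps)
  have "norm (scaleC_L2 c f) = norm f"
  proof -
    have "(norm (scaleC_L2 c f))\<^sup>2 = (norm f)\<^sup>2"
    proof -
      have "cinner (scaleC_L2 c f) (scaleC_L2 c f) = (c * cnj c) * cinner f f"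
        by (simp add: cinner_scaleC_left cinner_scaleC_right)
      then show ?thesis by (simp only: norm_L2_sq cc) simp
    qed
    then show ?thesis by simp
  qed
  moreover have "norm (cinner f g) = Re (cinner (scaleC_L2 c f) g)"
    by (simp add: cinner_scaleC_left c)
  ultimately show ?thesis
    using norm_cinner_le[of "scaleC_L2 c f" g] by simp
qed simp

lemma norm_abs_L2_sq:
  assumes "sq_int f"
  shows "(norm (abs_L2 f))\<^sup>2 = (LINT x|unit_meas. (norm (f x))\<^sup>2)"
proof -
  have e: "v $ 1 * cnj (v $ 1) + v $ 2 * cnj (v $ 2) = complex_of_real ((norm v)\<^sup>2)" for v :: "complex ^ 2"
    by (simp add: norm_vec_def L2_set_def sum_2 complex_norm_square del: of_real_power)
  have "cinner (abs_L2 f) (abs_L2 f) = complex_of_real (LINT x|unit_meas. (norm (f x))\<^sup>2)"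
    by (simp only: abs_L2_simps assms e integral_complex_of_real)
  then show ?thesis by (simp add: norm_L2_sq)
qed

lemma norm_matrix_L2_le:
  obtains C where "C > 0" "\<And>f. norm (matrix_L2 A f) \<le> C * norm f"
proof -
  obtain C where C: "C > 0" "\<And>v. norm (A *v v) \<le> norm v * C"
    using bounded_linear.pos_bounded[OF bounded_linear_matrix] by blast
  have "norm (matrix_L2 A f) \<le> C * norm f" for f
  proof -
    obtain f0 where f: "sq_int f0" "f = abs_L2 f0" by (rule abs_L2_cases)
    have "(norm (matrix_L2 A f))\<^sup>2 = (LINT x|unit_meas. (norm (A *v f0 x))\<^sup>2)"
      by (simp add: f abs_L2_simps norm_abs_L2_sq sq_int_matrix)
    also have "\<dots> \<le> (LINT x|unit_meas. C\<^sup>2 * (norm (f0 x))\<^sup>2)"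
    proof (rule integral_mono)
      show "(norm (A *v f0 x))\<^sup>2 \<le> C\<^sup>2 * (norm (f0 x))\<^sup>2" for x
        using power_mono[OF C(2) norm_ge_zero, of "f0 x" 2] by (simp add: power_mult_distrib mult.commute)
    qed (use f(1) sq_int_matrix[OF f(1)] in \<open>auto simp: sq_int_def\<close>)
    also have "\<dots> = (C * norm f)\<^sup>2"
      by (simp add: f norm_abs_L2_sq power_mult_distrib)
    finally show ?thesis
      by (rule power2_le_imp_le) (use C in auto)
  qed
  then show thesis using that C(1) by blast
qed

lemma bounded_clinear_matrix: "bounded_clinear (matrix_L2 A)"
proof -
  obtain C where "C > 0" "\<And>f. norm (matrix_L2 A f) \<le> C * norm f"
    using norm_matrix_L2_le[of A] by blast
  then have "bounded_linear (matrix_L2 A)"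
    by (intro bounded_linear_intro[of _ C])
      (auto simp: matrix_L2_add matrix_L2_scaleR mult.commute)
  then show ?thesis by (simp add: bounded_clinear_def matrix_L2_scaleC)
qed

definition adjoint_matrix :: "complex ^ 2 ^ 2 \<Rightarrow> complex ^ 2 ^ 2" where
  "adjoint_matrix A = (\<chi> i j. cnj (A $ j $ i))"

lemma cinner_matrix_left: "cinner (matrix_L2 A f) g = cinner f (matrix_L2 (adjoint_matrix A) g)"
proof -
  obtain f0 where f: "sq_int f0" "f = abs_L2 f0" by (rule abs_L2_cases)
  obtain g0 where g: "sq_int g0" "g = abs_L2 g0" by (rule abs_L2_cases)
  show ?thesis
    by (simp add: f g abs_L2_simps sq_int_matrix)
      (simp add: adjoint_matrix_def matrix_vector_mult_def sum_2 algebra_simps)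
qed

subsection \<open>Symmetric operators with surjective shifts\<close>

lemma linear_operatorD:
  assumes "linear_operator K"
  shows "0 \<in> Dom K" "f \<in> Dom K \<Longrightarrow> g \<in> Dom K \<Longrightarrow> f + g \<in> Dom K"
    "f \<in> Dom K \<Longrightarrow> g \<in> Dom K \<Longrightarrow> app K (f + g) = app K f + app K g"
    "f \<in> Dom K \<Longrightarrow> scaleC_L2 c f \<in> Dom K"
    "f \<in> Dom K \<Longrightarrow> app K (scaleC_L2 c f) = scaleC_L2 c (app K f)"
    "f \<in> Dom K \<Longrightarrow> g \<in> Dom K \<Longrightarrow> f - g \<in> Dom K"
    "f \<in> Dom K \<Longrightarrow> g \<in> Dom K \<Longrightarrow> app K (f - g) = app K f - app K g"
proof -
  show 1: "0 \<in> Dom K" "f \<in> Dom K \<Longrightarrow> g \<in> Dom K \<Longrightarrow> f + g \<in> Dom K"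
    "f \<in> Dom K \<Longrightarrow> g \<in> Dom K \<Longrightarrow> app K (f + g) = app K f + app K g" for f g
    using assms by (auto simp: linear_operator_def)
  show 2: "f \<in> Dom K \<Longrightarrow> scaleC_L2 c f \<in> Dom K"
    "f \<in> Dom K \<Longrightarrow> app K (scaleC_L2 c f) = scaleC_L2 c (app K f)" for f c
    using assms by (auto simp: linear_operator_def)
  have m: "scaleC_L2 (- 1) f = - f" for f
    using scaleC_L2_of_real[of "-1" f] by simp
  show "f \<in> Dom K \<Longrightarrow> g \<in> Dom K \<Longrightarrow> f - g \<in> Dom K"
    using 1(2)[of f "- g"] 2(1)[of g "- 1"] by (simp add: m)
  show "f \<in> Dom K \<Longrightarrow> g \<in> Dom K \<Longrightarrow> app K (f - g) = app K f - app K g"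
    using 1(3)[of f "- g"] 2[of g "- 1"] by (simp add: m)
qed

text \<open>The lower bound gives injectivity and, read for the inverse, boundedness with constant
  \<open>1 / c\<close>; linearity of the inverse follows from uniqueness of preimages.\<close>

lemma resolvent_setI:
  assumes K: "linear_operator K" and c: "c > 0"
    and low: "\<And>f. f \<in> Dom K \<Longrightarrow> c * norm f \<le> norm (app K f - scaleC_L2 z f)"
    and surj: "\<And>h. \<exists>f\<in>Dom K. app K f - scaleC_L2 z f = h"
  shows "z \<in> resolvent_set K"
proof -
  let ?T = "\<lambda>f. app K f - scaleC_L2 z f"
  let ?R = "inv_into (Dom K) ?T"
  note lin = linear_operatorD[OF K]
  have Tdiff: "?T (f - g) = ?T f - ?T g" and Tadd: "?T (f + g) = ?T f + ?T g"
    if "f \<in> Dom K" "g \<in> Dom K" for f g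
    using that by (simp_all add: lin scaleC_L2_diff scaleC_L2_add)
  have Tscale: "?T (scaleC_L2 d f) = scaleC_L2 d (?T f)" if "f \<in> Dom K" for f d
    using that by (simp add: lin scaleC_L2_diff scaleC_L2_commute)
  have inj: "inj_on ?T (Dom K)"
  proof (rule inj_onI)
    fix f g assume fg: "f \<in> Dom K" "g \<in> Dom K" "?T f = ?T g"
    then have "c * norm (f - g) \<le> 0"
      using low[OF lin(6)[OF fg(1,2)]] Tdiff[OF fg(1,2)] by simp
    then have "norm (f - g) \<le> 0" using c by (simp add: mult_le_0_iff)
    then show "f = g" by simp
  qed
  have im: "?T ` Dom K = UNIV" using surj by (auto simp: image_def) metis
  have bij: "bij_betw ?T (Dom K) UNIV" using inj im by (simp add: bij_betw_def)
  have R: "?R h \<in> Dom K" "?T (?R h) = h" for h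
    using im inv_into_into[of h ?T "Dom K"] f_inv_into_f[of h ?T "Dom K"] by auto
  have RI: "?R h = f" if "f \<in> Dom K" "?T f = h" for f h
    using inv_into_f_f[OF inj that(1)] that(2) by simp
  have add: "?R (h + k) = ?R h + ?R k" for h k
    using R[of h] R[of k] by (intro RI lin) (simp_all add: Tadd)
  have scale: "?R (scaleC_L2 d h) = scaleC_L2 d (?R h)" for d h
    using R[of h] by (intro RI lin) (simp_all add: Tscale)
  have "bounded_linear ?R"
  proof (rule bounded_linear_intro[of _ "1 / c"])
    show "?R (h + k) = ?R h + ?R k" for h k by (rule add)
    show "?R (r *\<^sub>R h) = r *\<^sub>R ?R h" for r h
      using scale[of "of_real r" h] by (simp add: scaleC_L2_of_real)
    show "norm (?R h) \<le> norm h * (1 / c)" for h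
      using low[OF R(1)[of h]] R(2)[of h] c by (simp add: field_simps)
  qed
  then show ?thesis
    unfolding resolvent_set_def bounded_clinear_def using bij scale by simp
qed

text \<open>Symmetry makes \<open>cinner (app L f) f\<close> real, so the imaginary part of the form
  of \<open>L - z\<close> at \<open>f\<close> is \<open>- Im z\<close> times the squared norm.
  Cauchy-Schwarz finishes.\<close>

lemma symmetric_lower_bound:
  assumes sym: "\<And>f g. f \<in> Dom L \<Longrightarrow> g \<in> Dom L \<Longrightarrow> cinner (app L f) g = cinner f (app L g)"
    and f: "f \<in> Dom L"
  shows "\<bar>Im z\<bar> * norm f \<le> norm (app L f - scaleC_L2 z f)"
proof (cases "f = 0")
  case False
  have "Im (cinner (app L f) f) = 0"
    using sym[OF f f] cinner_commute[of f "app L f"] by (simp add: complex_eq_iff)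
  then have "\<bar>Im z\<bar> * (norm f)\<^sup>2 = \<bar>Im (cinner (app L f - scaleC_L2 z f) f)\<bar>"
    by (simp add: cinner_diff_left cinner_scaleC_left cinner_self abs_mult)
  also have "\<dots> \<le> norm (cinner (app L f - scaleC_L2 z f) f)"
    by (rule abs_Im_le_cmod)
  also have "\<dots> \<le> norm (app L f - scaleC_L2 z f) * norm f"
    by (rule cinner_norm_le)
  finally have "(\<bar>Im z\<bar> * norm f) * norm f \<le> norm (app L f - scaleC_L2 z f) * norm f"
    by (simp add: power2_eq_square mult.assoc)
  then show ?thesis using False by simp
qed simp

text \<open>For \<open>(g, h)\<close> in the adjoint graph, solve (L - i) k = h - i g with
  \<open>k\<close> in the domain. By symmetry \<open>g - k\<close> is orthogonal to the range of L +
  i, which is everything, so \<open>g = k\<close> lies in the domain.\<close>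

lemma self_adjointI:
  assumes L: "linear_operator L" and dense: "closure (Dom L) = UNIV"
    and sym: "\<And>f g. f \<in> Dom L \<Longrightarrow> g \<in> Dom L \<Longrightarrow> cinner (app L f) g = cinner f (app L g)"
    and surj: "\<And>z h. z \<notin> \<real> \<Longrightarrow> \<exists>f\<in>Dom L. app L f - scaleC_L2 z f = h"
  shows "self_adjoint L"
proof -
  have "(g, h) \<in> graph_of L" if gh: "(g, h) \<in> adjoint_graph L" for g h
  proof -
    have adj: "cinner (app L f) g = cinner f h" if "f \<in> Dom L" for f
      using gh that by (auto simp: adjoint_graph_def)
    have iR: "\<i> \<notin> \<real>" "- \<i> \<notin> \<real>" by (simp_all add: complex_is_Real_iff)
    obtain k where k: "k \<in> Dom L" "app L k - scaleC_L2 \<i> k = h - scaleC_L2 \<i> g"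
      using surj[OF iR(1)] by blast
    have orth: "cinner (app L f - scaleC_L2 (- \<i>) f) (g - k) = 0" if f: "f \<in> Dom L" for f
    proof -
      have "cinner (app L f - scaleC_L2 (- \<i>) f) g = cinner f (h - scaleC_L2 \<i> g)"
        by (simp add: cinner_diff_left cinner_diff_right cinner_scaleC_left cinner_scaleC_right adj[OF f])
      also have "\<dots> = cinner f (app L k - scaleC_L2 \<i> k)" by (simp only: k)
      also have "\<dots> = cinner (app L f - scaleC_L2 (- \<i>) f) k"
        by (simp add: cinner_diff_left cinner_diff_right cinner_scaleC_left cinner_scaleC_right sym[OF f k(1)])
      finally show ?thesis by (simp add: cinner_diff_right)
    qed
    obtain f where "f \<in> Dom L" "app L f - scaleC_L2 (- \<i>) f = g - k"
      using surj[OF iR(2)] by blast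
    with orth have "cinner (g - k) (g - k) = 0" by metis
    then have gk: "g = k" by (simp add: cinner_self)
    then have "h = app L g" using k(2) by (simp add: algebra_simps)
    then show ?thesis using k(1) gk by (auto simp: graph_of_def)
  qed
  moreover have "graph_of L \<subseteq> adjoint_graph L"
    using sym by (auto simp: graph_of_def adjoint_graph_def)
  ultimately show ?thesis
    using L dense unfolding self_adjoint_def by auto
qed

subsection \<open>The operator D\<close>

lemma linear_operator_D: "linear_operator D_op"
proof -
  have z: "H2 (\<lambda>x. 0 :: complex ^ 2) (\<lambda>x. 0) (\<lambda>x. 0)"
    by (rule H2I_C2) auto
  have add: "f + g \<in> Dom D_op \<and> app D_op (f + g) = app D_op f + app D_op g"
    if "f \<in> Dom D_op" "g \<in> Dom D_op" for f g
  proof -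
    from \<open>f \<in> Dom D_op\<close> obtain F F' f2 where F: "H2 F F' f2" "boundary_conditions F F'"
      "sq_int F" "sq_int f2" "f = abs_L2 F" "app D_op f = abs_L2 (\<lambda>x. - f2 x)" by (rule D_opE)
    from \<open>g \<in> Dom D_op\<close> obtain G G' g2 where G: "H2 G G' g2" "boundary_conditions G G'"
      "sq_int G" "sq_int g2" "g = abs_L2 G" "app D_op g = abs_L2 (\<lambda>x. - g2 x)" by (rule D_opE)
    have b: "boundary_conditions (\<lambda>x. F x + G x) (\<lambda>x. F' x + G' x)"
      using F G by (simp add: boundary_conditions_def)
    show ?thesis
      using D_opI[OF H2_add[OF F(1) G(1)] b] F G by (simp add: abs_L2_simps sq_int_minus)
  qed
  have scale: "scaleC_L2 c f \<in> Dom D_op \<and> app D_op (scaleC_L2 c f) = scaleC_L2 c (app D_op f)"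
    if "f \<in> Dom D_op" for c f
  proof -
    from that obtain F F' f2 where F: "H2 F F' f2" "boundary_conditions F F'"
      "sq_int F" "sq_int f2" "f = abs_L2 F" "app D_op f = abs_L2 (\<lambda>x. - f2 x)" by (rule D_opE)
    have bl: "bounded_linear (\<lambda>v :: complex ^ 2. c *s v)"
      unfolding scaleC_eq_matrix by (rule bounded_linear_matrix)
    have b: "boundary_conditions (\<lambda>x. c *s F x) (\<lambda>x. c *s F' x)"
      using F by (simp add: boundary_conditions_def)
    have m: "c *s (- v) = - (c *s v)" for v :: "complex ^ 2"
      by (simp add: vec_eq_iff)
    show ?thesis
      using D_opI[OF H2_linear[OF F(1) bl] b] F by (simp add: abs_L2_simps sq_int_minus m)
  qed
  have "0 \<in> Dom D_op"
    using D_opI(1)[OF z] by (simp add: boundary_conditions_def zero_L2.abs_eq)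
  then show ?thesis
    unfolding linear_operator_def using add scale by blast
qed

text \<open>Weighted polynomials are dense, and they belong to the domain because the weight
  annihilates values and first derivatives at both ends.\<close>

lemma dense_D: "closure (Dom D_op) = UNIV"
proof -
  have "f \<in> closure (Dom D_op)" for f
    unfolding closure_approachable
  proof (intro allI impI)
    fix e :: real assume e: "e > 0"
    obtain f0 where f: "sq_int f0" "f = abs_L2 f0" by (rule abs_L2_cases)
    obtain p where p: "polynomial_function p"
      "(LINT x|unit_meas. (norm (f0 x - end_weight x *\<^sub>R p x))\<^sup>2) < e\<^sup>2"
      using poly_approx_sq_int[OF f(1), unfolded poly_approx_def, rule_format, of "e\<^sup>2"] e by auto
    define q where "q x = end_weight x *\<^sub>R p x" for x
    obtain p' where p': "polynomial_function p'" "\<And>x. (p has_vector_derivative p' x) (at x)"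
      using has_vector_derivative_polynomial_function[OF p(1)] by blast
    obtain p'' where p'': "polynomial_function p''" "\<And>x. (p' has_vector_derivative p'' x) (at x)"
      using has_vector_derivative_polynomial_function[OF p'(1)] by blast
    \<comment> \<open>\<open>w1\<close> and \<open>w2\<close> are the first and second derivatives
      of \<open>end_weight\<close>; \<open>w1\<close> still has the factor x (1 - x).\<close>
    define w1 where "w1 x = 2 * (x * (1 - x)) * (1 - 2 * x)" for x :: real
    define w2 where "w2 x = 2 * (1 - 2 * x)\<^sup>2 - 4 * (x * (1 - x))" for x :: real
    have w1: "(end_weight has_real_derivative w1 x) (at x)" for x
      unfolding end_weight_def[abs_def] w1_def
      by (auto intro!: derivative_eq_intros simp: algebra_simps)
    have w2: "(w1 has_real_derivative w2 x) (at x)" for x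
      unfolding w1_def[abs_def] w2_def
      by (auto intro!: derivative_eq_intros simp: algebra_simps power2_eq_square)
    define q' where "q' x = end_weight x *\<^sub>R p' x + w1 x *\<^sub>R p x" for x
    define q'' where "q'' x = (end_weight x *\<^sub>R p'' x + w1 x *\<^sub>R p' x) + (w1 x *\<^sub>R p' x + w2 x *\<^sub>R p x)" for x
    have q1: "(q has_vector_derivative q' x) (at x)" for x
      unfolding q_def[abs_def] q'_def by (rule has_vector_derivative_scaleR[OF w1 p'(2)])
    have q2: "(q' has_vector_derivative q'' x) (at x)" for x
      unfolding q'_def[abs_def] q''_def
      by (intro has_vector_derivative_add has_vector_derivative_scaleR w1 w2 p'(2) p''(2))
    have "continuous_on {0..1} q''"
      unfolding q''_def[abs_def] w1_def w2_def end_weight_def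
      by (intro continuous_intros continuous_on_polymonial_function p p' p'')
    then have H: "H2 q q' q''"
      by (rule H2I_C2[OF has_vector_derivative_at_within[OF q1] has_vector_derivative_at_within[OF q2]])
    have b: "boundary_conditions q q'"
      by (simp add: boundary_conditions_def q_def q'_def end_weight_def w1_def)
    have sq: "sq_int q" by (rule sq_int_continuous[OF H2_continuous(2)[OF H]])
    have "(dist (abs_L2 q) f)\<^sup>2 = (LINT x|unit_meas. (norm (f0 x - q x))\<^sup>2)"
      by (subst dist_commute) (simp add: dist_norm f sq abs_L2_simps norm_abs_L2_sq sq_int_diff)
    then have "(dist (abs_L2 q) f)\<^sup>2 < e\<^sup>2"
      using p(2) by (simp add: q_def)
    then have "dist (abs_L2 q) f < e"
      using e by (simp add: power2_less_imp_less)
    then show "\<exists>y\<in>Dom D_op. dist y f < e" using D_opI(1)[OF H b] by blast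
  qed
  then show ?thesis by blast
qed

text \<open>The kernel is the conjugate of \<open>u\<close>, which is C^1, and the primitive is
  \<open>f'\<close>, so \<open>g\<close> may be merely square-integrable.\<close>

lemma parts_complex:
  fixes f f' g u u' h :: "real \<Rightarrow> complex"
  assumes "H2 f f' g" "H2 u u' h"
  shows "(LINT x|unit_meas. g x * cnj (u x))
    = f' 1 * cnj (u 1) - f' 0 * cnj (u 0) - (LINT x|unit_meas. f' x * cnj (u' x))"
proof -
  note c = H2_linear[OF assms(2) bounded_linear_cnj]
  interpret smooth_kernel "(*)" "\<lambda>x. cnj (u x)" "\<lambda>x. cnj (u' x)"
    by (rule smooth_kernel.intro[OF bounded_bilinear_mult H2_derivative[OF c] H2_continuous(1)[OF c]])
  show ?thesis
    using parts_unit[OF H2D(1,2)[OF assms(1)]] by (simp add: mult.commute)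
qed

text \<open>This is \<open>s\<close> times J. Being diagonal, it leaves the boundary conditions of
  the two components separate.\<close>

definition signature_matrix :: "real \<Rightarrow> complex ^ 2 ^ 2" where
  "signature_matrix s = vector [vector [of_real s, 0], vector [0, - of_real s]]"

text \<open>After integration by parts every boundary term contains either the first component of
  \<open>G\<close> or the second component of \<open>F'\<close> at an end point, and both vanish.
  What remains is visibly Hermitian.\<close>

lemma signature_form:
  assumes F: "H2 F F' f2" "boundary_conditions F F'" and G: "H2 G G' g2" "boundary_conditions G G'"
  shows "cinner (matrix_L2 (signature_matrix s) (app D_op (abs_L2 F))) (abs_L2 G)
    = of_real s * ((LINT x|unit_meas. F' x $ 1 * cnj (G' x $ 1)) - (LINT x|unit_meas. F' x $ 2 * cnj (G' x $ 2)))"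
proof -
  have s: "sq_int F" "sq_int G" "sq_int f2"
    by (rule sq_int_continuous H2_continuous F G H2D(1))+
  note i = integrable_mult_cnj[OF s(3) s(2)]
  have c: "(LINT x|unit_meas. f2 x $ i * cnj (G x $ i))
      = F' 1 $ i * cnj (G 1 $ i) - F' 0 $ i * cnj (G 0 $ i) - (LINT x|unit_meas. F' x $ i * cnj (G' x $ i))"
    for i
    using parts_complex[OF H2_linear[OF F(1) bounded_linear_vec_nth[of i]] H2_linear[OF G(1) bounded_linear_vec_nth[of i]]] .
  have "cinner (matrix_L2 (signature_matrix s) (app D_op (abs_L2 F))) (abs_L2 G)
    = (LINT x|unit_meas. of_real s * (f2 x $ 2 * cnj (G x $ 2)) - of_real s * (f2 x $ 1 * cnj (G x $ 1)))"
    by (simp add: D_opI(2)[OF F] abs_L2_simps s sq_int_minus sq_int_matrix)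
      (simp add: signature_matrix_def matrix_vector_mult_def sum_2 mult.assoc)
  also have "\<dots> = of_real s * (LINT x|unit_meas. f2 x $ 2 * cnj (G x $ 2))
      - of_real s * (LINT x|unit_meas. f2 x $ 1 * cnj (G x $ 1))"
    using i by simp
  also have "\<dots> = of_real s * ((LINT x|unit_meas. F' x $ 1 * cnj (G' x $ 1)) - (LINT x|unit_meas. F' x $ 2 * cnj (G' x $ 2)))"
    unfolding c using F(2) G(2) by (simp add: boundary_conditions_def algebra_simps)
  finally show ?thesis .
qed

lemma signature_symmetric:
  assumes "f \<in> Dom D_op" "g \<in> Dom D_op"
  shows "cinner (matrix_L2 (signature_matrix s) (app D_op f)) g
    = cinner f (matrix_L2 (signature_matrix s) (app D_op g))"
proof -
  from assms(1) obtain F F' f2 where F: "H2 F F' f2" "boundary_conditions F F'" "sq_int F" "sq_int f2"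
    "f = abs_L2 F" "app D_op f = abs_L2 (\<lambda>x. - f2 x)" by (rule D_opE)
  from assms(2) obtain G G' g2 where G: "H2 G G' g2" "boundary_conditions G G'" "sq_int G" "sq_int g2"
    "g = abs_L2 G" "app D_op g = abs_L2 (\<lambda>x. - g2 x)" by (rule D_opE)
  have e: "cnj (LINT x|unit_meas. G' x $ i * cnj (F' x $ i)) = (LINT x|unit_meas. F' x $ i * cnj (G' x $ i))" for i
    by (subst Bochner_Integration.integral_cnj[symmetric]) (simp add: mult.commute)
  show ?thesis
    unfolding cinner_commute[of f "matrix_L2 (signature_matrix s) (app D_op g)"]
    unfolding F(5) G(5) signature_form[OF F(1,2) G(1,2)] signature_form[OF G(1,2) F(1,2)]
    by (simp add: e)
qed

subsection \<open>Linear differential equations with square-integrable forcing\<close>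

lemma exp_vector_derivative:
  fixes c :: complex
  shows "((\<lambda>t. exp (c * of_real t)) has_vector_derivative c * exp (c * of_real t)) (at t within S)"
proof -
  have "((\<lambda>z. exp (c * z)) has_field_derivative c * exp (c * of_real t)) (at (of_real t))"
    by (auto intro!: derivative_eq_intros)
  from has_vector_derivative_at_within[OF has_vector_derivative_real_field[OF this]]
  show ?thesis .
qed

text \<open>Variation of constants, exp(cx) times the integral of exp(-ct) h(t). The equation is
  stated in integral form because \<open>h\<close> need not be continuous.\<close>

lemma first_order_ivp:
  fixes h :: "real \<Rightarrow> complex"
  assumes h: "sq_int h"
  obtains E where "continuous_on {0..1} E" "\<And>x. x \<in> {0..1} \<Longrightarrow> E x = integral {0..x} (\<lambda>t. c * E t + h t)"
proof -
  have ce: "continuous_on S (\<lambda>t. exp (k * complex_of_real t))" for k S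
    by (intro continuous_intros)
  define g where "g t = exp (- c * of_real t) * h t" for t :: real
  \<comment> \<open>The summand 0 displays the initial value in the shape that \<open>parts\<close>
    expects.\<close>
  define G where "G x = 0 + integral {0..x} g" for x
  have g: "sq_int g"
    unfolding g_def[abs_def] by (rule sq_int_bilinear_continuous[OF bounded_bilinear_mult ce h])
  interpret smooth_kernel "(*)" "\<lambda>t. exp (c * complex_of_real t)" "\<lambda>t. c * exp (c * complex_of_real t)"
    by (rule smooth_kernel.intro[OF bounded_bilinear_mult exp_vector_derivative
          continuous_on_mult[OF continuous_on_const ce]])
  have cG: "continuous_on {0..1} G"
    by (rule continuous_if_primitive[OF g]) (simp add: G_def)
  define E where "E x = exp (c * of_real x) * G x" for x
  have "E x = integral {0..x} (\<lambda>t. c * E t + h t)" if "x \<in> {0..1}" for x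
  proof -
    have "((\<lambda>t. c * exp (c * of_real t) * G t + exp (c * of_real t) * g t) has_integral
        exp (c * of_real x) * G x - exp (c * of_real 0) * 0) {0..x}"
      by (rule parts[OF g]) (use that in \<open>auto simp: G_def\<close>)
    moreover have "c * exp (c * of_real t) * G t + exp (c * of_real t) * g t = c * E t + h t" for t
      by (simp add: E_def g_def mult.assoc exp_minus field_simps)
    ultimately have "((\<lambda>t. c * E t + h t) has_integral E x) {0..x}"
      by (simp add: E_def)
    then show ?thesis by (simp add: integral_unique)
  qed
  moreover have "continuous_on {0..1} E"
    unfolding E_def[abs_def] by (intro continuous_on_mult ce cG)
  ultimately show thesis using that by blast
qed

text \<open>The operator $d^2/dx^2 - c^2$ is factored as $(d/dx - c)(d/dx + c)$.\<close>

lemma second_order_ivp: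
  fixes h :: "real \<Rightarrow> complex"
  assumes h: "sq_int h"
  obtains y y' where "H2 y y' (\<lambda>x. c\<^sup>2 * y x + h x)" "y 0 = 0" "y' 0 = 0"
proof -
  obtain E where E: "continuous_on {0..1} E" "\<And>x. x \<in> {0..1} \<Longrightarrow> E x = integral {0..x} (\<lambda>t. c * E t + h t)"
    using first_order_ivp[OF h, where c = c] by blast
  have sE: "sq_int E" by (rule sq_int_continuous[OF E(1)])
  obtain y where y: "continuous_on {0..1} y" "\<And>x. x \<in> {0..1} \<Longrightarrow> y x = integral {0..x} (\<lambda>t. - c * y t + E t)"
    using first_order_ivp[OF sE, where c = "- c"] by blast
  define y' where "y' x = - c * y x + E x" for x
  have sm: "sq_int (\<lambda>t. k * u t)" if "sq_int u" for k :: complex and u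
    by (rule sq_int_linear[OF that bounded_linear_mult_right])
  have s1: "sq_int (\<lambda>t. - c * y t + E t)" "sq_int (\<lambda>t. c * E t + h t)"
    by (intro sq_int_add sm sE h sq_int_continuous[OF y(1)])+
  have s2: "sq_int (\<lambda>x. c\<^sup>2 * y x + h x)"
    by (intro sq_int_add sm h sq_int_continuous[OF y(1)])
  have z: "y 0 = 0" "y' 0 = 0" using y(2)[of 0] E(2)[of 0] by (auto simp: y'_def)
  have p: "y' x = integral {0..x} (\<lambda>x. c\<^sup>2 * y x + h x)" if x: "x \<in> {0..1}" for x
  proof -
    have x': "0 \<le> x" "x \<le> 1" using x by auto
    note i = sq_int_integrable_on(1)[OF s1(1) x'] sq_int_integrable_on(1)[OF s1(2) x']
    have "y' x = - c * integral {0..x} (\<lambda>t. - c * y t + E t) + integral {0..x} (\<lambda>t. c * E t + h t)"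
      unfolding y'_def using y(2)[OF x] E(2)[OF x] by simp
    also have "\<dots> = integral {0..x} (\<lambda>t. - c * (- c * y t + E t)) + integral {0..x} (\<lambda>t. c * E t + h t)"
      by (simp only: integral_mult_right)
    also have "\<dots> = integral {0..x} (\<lambda>t. - c * (- c * y t + E t) + (c * E t + h t))"
      by (rule integral_add[symmetric, OF integrable_on_mult_right[OF i(1)] i(2)])
    also have "\<dots> = integral {0..x} (\<lambda>x. c\<^sup>2 * y x + h x)"
      by (rule integral_cong) (simp add: algebra_simps power2_eq_square)
    finally show ?thesis .
  qed
  have "H2 y y' (\<lambda>x. c\<^sup>2 * y x + h x)"
    unfolding H2_def
  proof (intro conjI ballI s2)
    fix x :: real assume x: "x \<in> {0..1}"
    show "y' x = y' 0 + integral {0..x} (\<lambda>x. c\<^sup>2 * y x + h x)" using p[OF x] z by simp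
    show "y x = y 0 + integral {0..x} y'"
      using y(2)[OF x] z by (simp add: y'_def[abs_def])
  qed
  then show thesis using that z by blast
qed

definition ch :: "complex \<Rightarrow> real \<Rightarrow> complex" where
  "ch c x = (exp (c * of_real x) + exp (- c * of_real x)) / 2"

text \<open>Division by \<open>2 * c\<close> gives sinh(cx)/c, whose derivative is exactly
  \<open>ch c\<close>. Thus \<open>ch c\<close> and \<open>sh c\<close> have initial data (1, 0) and
  (0, 1).\<close>

definition sh :: "complex \<Rightarrow> real \<Rightarrow> complex" where
  "sh c x = (exp (c * of_real x) - exp (- c * of_real x)) / (2 * c)"

lemma ch_sh_zero: "ch c 0 = 1" "sh c 0 = 0"
  by (simp_all add: ch_def sh_def)

lemma H2_ch_sh:
  assumes "c \<noteq> 0"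
  shows "H2 (ch c) (\<lambda>x. c\<^sup>2 * sh c x) (\<lambda>x. c\<^sup>2 * ch c x)" "H2 (sh c) (ch c) (\<lambda>x. c\<^sup>2 * sh c x)"
proof -
  note d = bounded_linear.has_vector_derivative[OF bounded_linear_divide]
  have 1: "(ch c has_vector_derivative c\<^sup>2 * sh c x) (at x within {0..1})" for x
  proof -
    have "((\<lambda>x. (exp (c * of_real x) + exp (- c * of_real x)) / 2) has_vector_derivative
        (c * exp (c * of_real x) + (- c) * exp (- c * of_real x)) / 2) (at x within {0..1})"
      by (rule d[OF has_vector_derivative_add[OF exp_vector_derivative exp_vector_derivative]])
    moreover have "(c * exp (c * of_real x) + (- c) * exp (- c * of_real x)) / 2 = c\<^sup>2 * sh c x"
      using assms by (simp add: sh_def power2_eq_square field_simps)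
    ultimately show ?thesis by (simp add: ch_def[abs_def])
  qed
  have 2: "(sh c has_vector_derivative ch c x) (at x within {0..1})" for x
  proof -
    have "((\<lambda>x. (exp (c * of_real x) - exp (- c * of_real x)) / (2 * c)) has_vector_derivative
        (c * exp (c * of_real x) - (- c) * exp (- c * of_real x)) / (2 * c)) (at x within {0..1})"
      by (rule d[OF has_vector_derivative_diff[OF exp_vector_derivative exp_vector_derivative]])
    moreover have "(c * exp (c * of_real x) - (- c) * exp (- c * of_real x)) / (2 * c) = ch c x"
      using assms by (simp add: ch_def field_simps)
    ultimately show ?thesis by (simp add: sh_def[abs_def])
  qed
  have 3: "((\<lambda>x. c\<^sup>2 * sh c x) has_vector_derivative c\<^sup>2 * ch c x) (at x within {0..1})" for x
    by (rule bounded_linear.has_vector_derivative[OF bounded_linear_mult_right 2])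
  have c: "continuous_on {0..1} (\<lambda>x. c\<^sup>2 * ch c x)" "continuous_on {0..1} (\<lambda>x. c\<^sup>2 * sh c x)"
    unfolding ch_def sh_def using assms by (auto intro!: continuous_intros)
  show "H2 (ch c) (\<lambda>x. c\<^sup>2 * sh c x) (\<lambda>x. c\<^sup>2 * ch c x)" by (rule H2I_C2[OF 1 3 c(1)])
  show "H2 (sh c) (ch c) (\<lambda>x. c\<^sup>2 * sh c x)" by (rule H2I_C2[OF 2 1 c(2)])
qed

text \<open>If the determinant vanished, (m22, -m21) and (m12, -m11) would be kernel vectors, hence
  zero, and then (1, 1) would be a kernel vector too. With a nonzero determinant Cramer's rule gives
  the solution.\<close>

lemma linear_system_2:
  fixes m11 m12 m21 m22 :: "'a::field"
  assumes "\<And>x y. m11 * x + m12 * y = 0 \<Longrightarrow> m21 * x + m22 * y = 0 \<Longrightarrow> x = 0 \<and> y = 0"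
  shows "\<exists>x y. m11 * x + m12 * y = r1 \<and> m21 * x + m22 * y = r2"
proof -
  let ?D = "m11 * m22 - m12 * m21"
  have D: "?D \<noteq> 0"
  proof
    assume D: "?D = 0"
    have "m22 = 0 \<and> - m21 = 0"
      by (rule assms) (use D in \<open>auto simp: algebra_simps\<close>)
    moreover have "m12 = 0 \<and> - m11 = 0"
      by (rule assms) (use D in \<open>auto simp: algebra_simps\<close>)
    ultimately show False using assms[of 1 1] by simp
  qed
  have e: "m11 * (m22 * r1 - m12 * r2) + m12 * (m11 * r2 - m21 * r1) = r1 * ?D"
    "m21 * (m22 * r1 - m12 * r2) + m22 * (m11 * r2 - m21 * r1) = r2 * ?D"
    by (simp_all add: algebra_simps)
  show ?thesis
    by (rule exI[of _ "(m22 * r1 - m12 * r2) / ?D"], rule exI[of _ "(m11 * r2 - m21 * r1) / ?D"],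
        simp only: times_divide_eq_right add_divide_distrib[symmetric] e) (use D in simp)
qed

subsection \<open>The boundary value problem\<close>

lemma bounded_linear_scaleC_left: "bounded_linear (\<lambda>c. c *s (v :: complex ^ 2))"
proof -
  have "linear (\<lambda>c. c *s v)"
    by (rule linearI) (simp_all add: vec_eq_iff algebra_simps)
  then show ?thesis by (simp add: linear_conv_bounded_linear)
qed

text \<open>In eigenvector coordinates the equation decouples into scalar equations with
  coefficients c1^2 = -z/\<mu>1 and c2^2 = -z/\<mu>2; only the boundary conditions still couple the
  two. Nonzero eigenvalues permit the division, and \<open>z \<noteq> 0\<close> keeps
  \<open>c1\<close> and \<open>c2\<close> nonzero, as \<open>sh\<close> requires.\<close>

locale eigen_matrix =
  fixes A :: "complex ^ 2 ^ 2" and \<mu>1 \<mu>2 w1 w2 z :: complex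
  assumes eigen: "A *v vector [1, w1] = \<mu>1 *s vector [1, w1]" "A *v vector [1, w2] = \<mu>2 *s vector [1, w2]"
    and ne: "\<mu>1 \<noteq> 0" "\<mu>2 \<noteq> 0" "w1 \<noteq> w2" "z \<noteq> 0"
begin

definition "c1 = csqrt (- z / \<mu>1)"
definition "c2 = csqrt (- z / \<mu>2)"

lemma c: "c1\<^sup>2 = - z / \<mu>1" "c2\<^sup>2 = - z / \<mu>2" "c1 \<noteq> 0" "c2 \<noteq> 0"
  using ne by (auto simp: c1_def c2_def)

definition combine :: "(real \<Rightarrow> complex) \<Rightarrow> (real \<Rightarrow> complex) \<Rightarrow> real \<Rightarrow> complex ^ 2" where
  "combine p q x = p x *s vector [1, w1] + q x *s vector [1, w2]"

lemma combine_nth [simp]: "combine p q x $ 1 = p x + q x" "combine p q x $ 2 = w1 * p x + w2 * q x"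
  by (simp_all add: combine_def mult.commute)

text \<open>On the first eigenvector the operator acts as -\<mu>1 p'' - z p. Since \<mu>1 c1^2 = -z,
  only -\<mu>1 g survives, and likewise for the second.\<close>

lemma combine_solves:
  assumes p: "H2 p p' (\<lambda>x. c1\<^sup>2 * p x + g x)" and q: "H2 q q' (\<lambda>x. c2\<^sup>2 * q x + h x)"
    and s: "sq_int g" "sq_int h"
    and b: "boundary_conditions (combine p q) (combine p' q')"
  shows "H2 (combine p q) (combine p' q') (combine (\<lambda>x. c1\<^sup>2 * p x + g x) (\<lambda>x. c2\<^sup>2 * q x + h x))"
    and "abs_L2 (combine p q) \<in> Dom D_op"
    and "matrix_L2 A (app D_op (abs_L2 (combine p q))) - scaleC_L2 z (abs_L2 (combine p q))
      = abs_L2 (combine (\<lambda>x. - \<mu>1 * g x) (\<lambda>x. - \<mu>2 * h x))"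
proof -
  let ?g2 = "combine (\<lambda>x. c1\<^sup>2 * p x + g x) (\<lambda>x. c2\<^sup>2 * q x + h x)"
  show H: "H2 (combine p q) (combine p' q') ?g2"
    unfolding combine_def[abs_def]
    by (rule H2_add[OF H2_linear[OF p bounded_linear_scaleC_left] H2_linear[OF q bounded_linear_scaleC_left]])
  show "abs_L2 (combine p q) \<in> Dom D_op" by (rule D_opI(1)[OF H b])
  have sF: "sq_int (combine p q)" by (rule sq_int_continuous[OF H2_continuous(2)[OF H]])
  have s2: "sq_int ?g2" by (rule H2D(1)[OF H])
  have "A *v (- ?g2 x) - z *s combine p q x = combine (\<lambda>x. - \<mu>1 * g x) (\<lambda>x. - \<mu>2 * h x) x" for x
  proof -
    have lin: "A *v (r *s u + t *s v) = r *s (A *v u) + t *s (A *v v)" for r t u v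
      by (simp add: vec_eq_iff matrix_vector_mult_def sum_2 algebra_simps)
    have "- ?g2 x = (- (c1\<^sup>2 * p x + g x)) *s vector [1, w1] + (- (c2\<^sup>2 * q x + h x)) *s vector [1, w2]"
      by (simp add: combine_def vec_eq_iff algebra_simps)
    then have e: "A *v (- ?g2 x) = (- (c1\<^sup>2 * p x + g x)) *s (\<mu>1 *s vector [1, w1])
        + (- (c2\<^sup>2 * q x + h x)) *s (\<mu>2 *s vector [1, w2])"
      by (simp only: lin eigen)
    have k: "c1\<^sup>2 * \<mu>1 = - z" "c2\<^sup>2 * \<mu>2 = - z" using c ne by auto
    have r: "(- (c1\<^sup>2 * p x + g x)) * \<mu>1 = z * p x - \<mu>1 * g x" "(- (c2\<^sup>2 * q x + h x)) * \<mu>2 = z * q x - \<mu>2 * h x"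
    proof -
      have "(- (c1\<^sup>2 * p x + g x)) * \<mu>1 = - (c1\<^sup>2 * \<mu>1) * p x - \<mu>1 * g x"
        "(- (c2\<^sup>2 * q x + h x)) * \<mu>2 = - (c2\<^sup>2 * \<mu>2) * q x - \<mu>2 * h x"
        by (simp_all add: algebra_simps)
      then show "(- (c1\<^sup>2 * p x + g x)) * \<mu>1 = z * p x - \<mu>1 * g x"
        "(- (c2\<^sup>2 * q x + h x)) * \<mu>2 = z * q x - \<mu>2 * h x"
        by (simp_all only: k) simp_all
    qed
    show ?thesis
      unfolding e vector_smult_assoc r
      by (simp add: vec_eq_iff combine_def algebra_simps)
  qed
  then show "matrix_L2 A (app D_op (abs_L2 (combine p q))) - scaleC_L2 z (abs_L2 (combine p q))
      = abs_L2 (combine (\<lambda>x. - \<mu>1 * g x) (\<lambda>x. - \<mu>2 * h x))"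
    by (simp add: D_opI(2)[OF H b] abs_L2_simps sF s2 sq_int_minus sq_int_matrix sq_int_scaleC)
qed

theorem bvp_solvable:
  assumes unique: "\<And>f. f \<in> Dom D_op \<Longrightarrow> matrix_L2 A (app D_op f) - scaleC_L2 z f = 0 \<Longrightarrow> f = 0"
  shows "\<exists>f\<in>Dom D_op. matrix_L2 A (app D_op f) - scaleC_L2 z f = k"
proof -
  obtain k0 where k0: "sq_int k0" "k = abs_L2 k0" by (rule abs_L2_cases)
  \<comment> \<open>\<open>e1\<close> and \<open>e2\<close> are the coordinates of \<open>k0\<close>
    in the eigenvector basis; the division uses \<open>w1 \<noteq> w2\<close>.\<close>
  define e2 where "e2 x = (k0 x $ 2 - w1 * k0 x $ 1) / (w2 - w1)" for x
  define e1 where "e1 x = k0 x $ 1 - e2 x" for x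
  have n: "sq_int (\<lambda>x. k0 x $ i)" for i
    by (rule sq_int_linear[OF k0(1) bounded_linear_vec_nth])
  have sm: "sq_int (\<lambda>t. r * u t)" if "sq_int u" for r :: complex and u
    by (rule sq_int_linear[OF that bounded_linear_mult_right])
  have e: "sq_int e1" "sq_int e2"
  proof -
    show 2: "sq_int e2"
      unfolding e2_def[abs_def]
      by (rule sq_int_linear[OF sq_int_diff[OF n sm[OF n]] bounded_linear_divide])
    show "sq_int e1" unfolding e1_def[abs_def] by (rule sq_int_diff[OF n 2])
  qed
  have ek: "combine e1 e2 x = k0 x" for x
  proof -
    have "(w2 - w1) * e2 x = k0 x $ 2 - w1 * k0 x $ 1"
      using ne(3) by (simp add: e2_def)
    then have "w2 * e2 x = w1 * e2 x + k0 x $ 2 - w1 * k0 x $ 1"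
      by (simp add: algebra_simps)
    then show ?thesis
      by (simp add: vec_eq_iff forall_2 e1_def right_diff_distrib)
  qed
  \<comment> \<open>Chosen to cancel the factors -\<mu>1 and -\<mu>2 that
    \<open>combine_solves\<close> puts in front of the forcing.\<close>
  define g where "g x = (- 1 / \<mu>1) * e1 x" for x
  define h where "h x = (- 1 / \<mu>2) * e2 x" for x
  have gh: "sq_int g" "sq_int h"
    unfolding g_def[abs_def] h_def[abs_def] by (intro sm e)+
  obtain p p' where p: "H2 p p' (\<lambda>x. c1\<^sup>2 * p x + g x)" "p 0 = 0" "p' 0 = 0"
    using second_order_ivp[OF gh(1)] by blast
  obtain q q' where q: "H2 q q' (\<lambda>x. c2\<^sup>2 * q x + h x)" "q 0 = 0" "q' 0 = 0"
    using second_order_ivp[OF gh(2)] by blast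
  \<comment> \<open>\<epsilon> switches the particular solution on or off. The coefficients of
    \<alpha> (1 and -1) and of \<beta> (w2 and -w1) are chosen so that both conditions at 0 hold
    identically, leaving two equations at 1 for two unknowns.\<close>
  define P where "P \<epsilon> \<alpha> \<beta> x = \<epsilon> * p x + (\<alpha> * ch c1 x + (\<beta> * w2) * sh c1 x)" for \<epsilon> \<alpha> \<beta> x
  define P' where "P' \<epsilon> \<alpha> \<beta> x = \<epsilon> * p' x + (\<alpha> * (c1\<^sup>2 * sh c1 x) + (\<beta> * w2) * ch c1 x)" for \<epsilon> \<alpha> \<beta> x
  define Q where "Q \<epsilon> \<alpha> \<beta> x = \<epsilon> * q x + ((- \<alpha>) * ch c2 x + (- \<beta> * w1) * sh c2 x)" for \<epsilon> \<alpha> \<beta> x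
  define Q' where "Q' \<epsilon> \<alpha> \<beta> x = \<epsilon> * q' x + ((- \<alpha>) * (c2\<^sup>2 * sh c2 x) + (- \<beta> * w1) * ch c2 x)" for \<epsilon> \<alpha> \<beta> x
  note lin = H2_linear[OF _ bounded_linear_mult_right]
  have HP: "H2 (P \<epsilon> \<alpha> \<beta>) (P' \<epsilon> \<alpha> \<beta>) (\<lambda>x. c1\<^sup>2 * P \<epsilon> \<alpha> \<beta> x + \<epsilon> * g x)" for \<epsilon> \<alpha> \<beta>
    using H2_add[OF lin[OF p(1)] H2_add[OF lin[OF H2_ch_sh(1)[OF c(3)]] lin[OF H2_ch_sh(2)[OF c(3)]]], of \<epsilon> \<alpha> "\<beta> * w2"]
    by (simp add: P_def[abs_def] P'_def[abs_def] algebra_simps)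
  have HQ: "H2 (Q \<epsilon> \<alpha> \<beta>) (Q' \<epsilon> \<alpha> \<beta>) (\<lambda>x. c2\<^sup>2 * Q \<epsilon> \<alpha> \<beta> x + \<epsilon> * h x)" for \<epsilon> \<alpha> \<beta>
    using H2_add[OF lin[OF q(1)] H2_add[OF lin[OF H2_ch_sh(1)[OF c(4)]] lin[OF H2_ch_sh(2)[OF c(4)]]], of \<epsilon> "- \<alpha>" "- \<beta> * w1"]
    by (simp add: Q_def[abs_def] Q'_def[abs_def] algebra_simps)
  let ?F = "\<lambda>\<epsilon> \<alpha> \<beta>. combine (P \<epsilon> \<alpha> \<beta>) (Q \<epsilon> \<alpha> \<beta>)" and ?F' = "\<lambda>\<epsilon> \<alpha> \<beta>. combine (P' \<epsilon> \<alpha> \<beta>) (Q' \<epsilon> \<alpha> \<beta>)"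
  let ?m11 = "ch c1 1 - ch c2 1" and ?m12 = "w2 * sh c1 1 - w1 * sh c2 1"
  let ?m21 = "w1 * (c1\<^sup>2 * sh c1 1) - w2 * (c2\<^sup>2 * sh c2 1)" and ?m22 = "w1 * w2 * ch c1 1 - w1 * w2 * ch c2 1"
  let ?r1 = "p 1 + q 1" and ?r2 = "w1 * p' 1 + w2 * q' 1"
  have bc: "boundary_conditions (?F \<epsilon> \<alpha> \<beta>) (?F' \<epsilon> \<alpha> \<beta>)"
    if "\<epsilon> * ?r1 + (?m11 * \<alpha> + ?m12 * \<beta>) = 0" "\<epsilon> * ?r2 + (?m21 * \<alpha> + ?m22 * \<beta>) = 0" for \<epsilon> \<alpha> \<beta>
    using that p(2,3) q(2,3)
    by (simp add: boundary_conditions_def P_def Q_def P'_def Q'_def ch_sh_zero) (simp add: algebra_simps)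
  have "\<exists>\<alpha> \<beta>. ?m11 * \<alpha> + ?m12 * \<beta> = - ?r1 \<and> ?m21 * \<alpha> + ?m22 * \<beta> = - ?r2"
  proof (rule linear_system_2)
    fix \<alpha> \<beta>
    assume "?m11 * \<alpha> + ?m12 * \<beta> = 0" "?m21 * \<alpha> + ?m22 * \<beta> = 0"
    then have b: "boundary_conditions (?F 0 \<alpha> \<beta>) (?F' 0 \<alpha> \<beta>)" by (intro bc) auto
    have H0: "H2 (P 0 \<alpha> \<beta>) (P' 0 \<alpha> \<beta>) (\<lambda>x. c1\<^sup>2 * P 0 \<alpha> \<beta> x + 0)" "H2 (Q 0 \<alpha> \<beta>) (Q' 0 \<alpha> \<beta>) (\<lambda>x. c2\<^sup>2 * Q 0 \<alpha> \<beta> x + 0)"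
      using HP[of 0] HQ[of 0] by simp_all
    note sol = combine_solves[OF H0 sq_int_const sq_int_const b]
    have z0: "abs_L2 (combine (\<lambda>x. - \<mu>1 * 0) (\<lambda>x. - \<mu>2 * 0)) = 0"
      by (simp add: combine_def[abs_def] zero_L2.abs_eq)
    have cF: "continuous_on {0..1} (?F 0 \<alpha> \<beta>)" by (rule H2_continuous(2)[OF sol(1)])
    have "abs_L2 (?F 0 \<alpha> \<beta>) = abs_L2 (\<lambda>x. 0)"
      using unique[OF sol(2)] sol(3) z0 by (simp only: zero_L2.abs_eq)
    then have "AE x in unit_meas. ?F 0 \<alpha> \<beta> x = 0"
      using abs_L2_eq_iff[OF sq_int_continuous[OF cF] sq_int_const] by simp
    then have "AE x in unit_meas. 0 < x \<and> x < 1 \<longrightarrow> ?F 0 \<alpha> \<beta> x = 0"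
      by eventually_elim simp
    then have F0: "?F 0 \<alpha> \<beta> x = 0" if "x \<in> {0..1}" for x
      using AE_eq_imp_eq_subinterval[OF cF continuous_on_const, of 0 x] that by simp
    \<comment> \<open>The solution vanishes on the whole interval, so its one-sided derivative at 0
      vanishes too.\<close>
    have d0: "((\<lambda>x. 0) has_vector_derivative ?F' 0 \<alpha> \<beta> 0) (at 0 within {0..1})"
      by (rule has_vector_derivative_transform[OF _ _ H2_derivative[OF sol(1)]]) (auto simp: F0)
    have F'0: "?F' 0 \<alpha> \<beta> 0 = 0"
      by (rule vector_derivative_unique_within[OF _ d0 has_vector_derivative_const])
        (simp add: trivial_limit_within islimpt_Icc)
    \<comment> \<open>The two quantities at 0 that the boundary conditions leave free, the value of
      the second component and the derivative of the first, recover \<alpha> and \<beta>.\<close>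
    have "\<alpha> * (w1 - w2) = ?F 0 \<alpha> \<beta> 0 $ 2"
      by (simp add: P_def Q_def ch_sh_zero algebra_simps)
    then have "\<alpha> = 0" using F0[of 0] ne(3) by simp
    moreover have "\<beta> * (w2 - w1) = ?F' 0 \<alpha> \<beta> 0 $ 1"
      by (simp add: P'_def Q'_def ch_sh_zero algebra_simps)
    then have "\<beta> = 0" using F'0 ne(3) by simp
    ultimately show "\<alpha> = 0 \<and> \<beta> = 0" by simp
  qed
  then obtain \<alpha> \<beta> where "?m11 * \<alpha> + ?m12 * \<beta> = - ?r1" "?m21 * \<alpha> + ?m22 * \<beta> = - ?r2" by blast
  then have b: "boundary_conditions (?F 1 \<alpha> \<beta>) (?F' 1 \<alpha> \<beta>)" by (intro bc) simp_all
  have H1: "H2 (P 1 \<alpha> \<beta>) (P' 1 \<alpha> \<beta>) (\<lambda>x. c1\<^sup>2 * P 1 \<alpha> \<beta> x + g x)" "H2 (Q 1 \<alpha> \<beta>) (Q' 1 \<alpha> \<beta>) (\<lambda>x. c2\<^sup>2 * Q 1 \<alpha> \<beta> x + h x)"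
    using HP[of 1] HQ[of 1] by simp_all
  note sol = combine_solves[OF H1 gh b]
  have "combine (\<lambda>x. - \<mu>1 * g x) (\<lambda>x. - \<mu>2 * h x) = k0"
    using ek ne by (simp add: fun_eq_iff g_def h_def combine_def)
  then show ?thesis using sol(2,3) k0(2) by metis
qed

end

subsection \<open>The operator in the non-degenerate case\<close>

lemma cinner_matrix_right: "cinner f (matrix_L2 A g) = cinner (matrix_L2 (adjoint_matrix A) f) g"
  unfolding cinner_commute[of f "matrix_L2 A g"] cinner_commute[of "matrix_L2 (adjoint_matrix A) f" g]
  by (simp add: cinner_matrix_left)

lemma unit_integral_FTC:
  fixes f :: "real \<Rightarrow> real"
  assumes "\<And>x. (F has_real_derivative f x) (at x)" "continuous_on UNIV f"
  shows "(LINT x|unit_meas. f x) = F 1 - F 0"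
proof -
  have "(f has_integral F 1 - F 0) {0..1}"
    using assms(1) by (intro fundamental_theorem_of_calculus)
      (auto simp: has_real_derivative_iff_has_vector_derivative intro: has_vector_derivative_at_within)
  moreover have sf: "sq_int f"
    by (rule sq_int_continuous) (rule continuous_on_subset[OF assms(2)], simp)
  ultimately show ?thesis
    using unit_integral_eq[OF integrable_sq_int[OF sf]] by (simp add: integral_unique)
qed

lemma trig_integrals:
  assumes "k \<noteq> 0" "sin k = 0"
  shows "(LINT x|unit_meas. (sin (k * x))\<^sup>2) = 1 / 2"
    "(LINT x|unit_meas. (cos (k * x))\<^sup>2) = 1 / 2"
    "(LINT x|unit_meas. sin (k * x) * cos (k * x)) = 0"
proof -
  have sq: "sin t * sin t = 1 - cos t * cos t" for t :: real
    using sin_squared_eq[of t] by (simp add: power2_eq_square)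
  have c: "continuous_on UNIV (\<lambda>x. (sin (k * x))\<^sup>2)" "continuous_on UNIV (\<lambda>x. (cos (k * x))\<^sup>2)"
    "continuous_on UNIV (\<lambda>x. sin (k * x) * cos (k * x))"
    by (intro continuous_intros)+
  have "((\<lambda>x. x / 2 - sin (k * x) * cos (k * x) / (2 * k)) has_real_derivative (sin (k * x))\<^sup>2) (at x)" for x
    using assms(1) by (auto intro!: derivative_eq_intros simp: field_simps power2_eq_square sq)
  from unit_integral_FTC[OF this c(1)] show "(LINT x|unit_meas. (sin (k * x))\<^sup>2) = 1 / 2"
    using assms(2) by simp
  have "((\<lambda>x. x / 2 + sin (k * x) * cos (k * x) / (2 * k)) has_real_derivative (cos (k * x))\<^sup>2) (at x)" for x
    using assms(1) by (auto intro!: derivative_eq_intros simp: field_simps power2_eq_square sq)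
  from unit_integral_FTC[OF this c(2)] show "(LINT x|unit_meas. (cos (k * x))\<^sup>2) = 1 / 2"
    using assms(2) by simp
  have "((\<lambda>x. (sin (k * x))\<^sup>2 / (2 * k)) has_real_derivative sin (k * x) * cos (k * x)) (at x)" for x
    using assms(1) by (auto intro!: derivative_eq_intros simp: field_simps)
  from unit_integral_FTC[OF this c(3)] show "(LINT x|unit_meas. sin (k * x) * cos (k * x)) = 0"
    using assms(2) by simp
qed

lemma trig_integrals_pi:
  assumes "n > 0"
  shows "(LINT x|unit_meas. (sin (pi * real n * x))\<^sup>2) = 1 / 2"
    "(LINT x|unit_meas. (cos (pi * real n * x))\<^sup>2) = 1 / 2"
    "(LINT x|unit_meas. sin (pi * real n * x) * cos (pi * real n * x)) = 0"
proof -
  have "pi * real n \<noteq> 0" "sin (pi * real n) = 0"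
    using assms sin_npi[of n] by (auto simp: mult.commute)
  note trig_integrals[OF this]
  then show "(LINT x|unit_meas. (sin (pi * real n * x))\<^sup>2) = 1 / 2"
    "(LINT x|unit_meas. (cos (pi * real n * x))\<^sup>2) = 1 / 2"
    "(LINT x|unit_meas. sin (pi * real n * x) * cos (pi * real n * x)) = 0" .
qed

section \<open>The matrix with ad < -1, its Cholesky factor and the symmetrised operator\<close>

locale indefinite_matrix =
  fixes a d :: real
  assumes ad: "a * d < - 1"
begin

definition "sg = sgn a"
text \<open>These are the entries of P = sg J A4^(-1), where 1 + a d is the determinant of
  \<open>A4 a d\<close>. The sign \<open>sg\<close> makes the diagonal positive.\<close>

definition "P11 = sg * d / (1 + a * d)"
definition "P12 = sg / (1 + a * d)"
definition "P22 = - sg * a / (1 + a * d)"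

text \<open>The Cholesky factor \<open>V\<close> of the positive definite matrix \<open>P\<close>, for which
  \<open>P A = \<plusminus> diag(1, -1)\<close>.\<close>

definition "vp = sqrt P11"
definition "vq = P12 / vp"
definition "vr = sqrt (P22 - vq\<^sup>2)"

definition V :: "complex ^ 2 ^ 2" where
  "V = vector [vector [of_real vp, of_real vq], vector [0, of_real vr]]"

definition U :: "complex ^ 2 ^ 2" where
  "U = vector [vector [of_real (1 / vp), of_real (- vq / (vp * vr))], vector [0, of_real (1 / vr)]]"

lemma ad_ne: "a \<noteq> 0" "d \<noteq> 0" "1 + a * d < 0" "1 + a * d \<noteq> 0"
  using ad by auto

lemma sg: "sg * sg = 1" "sg * a > 0" "sg * d < 0"
proof -
  show 1: "sg * sg = 1" using ad_ne(1) by (simp add: sg_def sgn_if)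
  show p: "sg * a > 0" using ad_ne(1) by (simp add: sg_def sgn_if)
  have "(sg * a) * (sg * d) = (sg * sg) * (a * d)" by (simp only: mult_ac)
  also have "\<dots> = a * d" by (simp only: 1 mult_1)
  also have "\<dots> < 0" using ad by linarith
  finally have "(sg * a) * (sg * d) < 0" .
  then show "sg * d < 0" using p by (meson less_imp_le mult_nonneg_nonneg not_less)
qed

lemma P_pos: "P11 > 0" "P22 > 0"
proof -
  show "P11 > 0" unfolding P11_def by (rule divide_neg_neg[OF sg(3) ad_ne(3)])
  show "P22 > 0" unfolding P22_def by (rule divide_neg_neg[OF _ ad_ne(3)]) (use sg(2) in simp)
qed

text \<open>Existence of the factor is positivity of the leading minors of P. The determinant is
  (-ad - 1)/(1 + ad)^2, which is where the strict inequality ad < -1 makes the last pivot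
  \<open>vr\<close> positive.\<close>

lemma V_entries: "vp > 0" "vr > 0" "vp\<^sup>2 = P11" "vp * vq = P12" "vq\<^sup>2 + vr\<^sup>2 = P22"
proof -
  show p: "vp > 0" "vp\<^sup>2 = P11" using P_pos by (auto simp: vp_def)
  show "vp * vq = P12" using p by (simp add: vq_def)
  have "P11 * P22 = - (sg * sg) * (a * d) / (1 + a * d)\<^sup>2"
    by (simp add: P11_def P22_def power2_eq_square mult_ac)
  moreover have "P12\<^sup>2 = sg * sg / (1 + a * d)\<^sup>2"
    by (simp add: P12_def power2_eq_square)
  moreover have "1 / (1 + a * d)\<^sup>2 < - (a * d) / (1 + a * d)\<^sup>2"
    using ad ad_ne(4) by (intro divide_strict_right_mono) auto
  ultimately have less: "P12\<^sup>2 < P11 * P22" by (simp only: sg)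
  have "P12\<^sup>2 = P11 * vq\<^sup>2" using p P_pos by (simp add: vq_def power_divide)
  with less have r: "P22 - vq\<^sup>2 > 0" using P_pos by simp
  then show "vr > 0" "vq\<^sup>2 + vr\<^sup>2 = P22" by (auto simp: vr_def)
qed

lemma UV: "U ** V = mat 1" "V ** U = mat 1"
  using V_entries(1,2)
  by (simp_all add: U_def V_def vec_eq_iff forall_2 matrix_matrix_mult_def sum_2 mat_def field_simps
      flip: of_real_mult of_real_add of_real_divide)

lemma adjoint_V: "adjoint_matrix V = vector [vector [of_real vp, 0], vector [of_real vq, of_real vr]]"
  by (simp add: adjoint_matrix_def V_def vec_eq_iff forall_2)

lemma V_signature: "adjoint_matrix V ** (V ** A4 a d) = signature_matrix sg"
proof -
  have D: "1 + a * d \<noteq> 0" by (rule ad_ne)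
  have M: "adjoint_matrix V ** V
      = vector [vector [of_real P11, of_real P12], vector [of_real P12, of_real P22]]"
    using V_entries(3-5) unfolding adjoint_V
    by (simp add: V_def vec_eq_iff forall_2 matrix_matrix_mult_def sum_2
        power2_eq_square mult.commute add.commute flip: of_real_mult of_real_add)
  have "P11 * a + P12 = sg" "- P11 + P12 * d = 0" "P12 * a + P22 = 0" "- P12 + P22 * d = - sg"
  proof -
    \<comment> \<open>Naming the common denominator makes the four entry identities polynomial,
      apart from the relation \<open>e * (1 + a * d) = 1\<close>.\<close>
    define e where "e = 1 / (1 + a * d)"
    have P: "P11 = sg * d * e" "P12 = sg * e" "P22 = - sg * a * e" and e: "e * (1 + a * d) = 1"
      using D by (simp_all add: P11_def P12_def P22_def e_def)
    have "P11 * a + P12 = sg * (e * (1 + a * d))" "- P12 + P22 * d = - sg * (e * (1 + a * d))"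
      by (simp_all add: P algebra_simps)
    then show "P11 * a + P12 = sg" "- P12 + P22 * d = - sg" by (simp_all add: e)
    show "- P11 + P12 * d = 0" "P12 * a + P22 = 0" by (simp_all add: P)
  qed
  then have "of_real P11 * of_real a + of_real P12 = (of_real sg :: complex)"
    "- of_real P11 + of_real P12 * of_real d = (0 :: complex)"
    "of_real P12 * of_real a + of_real P22 = (0 :: complex)"
    "- of_real P12 + of_real P22 * of_real d = (- of_real sg :: complex)"
    by (simp_all flip: of_real_mult of_real_add of_real_minus)
  then show ?thesis
    unfolding matrix_mul_assoc M
    by (simp add: signature_matrix_def A4_def vec_eq_iff forall_2 matrix_matrix_mult_def sum_2)
qed

definition K :: operator where "K = matrix_op (A4 a d) D_op"

text \<open>Conjugation by \<open>V\<close> turns the inner product with weight P, for which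
  \<open>K\<close> is symmetric, into the standard one. The price is a domain whose boundary
  conditions mix the components.\<close>

definition L :: operator where
  "L = \<lparr>Dom = matrix_L2 V ` Dom D_op, app = (\<lambda>f. matrix_L2 V (app K (matrix_L2 U f)))\<rparr>"

lemma UV_L2 [simp]: "matrix_L2 U (matrix_L2 V f) = f" "matrix_L2 V (matrix_L2 U f) = f"
  by (simp_all add: matrix_L2_compose UV matrix_L2_one)

lemma K_simps: "Dom K = Dom D_op" "app K f = matrix_L2 (A4 a d) (app D_op f)"
  by (simp_all add: K_def matrix_op_def)

lemma L_simps: "Dom L = matrix_L2 V ` Dom D_op" "app L (matrix_L2 V f) = matrix_L2 V (app K f)"
  by (simp_all add: L_def)

lemma linear_K: "linear_operator K"
  using linear_operatorD[OF linear_operator_D]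
  unfolding linear_operator_def K_simps by (simp add: matrix_L2_add matrix_L2_scaleC)

lemma linear_L: "linear_operator L"
  unfolding linear_operator_def
proof (intro conjI ballI allI)
  note K = linear_operatorD[OF linear_K, unfolded K_simps(1)]
  have "matrix_L2 V 0 = 0" using matrix_L2_scaleR[of V 0 0] by simp
  then show "0 \<in> Dom L" using K(1) unfolding L_simps by (metis imageI)
  fix f assume "f \<in> Dom L"
  then obtain u where u: "u \<in> Dom D_op" "f = matrix_L2 V u" by (auto simp: L_simps)
  fix c
  show "scaleC_L2 c f \<in> Dom L" "app L (scaleC_L2 c f) = scaleC_L2 c (app L f)"
    using K(4,5)[OF u(1), of c] unfolding u(2) matrix_L2_scaleC[symmetric] L_simps by auto
  fix g assume "g \<in> Dom L"
  then obtain v where v: "v \<in> Dom D_op" "g = matrix_L2 V v" by (auto simp: L_simps)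
  show "f + g \<in> Dom L" "app L (f + g) = app L f + app L g"
    using K(2,3)[OF u(1) v(1)] unfolding u(2) v(2) matrix_L2_add[symmetric] L_simps by auto
qed

text \<open>Moving the outer \<open>V\<close> across the inner product produces the adjoint of
  \<open>V\<close> times \<open>V\<close>, that is P, in front of \<open>A4 a d\<close>. The whole
  product is the signature matrix.\<close>

lemma form_L:
  "cinner (app L (matrix_L2 V u)) (matrix_L2 V v) = cinner (matrix_L2 (signature_matrix sg) (app D_op u)) v"
  by (simp add: L_simps K_simps cinner_matrix_right matrix_L2_compose V_signature)

lemma symmetric_L:
  assumes "f \<in> Dom L" "g \<in> Dom L"
  shows "cinner (app L f) g = cinner f (app L g)"
proof -
  obtain u v where uv: "u \<in> Dom D_op" "f = matrix_L2 V u" "v \<in> Dom D_op" "g = matrix_L2 V v"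
    using assms by (auto simp: L_simps)
  show ?thesis
    unfolding cinner_commute[of f "app L g"] unfolding uv form_L
    using signature_symmetric[OF uv(1,3)] cinner_commute by metis
qed

lemma similar_K_L: "similar_operators K L"
  unfolding similar_operators_def
proof (intro exI conjI)
  show "bounded_clinear (matrix_L2 U)" "bounded_clinear (matrix_L2 V)"
    by (rule bounded_clinear_matrix)+
  show "matrix_L2 U \<circ> matrix_L2 V = id" "matrix_L2 V \<circ> matrix_L2 U = id"
    by (auto simp: fun_eq_iff)
  show "Dom K = matrix_L2 U ` Dom L"
    by (auto simp: K_simps L_simps image_image)
  show "\<forall>f\<in>Dom K. app K f = matrix_L2 U (app L (matrix_L2 V f))"
    by (simp add: L_simps)
qed

text \<open>The bound for the symmetric operator \<open>L\<close> is carried back to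
  \<open>K\<close>, weakened by the norms of \<open>V\<close> and its inverse
  \<open>U\<close>.\<close>

lemma lower_bound_K:
  assumes "z \<notin> \<real>"
  obtains c where "c > 0" "\<And>f. f \<in> Dom K \<Longrightarrow> c * norm f \<le> norm (app K f - scaleC_L2 z f)"
proof -
  obtain C1 where C1: "C1 > 0" "\<And>f. norm (matrix_L2 V f) \<le> C1 * norm f"
    using norm_matrix_L2_le[of V] by blast
  obtain C2 where C2: "C2 > 0" "\<And>f. norm (matrix_L2 U f) \<le> C2 * norm f"
    using norm_matrix_L2_le[of U] by blast
  have z: "\<bar>Im z\<bar> > 0" using assms by (auto simp: complex_is_Real_iff)
  have "\<bar>Im z\<bar> / (C1 * C2) * norm f \<le> norm (app K f - scaleC_L2 z f)" if f: "f \<in> Dom K" for f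
  proof -
    have "\<bar>Im z\<bar> * norm (matrix_L2 V f) \<le> norm (app L (matrix_L2 V f) - scaleC_L2 z (matrix_L2 V f))"
      by (rule symmetric_lower_bound[OF symmetric_L]) (use f in \<open>auto simp: L_simps K_simps\<close>)
    also have "\<dots> = norm (matrix_L2 V (app K f - scaleC_L2 z f))"
      by (simp add: L_simps matrix_L2_diff matrix_L2_scaleC)
    also have "\<dots> \<le> C1 * norm (app K f - scaleC_L2 z f)" by (rule C1)
    finally have 1: "\<bar>Im z\<bar> * norm (matrix_L2 V f) \<le> C1 * norm (app K f - scaleC_L2 z f)" .
    have "\<bar>Im z\<bar> * norm f \<le> \<bar>Im z\<bar> * (C2 * norm (matrix_L2 V f))"
      using C2(2)[of "matrix_L2 V f"] by (intro mult_left_mono) auto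
    also have "\<dots> \<le> C2 * (C1 * norm (app K f - scaleC_L2 z f))"
      using mult_left_mono[OF 1, of C2] C2(1) by (simp add: mult_ac)
    finally show ?thesis using C1(1) C2(1) by (simp add: field_simps)
  qed
  then show thesis using that[of "\<bar>Im z\<bar> / (C1 * C2)"] z C1(1) C2(1) by simp
qed

lemma surj_K:
  assumes z: "z \<notin> \<real>"
  shows "\<exists>f\<in>Dom K. app K f - scaleC_L2 z f = h"
proof -
  \<comment> \<open>The square root of the discriminant of the characteristic polynomial of
    \<open>A4 a d\<close>. It is positive because the determinant 1 + ad is negative, so the
    eigenvalues are real, distinct and nonzero.\<close>
  define r where "r = sqrt ((a + d)\<^sup>2 - 4 * (1 + a * d))"
  have "4 * (1 + a * d) < 0" using ad_ne(3) by simp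
  also have "0 \<le> (a + d)\<^sup>2" by simp
  finally have pos: "(a + d)\<^sup>2 - 4 * (1 + a * d) > 0" by simp
  then have r: "r > 0" "r\<^sup>2 = (a + d)\<^sup>2 - 4 * (1 + a * d)"
    by (auto simp: r_def)
  define m1 where "m1 = (a + d + r) / 2"
  define m2 where "m2 = (a + d - r) / 2"
  have quad: "m\<^sup>2 - (a + d) * m + (1 + a * d) = 0" if "m = m1 \<or> m = m2" for m
  proof -
    have "(2 * m - (a + d))\<^sup>2 = r\<^sup>2"
    proof -
      have "2 * m - (a + d) = r \<or> 2 * m - (a + d) = - r"
        using that by (auto simp: m1_def m2_def)
      then show ?thesis by (elim disjE) (simp_all only: power2_minus)
    qed
    then have "4 * (m\<^sup>2 - (a + d) * m) = r\<^sup>2 - (a + d)\<^sup>2"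
      by (simp add: power2_eq_square algebra_simps)
    then show ?thesis using r(2) by simp
  qed
  have mne: "m \<noteq> 0" if "m = m1 \<or> m = m2" for m
  proof
    assume "m = 0"
    with quad[OF that] have "1 + a * d = 0" by simp
    then show False using ad_ne(4) by contradiction
  qed
  \<comment> \<open>The first row of the eigenvalue equation forces the second entry to be a - m,
    since the off-diagonal entry is -1; the second row is then the characteristic equation.\<close>
  have eig: "A4 a d *v vector [1, of_real (a - m)] = of_real m *s vector [1, of_real (a - m)]"
    if "m = m1 \<or> m = m2" for m
  proof -
    have "1 + d * (a - m) = m * (a - m)"
      using quad[OF that] by (simp add: power2_eq_square algebra_simps)
    from arg_cong[OF this, of complex_of_real]
    have "1 + of_real d * of_real (a - m) = (of_real m * of_real (a - m) :: complex)"
      by (simp only: of_real_add of_real_mult of_real_1)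
    then show ?thesis
      by (simp add: A4_def vec_eq_iff forall_2 matrix_vector_mult_def sum_2)
  qed
  interpret eigen_matrix "A4 a d" "of_real m1" "of_real m2" "of_real (a - m1)" "of_real (a - m2)" z
  proof
    show "complex_of_real (a - m1) \<noteq> complex_of_real (a - m2)"
      unfolding of_real_eq_iff using r(1) by (simp add: m1_def m2_def)
    show "z \<noteq> 0" using z by auto
  qed (use eig mne in auto)
  obtain c where c: "c > 0" "\<And>f. f \<in> Dom K \<Longrightarrow> c * norm f \<le> norm (app K f - scaleC_L2 z f)"
    using lower_bound_K[OF z] by blast
  have "f = 0" if "f \<in> Dom D_op" "matrix_L2 (A4 a d) (app D_op f) - scaleC_L2 z f = 0" for f
    using c(2)[of f] that c(1) by (simp add: K_simps mult_le_0_iff)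
  then show ?thesis using bvp_solvable[of h] by (simp add: K_simps)
qed

lemma Spec_K: "Spec K \<subseteq> \<real>"
proof
  fix z assume "z \<in> Spec K"
  then have nr: "z \<notin> resolvent_set K" by (simp add: Spec_def)
  show "z \<in> \<real>"
  proof (rule ccontr)
    assume z: "z \<notin> \<real>"
    obtain c where "c > 0" "\<And>f. f \<in> Dom K \<Longrightarrow> c * norm f \<le> norm (app K f - scaleC_L2 z f)"
      using lower_bound_K[OF z] by blast
    from resolvent_setI[OF linear_K this surj_K[OF z]] nr show False by blast
  qed
qed

text \<open>Surjectivity of the shifts and density of the domain transfer from \<open>K\<close> and
  \<open>D_op\<close>, because \<open>V\<close> is a bounded bijection with inverse
  \<open>U\<close>.\<close>

lemma self_adjoint_L: "self_adjoint L"
proof (rule self_adjointI[OF linear_L _ symmetric_L])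
  show "\<exists>f\<in>Dom L. app L f - scaleC_L2 z f = h" if z: "z \<notin> \<real>" for z h
  proof -
    obtain f where f: "f \<in> Dom K" "app K f - scaleC_L2 z f = matrix_L2 U h"
      using surj_K[OF z] by blast
    have "app L (matrix_L2 V f) - scaleC_L2 z (matrix_L2 V f) = matrix_L2 V (app K f - scaleC_L2 z f)"
      by (simp add: L_simps matrix_L2_diff matrix_L2_scaleC)
    also have "\<dots> = h" by (simp add: f(2))
    finally show ?thesis using f(1) by (auto simp: L_simps K_simps)
  qed
  obtain C where C: "C > 0" "\<And>f. norm (matrix_L2 V f) \<le> C * norm f"
    using norm_matrix_L2_le[of V] by blast
  have "h \<in> closure (Dom L)" for h
    unfolding closure_approachable
  proof (intro allI impI)
    fix e :: real assume e: "e > 0"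
    have "matrix_L2 U h \<in> closure (Dom D_op)" using dense_D by simp
    then obtain u where u: "u \<in> Dom D_op" "dist u (matrix_L2 U h) < e / C"
      unfolding closure_approachable using e C(1) by (meson divide_pos_pos)
    have "dist (matrix_L2 V u) h = norm (matrix_L2 V (u - matrix_L2 U h))"
      by (simp add: dist_norm matrix_L2_diff)
    also have "\<dots> \<le> C * norm (u - matrix_L2 U h)" by (rule C)
    also have "\<dots> < e" using u(2) C(1) by (simp add: dist_norm field_simps)
    finally show "\<exists>y\<in>Dom L. dist y h < e" using u(1) by (auto simp: L_simps)
  qed
  then show "closure (Dom L) = UNIV" by blast
qed

section \<open>Trial functions and the numerical range\<close>

definition trig :: "nat \<Rightarrow> real \<Rightarrow> real \<Rightarrow> real \<Rightarrow> complex ^ 2" where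
  "trig n \<sigma> \<tau> x = vector [of_real (\<sigma> * sin (pi * n * x)), of_real (\<tau> * cos (pi * n * x))]"

definition trig' :: "nat \<Rightarrow> real \<Rightarrow> real \<Rightarrow> real \<Rightarrow> complex ^ 2" where
  "trig' n \<sigma> \<tau> x = vector [of_real (pi * n * \<sigma> * cos (pi * n * x)), of_real (- pi * n * \<tau> * sin (pi * n * x))]"

lemma vec2_derivative:
  assumes "(f has_real_derivative f') (at x)" "(g has_real_derivative g') (at x)"
  shows "((\<lambda>x. vector [of_real (f x), of_real (g x)] :: complex ^ 2) has_vector_derivative
    vector [of_real f', of_real g']) (at x within S)"
proof -
  have e: "vector [of_real u, of_real v] = u *\<^sub>R axis 1 (1 :: complex) + v *\<^sub>R (axis 2 1 :: complex ^ 2)"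
    for u v :: real
    by (simp add: vec_eq_iff forall_2 axis_def scaleR_conv_of_real[where 'a = complex])
  have "((\<lambda>x. f x *\<^sub>R axis 1 (1 :: complex) + g x *\<^sub>R (axis 2 1 :: complex ^ 2)) has_vector_derivative
      (f x *\<^sub>R 0 + f' *\<^sub>R axis 1 1) + (g x *\<^sub>R 0 + g' *\<^sub>R axis 2 1)) (at x)"
    by (intro has_vector_derivative_add has_vector_derivative_scaleR assms has_vector_derivative_const)
  then show ?thesis
    unfolding e by (simp add: has_vector_derivative_at_within)
qed

text \<open>Both components are eigenfunctions of minus the second derivative for the same
  eigenvalue: the sine matches the Dirichlet conditions and the cosine the Neumann conditions. The
  amplitudes \<sigma> and \<tau> remain free.\<close>

lemma trig_H2:
  "H2 (trig n \<sigma> \<tau>) (trig' n \<sigma> \<tau>) (trig n (- (pi * n)\<^sup>2 * \<sigma>) (- (pi * n)\<^sup>2 * \<tau>))"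
proof (rule H2I_C2)
  show d1: "(trig n \<sigma> \<tau> has_vector_derivative trig' n \<sigma> \<tau> x) (at x within S)" for \<sigma> \<tau> x S
    unfolding trig_def[abs_def] trig'_def
    by (rule vec2_derivative) (auto intro!: derivative_eq_intros simp: algebra_simps)
  show "(trig' n \<sigma> \<tau> has_vector_derivative trig n (- (pi * n)\<^sup>2 * \<sigma>) (- (pi * n)\<^sup>2 * \<tau>) x) (at x within {0..1})" for x
    unfolding trig'_def[abs_def] trig_def
    by (rule vec2_derivative) (auto intro!: derivative_eq_intros simp: algebra_simps power2_eq_square)
  show "continuous_on {0..1} (trig n (- (pi * n)\<^sup>2 * \<sigma>) (- (pi * n)\<^sup>2 * \<tau>))"
    unfolding continuous_on_eq_continuous_within
    using has_vector_derivative_continuous d1 by blast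
qed

lemma trig_boundary: "boundary_conditions (trig n \<sigma> \<tau>) (trig' n \<sigma> \<tau>)"
  using sin_npi[of n] by (simp add: boundary_conditions_def trig_def trig'_def mult.commute)

lemma trig_form:
  assumes "n > 0"
  shows "cinner (app L (matrix_L2 V (abs_L2 (trig n \<sigma> \<tau>)))) (matrix_L2 V (abs_L2 (trig n \<sigma> \<tau>)))
    = of_real (sg * (pi * n)\<^sup>2 * (\<sigma>\<^sup>2 - \<tau>\<^sup>2) / 2)"
proof -
  have e1: "trig' n \<sigma> \<tau> x $ 1 * cnj (trig' n \<sigma> \<tau> x $ 1) = complex_of_real ((pi * n * \<sigma>)\<^sup>2 * (cos (pi * n * x))\<^sup>2)"
    and e2: "trig' n \<sigma> \<tau> x $ 2 * cnj (trig' n \<sigma> \<tau> x $ 2) = complex_of_real ((pi * n * \<tau>)\<^sup>2 * (sin (pi * n * x))\<^sup>2)" for x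
    by (simp_all add: trig'_def power2_eq_square mult_ac)
  show ?thesis
    unfolding form_L signature_form[OF trig_H2 trig_boundary trig_H2 trig_boundary] e1 e2
      integral_complex_of_real
    by (simp only: integral_mult_right_zero trig_integrals_pi[OF assms])
      (simp add: power_mult_distrib algebra_simps)
qed

text \<open>The squared norm of \<open>V\<close> applied to a vector is the quadratic form of P. Its
  mixed term integrates to zero because sine and cosine of the same frequency are orthogonal on the
  interval.\<close>

lemma trig_norm:
  assumes "n > 0"
  shows "(norm (matrix_L2 V (abs_L2 (trig n \<sigma> \<tau>))))\<^sup>2 = (P11 * \<sigma>\<^sup>2 + P22 * \<tau>\<^sup>2) / 2"
proof -
  have s: "sq_int (trig n \<sigma> \<tau>)" by (rule sq_int_continuous[OF H2_continuous(2)[OF trig_H2]])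
  let ?s = "\<lambda>x. sin (pi * n * x)" and ?c = "\<lambda>x. cos (pi * n * x)"
  have i: "integrable unit_meas (\<lambda>x. (?s x)\<^sup>2)" "integrable unit_meas (\<lambda>x. (?c x)\<^sup>2)"
    "integrable unit_meas (\<lambda>x. ?s x * ?c x)"
    by (intro integrable_sq_int sq_int_continuous continuous_intros)+
  have e: "(norm (V *v trig n \<sigma> \<tau> x))\<^sup>2
      = (P11 * \<sigma>\<^sup>2) * (?s x)\<^sup>2 + (P22 * \<tau>\<^sup>2) * (?c x)\<^sup>2 + (2 * P12 * \<sigma> * \<tau>) * (?s x * ?c x)" for x
  proof -
    have "(V *v trig n \<sigma> \<tau> x) $ 1 = of_real (vp * (\<sigma> * ?s x) + vq * (\<tau> * ?c x))"
      "(V *v trig n \<sigma> \<tau> x) $ 2 = of_real (vr * (\<tau> * ?c x))"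
      by (simp_all add: V_def trig_def matrix_vector_mult_def sum_2)
    then have "(norm (V *v trig n \<sigma> \<tau> x))\<^sup>2
        = (vp * (\<sigma> * ?s x) + vq * (\<tau> * ?c x))\<^sup>2 + (vr * (\<tau> * ?c x))\<^sup>2"
      by (simp add: norm_vec_def L2_set_def sum_2 norm_of_real del: of_real_add of_real_mult)
    also have "\<dots> = (vp\<^sup>2 * \<sigma>\<^sup>2) * (?s x)\<^sup>2 + ((vq\<^sup>2 + vr\<^sup>2) * \<tau>\<^sup>2) * (?c x)\<^sup>2
        + (2 * (vp * vq) * \<sigma> * \<tau>) * (?s x * ?c x)"
      by (simp add: power2_eq_square algebra_simps)
    finally show ?thesis by (simp only: V_entries)
  qed
  have "(norm (matrix_L2 V (abs_L2 (trig n \<sigma> \<tau>))))\<^sup>2 = (LINT x|unit_meas. (norm (V *v trig n \<sigma> \<tau> x))\<^sup>2)"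
    by (simp add: abs_L2_simps s norm_abs_L2_sq sq_int_matrix)
  also have "\<dots> = (P11 * \<sigma>\<^sup>2 + P22 * \<tau>\<^sup>2) / 2"
    unfolding e using i by (simp add: trig_integrals_pi[OF assms] add_divide_distrib)
  finally show ?thesis .
qed

lemma numerical_range_L: "numerical_range L = \<real>"
proof
  show "numerical_range L \<subseteq> \<real>"
  proof
    fix z assume "z \<in> numerical_range L"
    then obtain f where f: "f \<in> Dom L" "z = cinner (app L f) f" by (auto simp: numerical_range_def)
    have "z = cnj z"
      using symmetric_L[OF f(1) f(1)] cinner_commute[of f "app L f"] f(2) by simp
    then show "z \<in> \<real>" by (metis Reals_cnj_iff)
  qed
  show "\<real> \<subseteq> numerical_range L"
  proof
    fix z :: complex assume "z \<in> \<real>"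
    then obtain l where l: "z = of_real l" by (auto elim: Reals_cases)
    \<comment> \<open>A large frequency makes \<delta>, of size |l| / N, so small that |\<delta>|
      (P11 + P22) < 1, which keeps the squared amplitudes chosen below nonnegative.\<close>
    obtain n :: nat where n: "\<bar>l\<bar> * (P11 + P22) < real n" using reals_Archimedean2 by blast
    have n0: "n > 0" using n P_pos by (cases n) (auto simp: mult_less_0_iff)
    define N where "N = (pi * n)\<^sup>2"
    have "pi * n \<ge> 1 * real n" using pi_gt3 by (intro mult_right_mono) auto
    moreover have "real n \<ge> 1" using n0 by simp
    ultimately have "pi * n \<ge> 1" by linarith
    then have "N \<ge> pi * n" unfolding N_def by (rule self_le_power) simp
    then have N: "N > \<bar>l\<bar> * (P11 + P22)" "N > 0"
      using n \<open>pi * n \<ge> 1 * real n\<close> \<open>pi * n \<ge> 1\<close> by linarith+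
    define \<delta> where "\<delta> = sg * l / N"
    have "\<bar>\<delta>\<bar> = \<bar>l\<bar> / N" using N ad_ne(1) by (simp add: \<delta>_def abs_mult sg_def abs_sgn_eq)
    then have "\<bar>\<delta>\<bar> * (P11 + P22) = \<bar>l\<bar> * (P11 + P22) / N" by simp
    also have "\<dots> < 1" using N by (simp add: divide_less_eq)
    finally have \<delta>: "\<bar>\<delta>\<bar> * (P11 + P22) < 1" .
    have "\<bar>\<delta> * P11\<bar> < 1" "\<bar>\<delta> * P22\<bar> < 1"
    proof -
      have "\<bar>\<delta> * P11\<bar> \<le> \<bar>\<delta>\<bar> * (P11 + P22)" "\<bar>\<delta> * P22\<bar> \<le> \<bar>\<delta>\<bar> * (P11 + P22)"
        using P_pos mult_left_mono[of P11 "P11 + P22" "\<bar>\<delta>\<bar>"] mult_left_mono[of P22 "P11 + P22" "\<bar>\<delta>\<bar>"]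
        by (simp_all add: abs_mult)
      then show "\<bar>\<delta> * P11\<bar> < 1" "\<bar>\<delta> * P22\<bar> < 1" using \<delta> by linarith+
    qed
    then have nn: "1 + \<delta> * P22 \<ge> 0" "1 - \<delta> * P11 \<ge> 0" by linarith+
    \<comment> \<open>The squares solve the linear system P11 \<sigma>^2 + P22 \<tau>^2 = 2 and
      \<sigma>^2 - \<tau>^2 = 2 \<delta>: unit norm, and value sg N \<delta> = l of the
      form.\<close>
    define \<sigma> where "\<sigma> = sqrt (2 * (1 + \<delta> * P22) / (P11 + P22))"
    define \<tau> where "\<tau> = sqrt (2 * (1 - \<delta> * P11) / (P11 + P22))"
    have sq: "\<sigma>\<^sup>2 = 2 * (1 + \<delta> * P22) / (P11 + P22)" "\<tau>\<^sup>2 = 2 * (1 - \<delta> * P11) / (P11 + P22)"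
      using nn P_pos by (auto simp: \<sigma>_def \<tau>_def)
    have S: "P11 + P22 \<noteq> 0" using P_pos by simp
    have "\<sigma>\<^sup>2 - \<tau>\<^sup>2 = 2 * \<delta> * (P11 + P22) / (P11 + P22)"
      unfolding sq by (simp only: diff_divide_distrib[symmetric]) (simp add: algebra_simps)
    then have d1: "(\<sigma>\<^sup>2 - \<tau>\<^sup>2) / 2 = \<delta>" using S by simp
    have "P11 * \<sigma>\<^sup>2 + P22 * \<tau>\<^sup>2 = 2 * (P11 + P22) / (P11 + P22)"
      unfolding sq by (simp only: times_divide_eq_right add_divide_distrib[symmetric]) (simp add: algebra_simps)
    then have d2: "(P11 * \<sigma>\<^sup>2 + P22 * \<tau>\<^sup>2) / 2 = 1" using S by simp
    let ?f = "matrix_L2 V (abs_L2 (trig n \<sigma> \<tau>))"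
    have "?f \<in> Dom L" using D_opI(1)[OF trig_H2 trig_boundary] by (simp add: L_simps)
    moreover have "norm ?f = 1"
      by (rule power2_eq_imp_eq) (use trig_norm[OF n0, of \<sigma> \<tau>] d2 in simp_all)
    moreover have "sg * N * (\<sigma>\<^sup>2 - \<tau>\<^sup>2) / 2 = l"
    proof -
      have "sg * N * (\<sigma>\<^sup>2 - \<tau>\<^sup>2) / 2 = sg * N * \<delta>" using d1 by simp
      also have "\<dots> = (sg * sg) * l" using N by (simp add: \<delta>_def)
      finally show ?thesis by (simp add: sg)
    qed
    then have "cinner (app L ?f) ?f = z"
      unfolding trig_form[OF n0] l N_def[symmetric] by simp
    ultimately show "z \<in> numerical_range L" unfolding numerical_range_def by blast
  qed
qed

end

subsection \<open>The degenerate case\<close>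

lemma degenerate_not_surjective:
  assumes ad: "a * d = - 1"
  shows "\<exists>h. \<forall>f\<in>Dom D_op. matrix_L2 (A4 a d) (app D_op f) - scaleC_L2 z f \<noteq> h"
proof -
  \<comment> \<open>The row (-1, a) takes the values 0 and -1 on the two halves of this function, so
    the combination jumps at 1/2.\<close>
  define h0 :: "real \<Rightarrow> complex ^ 2" where "h0 x = (if x \<le> 1 / 2 then 0 else vector [1, 0])" for x
  have h0: "sq_int h0"
  proof (rule sq_int_bound[OF sq_int_const[of "1 :: real"]])
    have "h0 \<in> borel_measurable borel"
      unfolding h0_def[abs_def] by measurable
    then show "h0 \<in> borel_measurable unit_meas"
      by (intro measurable_restrict_space1 measurable_completion) simp
    show "norm (h0 x) \<le> 1 * norm (1 :: real)" for x
      by (simp add: h0_def norm_vec_def L2_set_def sum_2)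
  qed
  have False if f: "f \<in> Dom D_op" "matrix_L2 (A4 a d) (app D_op f) - scaleC_L2 z f = abs_L2 h0" for f
  proof -
    from f(1) obtain F F' g where F: "H2 F F' g" "boundary_conditions F F'" "sq_int F" "sq_int g"
      "f = abs_L2 F" "app D_op f = abs_L2 (\<lambda>x. - g x)" by (rule D_opE)
    have "abs_L2 (\<lambda>x. A4 a d *v (- g x) - z *s F x) = abs_L2 h0"
      using f(2) F by (simp add: abs_L2_simps sq_int_minus sq_int_matrix sq_int_scaleC)
    then have ae: "AE x in unit_meas. A4 a d *v (- g x) - z *s F x = h0 x"
      by (subst (asm) abs_L2_eq_iff) (intro sq_int_diff sq_int_matrix sq_int_minus sq_int_scaleC F h0 | simp)+
    \<comment> \<open>Applying the row (-1, a) to the equation removes the second derivative and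
      leaves only \<open>F\<close>, which is continuous whatever the value of
      \<open>z\<close>.\<close>
    define k where "k x = z * (F x $ 1 - of_real a * F x $ 2)" for x
    have "continuous_on {0..1} F" by (rule H2_continuous[OF F(1)])
    then have ck: "continuous_on {0..1} k"
      unfolding k_def[abs_def] by (intro continuous_intros)
    have hk: "- h0 x $ 1 + of_real a * h0 x $ 2 = k x" if "A4 a d *v (- g x) - z *s F x = h0 x" for x
    proof -
      have "of_real a * of_real d = (- 1 :: complex)"
        using arg_cong[OF ad, of complex_of_real] by simp
      then have "of_real a * (of_real d * g x $ 2) = - (g x $ 2)"
        by (simp flip: mult.assoc)
      then show ?thesis
        unfolding that[symmetric] k_def
        by (simp add: A4_def matrix_vector_mult_def sum_2 algebra_simps)
    qed
    \<comment> \<open>Almost everywhere equality on each open half extends to the common end point,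
      where the left half gives 0 and the right half gives -1.\<close>
    have "k (1/2) = 0"
    proof (rule AE_eq_imp_eq_subinterval[of 0 "1/2"])
      show "AE x in unit_meas. 0 < x \<and> x < 1 / 2 \<longrightarrow> k x = 0"
        using ae
      proof eventually_elim
        case (elim x)
        show ?case using hk[OF elim] by (auto simp: h0_def)
      qed
      show "continuous_on {0..1 / 2} k" by (rule continuous_on_subset[OF ck]) auto
    qed auto
    moreover have "k (1/2) = - 1"
    proof (rule AE_eq_imp_eq_subinterval[of "1/2" 1])
      show "AE x in unit_meas. 1 / 2 < x \<and> x < 1 \<longrightarrow> k x = - 1"
        using ae
      proof eventually_elim
        case (elim x)
        show ?case using hk[OF elim] by (auto simp: h0_def)
      qed
      show "continuous_on {1 / 2..1} k" by (rule continuous_on_subset[OF ck]) auto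
    qed auto
    ultimately show False by simp
  qed
  then show ?thesis by blast
qed

theorem theorem21:
  fixes a d :: real
  shows "(a * d = - 1 \<longrightarrow> Spec (matrix_op (A4 a d) D_op) = UNIV) \<and>
    (a * d < - 1 \<longrightarrow>
       Spec (matrix_op (A4 a d) D_op) \<subseteq> \<real> \<and>
       (\<exists>L. self_adjoint L \<and> similar_operators (matrix_op (A4 a d) D_op) L \<and>
            numerical_range L = \<real>))"
proof (intro conjI impI)
  assume ad: "a * d = - 1"
  have "z \<notin> resolvent_set (matrix_op (A4 a d) D_op)" for z
  proof
    assume "z \<in> resolvent_set (matrix_op (A4 a d) D_op)"
    then have im: "(\<lambda>f. matrix_L2 (A4 a d) (app D_op f) - scaleC_L2 z f) ` Dom D_op = UNIV"
      by (simp add: resolvent_set_def matrix_op_def bij_betw_def)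
    obtain h where h: "\<forall>f\<in>Dom D_op. matrix_L2 (A4 a d) (app D_op f) - scaleC_L2 z f \<noteq> h"
      using degenerate_not_surjective[OF ad] by blast
    have "h \<in> (\<lambda>f. matrix_L2 (A4 a d) (app D_op f) - scaleC_L2 z f) ` Dom D_op"
      unfolding im by simp
    then show False using h by (elim imageE) blast
  qed
  then show "Spec (matrix_op (A4 a d) D_op) = UNIV" by (auto simp: Spec_def)
next
  assume "a * d < - 1"
  then interpret indefinite_matrix a d by unfold_locales
  show "Spec (matrix_op (A4 a d) D_op) \<subseteq> \<real>" using Spec_K by (simp add: K_def)
  show "\<exists>L. self_adjoint L \<and> similar_operators (matrix_op (A4 a d) D_op) L \<and> numerical_range L = \<real>"
    using self_adjoint_L similar_K_L numerical_range_L by (auto simp: K_def)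
qed

end
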